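(* Let $E \subset \mathbb{R}^n$ be a bounded nontrivial measurable set. Let $s\in \mathbb{R}$, $p \in [1,\infty]$ (with $p<\infty$ in all assertions about the spaces $F^{s,\tau}_{p,q}(\mathbb{R}^n)$), and $\tau \in (0,\infty)$. (i) ${\bf 1}_E \notin B^{1/p, \tau}_{p,q} (\mathbb{R}^n)$ for all $q\in(0,\infty)$. (ii) ${\bf 1}_E \notin F^{1/p, \tau}_{p,q} (\mathbb{R}^n)$ for all $q\in [1,\infty]$. (iii) If $s> n(\frac 1p - \tau)$, then ${\bf 1}_E \notin B^{s, \tau}_{p,q} (\mathbb{R}^n)$ for all $q\in [1,\infty]$. (iv) If $s> n(\frac 1p - \tau)$, then ${\bf 1}_E \notin F^{s, \tau}_{p,q} (\mathbb{R}^n)$ for all $q\in [1,\infty]$.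
   Context: ${\bf 1}_E$ denotes the characteristic function of $E$; "nontrivial" means that $E$ has positive Lebesgue measure. Dyadic cubes: for $j\in\mathbb{Z}$, $k\in\mathbb{Z}^n$ let $Q_{j,k}:=2^{-j}([0,1)^n+k)$; $\mathcal{Q}$ is the set of all of them; $\ell(P)$ is the edge length of $P$ and $j_P:=-\log_2\ell(P)$. Function spaces: fix $\varphi_0,\varphi\in\mathcal{S}(\mathbb{R}^n)$ with real-valued nonnegative Fourier transforms such that $\mathrm{supp}\,\mathcal{F}\varphi_0\subset\{|\xi|\le 2\}$, $|\mathcal{F}\varphi_0(\xi)|\ge C>0$ for $|\xi|\le 5/3$, $\mathrm{supp}\,\mathcal{F}\varphi\subset\{1/2\le|\xi|\le 2\}$, $|\mathcal{F}\varphi(\xi)|\ge C>0$ for $3/5\le|\xi|\le 5/3$; put $\varphi_j:=2^{jn}\varphi(2^j\cdot)$ for $j\ge 1$. For $s\in\mathbb{R}$, $\tau\in[0,\infty)$, $p,q\in(0,\infty]$, the Besov-type space $B^{s,\tau}_{p,q}(\mathbb{R}^n)$ is the set of all $f\in\mathcal{S}'(\mathbb{R}^n)$ with $$\|f\|_{B^{s,\tau}_{p,q}(\mathbb{R}^n)}:=\sup_{P\in\mathcal{Q}}\frac1{|P|^{\tau}}\Big\{\sum_{j=\max\{j_P,0\}}^\infty 2^{js q}\Big[\int_P|\varphi_j\ast f(x)|^p\,dx\Big]^{q/p}\Big\}^{1/q}<\infty,$$ and, for $p<\infty$, the Triebel--Lizorkin-type space $F^{s,\tau}_{p,q}(\mathbb{R}^n)$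 is the set of all $f\in\mathcal{S}'(\mathbb{R}^n)$ with $$\|f\|_{F^{s,\tau}_{p,q}(\mathbb{R}^n)}:=\sup_{P\in\mathcal{Q}}\frac1{|P|^{\tau}}\Big\{\int_P\Big[\sum_{j=\max\{j_P,0\}}^\infty 2^{js q}|\varphi_j\ast f(x)|^q\Big]^{p/q}dx\Big\}^{1/p}<\infty,$$ with the usual modifications if $p=\infty$ and/or $q=\infty$. The spaces do not depend on the choice of $\varphi_0,\varphi$. *)

theory Defs
  imports "HOL-Analysis.Analysis" "HOL-Probability.Essential_Supremum"
begin

section \<open>Schwartz functions and tempered distributions\<close>

definition partial_deriv :: "'n::finite \<Rightarrow> (real^'n \<Rightarrow> complex) \<Rightarrow> real^'n \<Rightarrow> complex" where
  "partial_deriv i f x = frechet_derivative f (at x) (axis i 1)"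

text \<open>Mixed partial derivatives are indexed by lists of coordinate directions instead of
  multi-indices. Requiring differentiability of all of them gives exactly the smooth functions.\<close>

abbreviation partial_derivs :: "'n::finite list \<Rightarrow> (real^'n \<Rightarrow> complex) \<Rightarrow> real^'n \<Rightarrow> complex" where
  "partial_derivs is f \<equiv> foldr partial_deriv is f"

definition smooth :: "(real^'n::finite \<Rightarrow> complex) \<Rightarrow> bool" where
  "smooth f \<longleftrightarrow> (\<forall>is. partial_derivs is f differentiable_on UNIV)"

definition schwartz_space :: "(real^'n::finite \<Rightarrow> complex) set" where
  "schwartz_space = {f. smooth f \<and>
     (\<forall>k is. bounded (range (\<lambda>x. (1 + norm x) ^ k *\<^sub>R partial_derivs is f x)))}"

definition schwartz_seminorm :: "nat \<Rightarrow> 'n::finite list \<Rightarrow> (real^'n \<Rightarrow> complex) \<Rightarrow> real" where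
  "schwartz_seminorm k is f = (SUP x. (1 + norm x) ^ k * norm (partial_derivs is f x))"

text \<open>Continuity of a linear functional is expressed, as usual for a space topologised by a
  family of seminorms, by a bound through finitely many of them. Functionals are total in HOL;
  their values outside of the Schwartz space are unconstrained and never used.\<close>

definition tempered_distributions :: "((real^'n::finite \<Rightarrow> complex) \<Rightarrow> complex) set" where
  "tempered_distributions = {f.
     (\<forall>\<psi>\<in>schwartz_space. \<forall>\<eta>\<in>schwartz_space. \<forall>a b.
        f (\<lambda>x. a * \<psi> x + b * \<eta> x) = a * f \<psi> + b * f \<eta>) \<and>
     (\<exists>C N. \<forall>\<psi>\<in>schwartz_space.
        norm (f \<psi>) \<le> C * (\<Sum>is | length is \<le> N. schwartz_seminorm N is \<psi>))}"

definition regular_distribution ::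
    "(real^'n::finite \<Rightarrow> complex) \<Rightarrow> (real^'n \<Rightarrow> complex) \<Rightarrow> complex" where
  "regular_distribution g \<psi> = (LINT x|lebesgue. g x * \<psi> x)"

definition distr_convolution ::
    "(real^'n::finite \<Rightarrow> complex) \<Rightarrow> ((real^'n \<Rightarrow> complex) \<Rightarrow> complex) \<Rightarrow> real^'n \<Rightarrow> complex" where
  "distr_convolution \<psi> f x = f (\<lambda>y. \<psi> (x - y))"

definition fourier_transform :: "(real^'n::finite \<Rightarrow> complex) \<Rightarrow> real^'n \<Rightarrow> complex" where
  "fourier_transform f \<xi> = of_real ((2 * pi) powr (- real CARD('n) / 2)) *
     (LINT x|lebesgue. exp (- \<i> * of_real (x \<bullet> \<xi>)) * f x)"

definition admissible_pair :: "(real^'n::finite \<Rightarrow> complex) \<Rightarrow> (real^'n \<Rightarrow> complex) \<Rightarrow> bool" where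
  "admissible_pair \<phi>0 \<phi> \<longleftrightarrow>
     \<phi>0 \<in> schwartz_space \<and> \<phi> \<in> schwartz_space \<and>
     (\<forall>\<xi>. fourier_transform \<phi>0 \<xi> \<in> \<real> \<and> 0 \<le> Re (fourier_transform \<phi>0 \<xi>)) \<and>
     (\<forall>\<xi>. fourier_transform \<phi> \<xi> \<in> \<real> \<and> 0 \<le> Re (fourier_transform \<phi> \<xi>)) \<and>
     closure {\<xi>. fourier_transform \<phi>0 \<xi> \<noteq> 0} \<subseteq> {\<xi>. norm \<xi> \<le> 2} \<and>
     (\<exists>C>0. \<forall>\<xi>. norm \<xi> \<le> 5/3 \<longrightarrow> C \<le> norm (fourier_transform \<phi>0 \<xi>)) \<and>
     closure {\<xi>. fourier_transform \<phi> \<xi> \<noteq> 0} \<subseteq> {\<xi>. 1/2 \<le> norm \<xi> \<and> norm \<xi> \<le> 2} \<and>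
     (\<exists>C>0. \<forall>\<xi>. 3/5 \<le> norm \<xi> \<and> norm \<xi> \<le> 5/3 \<longrightarrow> C \<le> norm (fourier_transform \<phi> \<xi>))"

definition dyadic_dilate ::
    "(real^'n::finite \<Rightarrow> complex) \<Rightarrow> (real^'n \<Rightarrow> complex) \<Rightarrow> nat \<Rightarrow> real^'n \<Rightarrow> complex" where
  "dyadic_dilate \<phi>0 \<phi> j =
     (if j = 0 then \<phi>0 else (\<lambda>x. 2 ^ (j * CARD('n)) * \<phi> (2 ^ j *\<^sub>R x)))"

definition dyadic_cube :: "int \<Rightarrow> int^'n::finite \<Rightarrow> (real^'n) set" where
  "dyadic_cube j k =
     (\<lambda>x. 2 powi (- j) *\<^sub>R (x + (\<chi> i. of_int (k $ i)))) ` {x. \<forall>i. 0 \<le> x $ i \<and> x $ i < 1}"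

section \<open>Lebesgue and sequence quasi-norms\<close>

text \<open>Only used for positive exponents.\<close>

definition ennreal_powr :: "ennreal \<Rightarrow> real \<Rightarrow> ennreal" where
  "ennreal_powr x a = (if x = \<infinity> then \<infinity> else ennreal (enn2real x powr a))"

definition Lp_norm :: "'a measure \<Rightarrow> ennreal \<Rightarrow> ('a \<Rightarrow> ennreal) \<Rightarrow> ennreal" where
  "Lp_norm M p f =
     (if p = \<infinity> then esssup M f
      else ennreal_powr (\<integral>\<^sup>+ x. ennreal_powr (f x) (enn2real p) \<partial>M) (1 / enn2real p))"

text \<open>The quasi-norm in \<open>\<ell>\<^sup>q\<close> of the tail of \<open>a\<close> starting at index \<open>J\<close>.\<close>

definition lq_norm_from :: "nat \<Rightarrow> ennreal \<Rightarrow> (nat \<Rightarrow> ennreal) \<Rightarrow> ennreal" where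
  "lq_norm_from J q a =
     (if q = \<infinity> then (SUP k. a (J + k))
      else ennreal_powr (\<Sum>k. ennreal_powr (a (J + k)) (enn2real q)) (1 / enn2real q))"

section \<open>Besov-type and Triebel--Lizorkin-type spaces\<close>

text \<open>The supremum over all dyadic cubes \<open>P\<close> is taken over their (unique) parameters \<open>j\<close>, \<open>k\<close>;
  then \<open>j\<close> is minus the binary logarithm of the edge length, and \<open>nat j\<close> is \<open>max j 0\<close>.\<close>

definition besov_type_norm ::
    "(real^'n::finite \<Rightarrow> complex) \<Rightarrow> (real^'n \<Rightarrow> complex) \<Rightarrow> real \<Rightarrow> real \<Rightarrow> ennreal \<Rightarrow> ennreal \<Rightarrow>
     ((real^'n \<Rightarrow> complex) \<Rightarrow> complex) \<Rightarrow> ennreal" where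
  "besov_type_norm \<phi>0 \<phi> s \<tau> p q f =
     (SUP (j, k)\<in>UNIV. let P = dyadic_cube j k in
        ennreal (1 / measure lebesgue P powr \<tau>) *
        lq_norm_from (nat j) q (\<lambda>i. ennreal (2 powr (real i * s)) *
          Lp_norm (lebesgue_on P) p
            (\<lambda>x. ennreal (norm (distr_convolution (dyadic_dilate \<phi>0 \<phi> i) f x)))))"

definition besov_type_space ::
    "(real^'n::finite \<Rightarrow> complex) \<Rightarrow> (real^'n \<Rightarrow> complex) \<Rightarrow> real \<Rightarrow> real \<Rightarrow> ennreal \<Rightarrow> ennreal \<Rightarrow>
     ((real^'n \<Rightarrow> complex) \<Rightarrow> complex) set" where
  "besov_type_space \<phi>0 \<phi> s \<tau> p q =
     {f \<in> tempered_distributions. besov_type_norm \<phi>0 \<phi> s \<tau> p q f < \<infinity>}"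

text \<open>For the Triebel--Lizorkin-type spaces only \<open>p < \<infinity>\<close> is meaningful.\<close>

definition triebel_lizorkin_type_norm ::
    "(real^'n::finite \<Rightarrow> complex) \<Rightarrow> (real^'n \<Rightarrow> complex) \<Rightarrow> real \<Rightarrow> real \<Rightarrow> ennreal \<Rightarrow> ennreal \<Rightarrow>
     ((real^'n \<Rightarrow> complex) \<Rightarrow> complex) \<Rightarrow> ennreal" where
  "triebel_lizorkin_type_norm \<phi>0 \<phi> s \<tau> p q f =
     (SUP (j, k)\<in>UNIV. let P = dyadic_cube j k in
        ennreal (1 / measure lebesgue P powr \<tau>) *
        Lp_norm (lebesgue_on P) p (\<lambda>x.
          lq_norm_from (nat j) q (\<lambda>i. ennreal (2 powr (real i * s)) *
            ennreal (norm (distr_convolution (dyadic_dilate \<phi>0 \<phi> i) f x)))))"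

definition triebel_lizorkin_type_space ::
    "(real^'n::finite \<Rightarrow> complex) \<Rightarrow> (real^'n \<Rightarrow> complex) \<Rightarrow> real \<Rightarrow> real \<Rightarrow> ennreal \<Rightarrow> ennreal \<Rightarrow>
     ((real^'n \<Rightarrow> complex) \<Rightarrow> complex) set" where
  "triebel_lizorkin_type_space \<phi>0 \<phi> s \<tau> p q =
     {f \<in> tempered_distributions. triebel_lizorkin_type_norm \<phi>0 \<phi> s \<tau> p q f < \<infinity>}"

end

theory Submission
  imports Defs "HOL-Probability.Characteristic_Functions"
begin

text \<open>A characteristic function takes only the values \<open>0\<close> and \<open>1\<close>, so any approximation of \<open>1\<^sub>E\<close>
  with error below \<open>1/4\<close> recovers its value. This rigidity is played against a scaling argument.
  A reproducing formula of Calderon type provides kernels \<open>\<Phi>\<close> and \<open>\<psi>\<close> with polynomial decay such that,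
  with \<open>\<Phi>\<^sub>j\<close>, \<open>\<psi>\<^sub>j\<close>, \<open>\<phi>\<^sub>j\<close> denoting the dyadic dilates and \<open>c\<close> the nonzero integral of \<open>\<Phi>\<close>,
  \<open>c 1\<^sub>E - \<Phi>\<^sub>J * 1\<^sub>E\<close> is dominated almost everywhere by the sum of \<open>|\<psi>\<^sub>j| * |\<phi>\<^sub>j * 1\<^sub>E|\<close> over \<open>j > J\<close>
  (\<open>Calderon_formula\<close>, \<open>mollify_remainder\<close>). The function \<open>\<Phi>\<^sub>J * 1\<^sub>E\<close> hardly varies over
  distances much smaller than \<open>2 ^ - J\<close>. Hence if the remainder is small outside of a set \<open>B\<^sub>J\<close>, then
  shifting \<open>E\<close> by a small multiple of \<open>2 ^ - J\<close> changes \<open>E\<close> only on a set of measure at most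
  \<open>2 |B\<^sub>J|\<close>. A shift that makes \<open>E\<close> disjoint from itself consists of about \<open>2 ^ J\<close> such steps, so
  that \<open>|E|\<close> is bounded by a constant times \<open>2 ^ J |B\<^sub>J|\<close>. If \<open>2 ^ J |B\<^sub>J|\<close> can be made arbitrarily
  small, \<open>E\<close> is a null set (\<open>null_if_well_approximated\<close>).

  In the case \<open>s > n (1/p - \<tau>)\<close> the quasi-norm, evaluated on cubes of edge length \<open>2 ^ - j\<close>, bounds
  the averages of \<open>|\<phi>\<^sub>j * 1\<^sub>E|\<close> over these cubes by a multiple of \<open>2 ^ (- j \<epsilon>)\<close> with
  \<open>\<epsilon> = s + n \<tau> - n/p > 0\<close>. Convolution with \<open>\<psi>\<^sub>j\<close> turns this into a uniform bound, the remainder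
  tends to \<open>0\<close> uniformly and \<open>B\<^sub>J\<close> is eventually a null set (\<open>null_if_cube_norms_bounded\<close>).

  In the case \<open>s = 1/p\<close>, \<open>p < \<infinity>\<close>, only large cubes around \<open>E\<close> are used. Splitting each
  \<open>\<phi>\<^sub>j * 1\<^sub>E\<close> at a height that decreases slowly in \<open>j - J\<close>, the lower parts contribute a small
  constant to the remainder, and the upper parts have a total integral that is \<open>o(2 ^ - J)\<close>.
  For Besov-type spaces with \<open>q < \<infinity>\<close> this is because \<open>2 ^ (j/p)\<close> times the \<open>L\<^sup>p\<close> norm of
  \<open>\<phi>\<^sub>j * 1\<^sub>E\<close> tends to \<open>0\<close> (\<open>null_if_cube_norms_tend_to_0\<close>). For Triebel--Lizorkin-type spaces it is
  because the supremum over \<open>j\<close> of \<open>2 ^ (j/p) |\<phi>\<^sub>j * 1\<^sub>E|\<close> is in \<open>L\<^sup>p\<close>, so that its \<open>p\<close>-th power has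
  small integral over the set where it is large (\<open>null_if_maximal_function_Lp\<close>). The case
  \<open>p = \<infinity>\<close>, \<open>s = 0\<close> of Besov-type spaces is covered by the first one, since \<open>\<tau> > 0\<close>.\<close>

section \<open>Affine changes of variables and polynomially decaying weights\<close>

lemma nn_integral_lborel_affine:
  fixes f :: "'a::euclidean_space \<Rightarrow> ennreal"
  assumes [measurable]: "f \<in> borel_measurable borel" and c: "c \<noteq> 0"
  shows "(\<integral>\<^sup>+x. f x \<partial>lborel) = ennreal (\<bar>c\<bar> ^ DIM('a)) * (\<integral>\<^sup>+x. f (t + c *\<^sub>R x) \<partial>lborel)"
  by (subst lborel_affine[OF c, of t])
     (simp add: nn_integral_density nn_integral_distr nn_integral_cmult)

lemma nn_integral_lborel_translation:
  fixes f :: "'a::euclidean_space \<Rightarrow> ennreal"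
  assumes "f \<in> borel_measurable borel"
  shows "(\<integral>\<^sup>+x. f (t + x) \<partial>lborel) = (\<integral>\<^sup>+x. f x \<partial>lborel)"
  using nn_integral_lborel_affine[OF assms, of 1 t] by simp

lemma nn_integral_lborel_reflection:
  fixes f :: "'a::euclidean_space \<Rightarrow> ennreal"
  assumes "f \<in> borel_measurable borel"
  shows "(\<integral>\<^sup>+x. f (t - x) \<partial>lborel) = (\<integral>\<^sup>+x. f x \<partial>lborel)"
  using nn_integral_lborel_affine[OF assms, of "-1" t] by simp

lemma lborel_affine_integral:
  fixes f :: "'a::euclidean_space \<Rightarrow> 'b::{banach, second_countable_topology}"
  assumes f[measurable]: "f \<in> borel_measurable borel" and c: "c \<noteq> 0"
  shows "integrable lborel (\<lambda>x. f (t + c *\<^sub>R x)) \<longleftrightarrow> integrable lborel f"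
    and "(\<integral>x. f x \<partial>lborel) = (\<bar>c\<bar> ^ DIM('a)) *\<^sub>R (\<integral>x. f (t + c *\<^sub>R x) \<partial>lborel)"
proof -
  have eq: "(\<integral>\<^sup>+x. norm (f x) \<partial>lborel) =
      ennreal (\<bar>c\<bar> ^ DIM('a)) * (\<integral>\<^sup>+x. norm (f (t + c *\<^sub>R x)) \<partial>lborel)"
    by (rule nn_integral_lborel_affine[OF _ c, of "\<lambda>x. ennreal (norm (f x))" t]) simp
  have pos: "ennreal (\<bar>c\<bar> ^ DIM('a)) \<noteq> 0" using c by (simp add: ennreal_eq_0_iff not_le)
  show "integrable lborel (\<lambda>x. f (t + c *\<^sub>R x)) \<longleftrightarrow> integrable lborel f"
    unfolding integrable_iff_bounded eq using pos by (auto simp: ennreal_mult_less_top)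
  show "(\<integral>x. f x \<partial>lborel) = (\<bar>c\<bar> ^ DIM('a)) *\<^sub>R (\<integral>x. f (t + c *\<^sub>R x) \<partial>lborel)"
    by (subst lborel_affine[OF c, of t])
       (simp add: integral_density integral_distr)
qed

lemma integral_lborel_translation:
  fixes f :: "'a::euclidean_space \<Rightarrow> 'b::{banach, second_countable_topology}"
  assumes "f \<in> borel_measurable borel"
  shows "(\<integral>x. f (t + x) \<partial>lborel) = (\<integral>x. f x \<partial>lborel)"
    and "integrable lborel (\<lambda>x. f (t + x)) \<longleftrightarrow> integrable lborel f"
  using lborel_affine_integral[OF assms, of 1 t] by simp_all

lemma integral_lborel_reflection:
  fixes f :: "'a::euclidean_space \<Rightarrow> 'b::{banach, second_countable_topology}"
  assumes "f \<in> borel_measurable borel"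
  shows "(\<integral>x. f (t - x) \<partial>lborel) = (\<integral>x. f x \<partial>lborel)"
    and "integrable lborel (\<lambda>x. f (t - x)) \<longleftrightarrow> integrable lborel f"
  using lborel_affine_integral[OF assms, of "-1" t] by simp_all

definition weight :: "'a::euclidean_space \<Rightarrow> real" where
  "weight x = 1 / (1 + norm x) ^ (DIM('a) + 1)"

lemma weight_pos: "0 < weight x"
  by (simp add: weight_def add_pos_nonneg)

lemma weight_nonneg [simp]: "0 \<le> weight x"
  using weight_pos[of x] by simp

lemma weight_measurable [measurable]: "weight \<in> borel_measurable borel"
  unfolding weight_def by measurable

text \<open>On the dyadic shell \<open>norm x \<approx> 2 ^ k\<close>, whose volume is about \<open>2 ^ (k d)\<close>, the weight is
  about \<open>2 ^ (- k (d + 1))\<close>, so the shells contribute a geometric series.\<close>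

lemma nn_integral_weight: "(\<integral>\<^sup>+x. ennreal (weight (x::'a::euclidean_space)) \<partial>lborel) < \<infinity>"
proof -
  let ?d = "DIM('a)"
  let ?g = "\<lambda>(k::nat) x::'a. ennreal (2 ^ (?d + 1) / 2 ^ (k * (?d + 1))) * indicator (cball 0 (2 ^ k)) x"
  have bound: "ennreal (weight x) \<le> (\<Sum>k. ?g k x)" for x :: 'a
  proof -
    obtain k where k: "norm x \<le> 2 ^ k" "2 ^ k \<le> 2 * (1 + norm x)"
    proof -
      define k where "k = (LEAST k::nat. norm x \<le> 2 ^ k)"
      have ex: "\<exists>k::nat. norm x \<le> 2 ^ k"
        using real_arch_pow[of 2 "norm x"] by (auto intro: less_imp_le)
      have k1: "norm x \<le> 2 ^ k" unfolding k_def by (rule LeastI_ex[OF ex])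
      have "2 ^ k \<le> 2 * (1 + norm x)"
      proof (cases k)
        case 0 then show ?thesis by simp
      next
        case (Suc m)
        then have "\<not> norm x \<le> 2 ^ m" unfolding k_def using not_less_Least[of m "\<lambda>k. norm x \<le> 2 ^ k"] by simp
        then show ?thesis using Suc by simp
      qed
      with k1 that show thesis by blast
    qed
    have "weight x \<le> 2 ^ (?d + 1) / 2 ^ (k * (?d + 1))"
    proof -
      have "(2 ^ k) ^ (?d + 1) \<le> (2 * (1 + norm x)) ^ (?d + 1)"
        by (rule power_mono[OF k(2)]) simp
      then have "2 ^ (k * (?d + 1)) \<le> 2 ^ (?d + 1) * (1 + norm x) ^ (?d + 1)"
        by (simp only: power_mult power_mult_distrib)
      moreover have "0 < (1 + norm x) ^ (?d + 1)" by (simp add: add_pos_nonneg)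
      ultimately show ?thesis unfolding weight_def
        by (simp add: divide_simps)
    qed
    then have "ennreal (weight x) \<le> ?g k x" using k(1) by (simp add: ennreal_leI)
    also have "\<dots> \<le> (\<Sum>k. ?g k x)"
    proof -
      have "G k \<le> (\<Sum>k. G k)" for G :: "nat \<Rightarrow> ennreal"
        using sum_le_suminf[of G "{k}"] by simp
      then show ?thesis .
    qed
    finally show ?thesis .
  qed
  define V where "V = unit_ball_vol (real ?d)"
  have V: "0 \<le> V" unfolding V_def by simp
  have int: "(\<integral>\<^sup>+x. ?g k x \<partial>lborel) = ennreal (2 ^ (?d + 1) * V * (1/2) ^ k)" for k
  proof -
    have "(\<integral>\<^sup>+x. ?g k x \<partial>lborel) = ennreal (2 ^ (?d + 1) / 2 ^ (k * (?d + 1))) * ennreal (V * (2 ^ k) ^ ?d)"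
      unfolding V_def by (subst nn_integral_cmult_indicator) (simp_all add: emeasure_cball)
    also have "\<dots> = ennreal ((2 ^ (?d + 1) / 2 ^ (k * (?d + 1))) * (V * (2 ^ k) ^ ?d))"
      by (rule ennreal_mult'[symmetric]) (simp add: V)
    also have "(2 ^ (?d + 1) / 2 ^ (k * (?d + 1))) * (V * (2 ^ k) ^ ?d) = 2 ^ (?d + 1) * V * (1/2) ^ k"
      by (simp add: power_mult[symmetric] power_add field_simps)
    finally show ?thesis .
  qed
  have "(\<integral>\<^sup>+x. ennreal (weight (x::'a)) \<partial>lborel) \<le> (\<integral>\<^sup>+x. (\<Sum>k. ?g k x) \<partial>lborel)"
    by (intro nn_integral_mono bound)
  also have "\<dots> = (\<Sum>k. \<integral>\<^sup>+x. ?g k x \<partial>lborel)"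
    by (rule nn_integral_suminf)
       (intro borel_measurable_times_ennreal borel_measurable_const borel_measurable_indicator, simp)
  also have "\<dots> = (\<Sum>k. ennreal (2 ^ (?d + 1) * V * (1/2) ^ k))"
    unfolding int ..
  also have "\<dots> = ennreal (\<Sum>k. 2 ^ (?d + 1) * V * (1/2) ^ k)"
    using V by (intro suminf_ennreal2 summable_mult) auto
  also have "\<dots> < \<infinity>" by simp
  finally show ?thesis .
qed

lemma integrable_weight: "integrable lborel (weight :: 'a::euclidean_space \<Rightarrow> real)"
  using nn_integral_weight[where 'a='a]
  by (auto simp: integrable_iff_bounded)

lemma integrable_weight_bound:
  fixes f :: "'a::euclidean_space \<Rightarrow> 'b::{banach, second_countable_topology}"
  assumes "f \<in> borel_measurable borel" "\<And>x. norm (f x) \<le> C * weight x"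
  shows "integrable lborel f"
proof (rule Bochner_Integration.integrable_bound)
  show "integrable lborel (\<lambda>x::'a. C * weight x)" using integrable_weight[where 'a='a] by simp
  have "norm (f x) \<le> norm (C * weight x)" for x
    using assms(2)[of x] abs_ge_self[of "C * weight x"] unfolding real_norm_def by linarith
  then show "AE x in lborel. norm (f x) \<le> norm (C * weight x)" by simp
qed (use assms in simp)

lemma weight_shift:
  fixes x y :: "'a::euclidean_space"
  assumes "norm (x - y) \<le> r"
  shows "weight x \<le> (1 + r) ^ (DIM('a) + 1) * weight y"
proof -
  have r: "0 \<le> r" using assms norm_ge_zero order_trans by blast
  have "norm y \<le> norm x + r" using assms norm_triangle_ineq4[of x "x - y"] by simp
  then have "1 + norm y \<le> (1 + r) * (1 + norm x)"
    using mult_nonneg_nonneg[OF r norm_ge_zero[of x]] by (simp add: algebra_simps)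
  then have "(1 + norm y) ^ (DIM('a) + 1) \<le> ((1 + r) * (1 + norm x)) ^ (DIM('a) + 1)"
    by (intro power_mono) simp_all
  then have "(1 + norm y) ^ (DIM('a) + 1) \<le> (1 + r) ^ (DIM('a) + 1) * (1 + norm x) ^ (DIM('a) + 1)"
    by (simp only: power_mult_distrib)
  moreover have "0 < (1 + norm x) ^ (DIM('a) + 1)" "0 < (1 + norm y) ^ (DIM('a) + 1)"
    by (simp_all add: add_pos_nonneg)
  ultimately show ?thesis unfolding weight_def
    by (simp add: divide_simps)
qed

section \<open>Finitely often continuously differentiable functions on open sets\<close>

abbreviation has_partials ::
    "(real^'n::finite \<Rightarrow> complex) \<Rightarrow> ('n \<Rightarrow> real^'n \<Rightarrow> complex) \<Rightarrow> real^'n \<Rightarrow> bool" where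
  "has_partials f f' x \<equiv> (f has_derivative (\<lambda>h. \<Sum>i\<in>UNIV. h $ i *\<^sub>R f' i x)) (at x)"

text \<open>Partial derivatives are only asserted to exist, so that closure properties follow by
  exhibiting them and induction on the order.\<close>

primrec C_diff :: "nat \<Rightarrow> (real^'n::finite) set \<Rightarrow> (real^'n \<Rightarrow> complex) \<Rightarrow> bool" where
  "C_diff 0 S f \<longleftrightarrow> continuous_on S f"
| "C_diff (Suc k) S f \<longleftrightarrow> (\<exists>f'. (\<forall>x\<in>S. has_partials f f' x) \<and>
     (\<forall>i. C_diff k S (f' i)))"

lemma C_diff_Suc_imp: "C_diff (Suc k) S f \<Longrightarrow> C_diff k S f"
proof (induction k arbitrary: f)
  case 0
  then obtain f' where "\<And>x. x \<in> S \<Longrightarrow> has_partials f f' x"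
    by auto
  then have "\<And>x. x \<in> S \<Longrightarrow> isCont f x" by (rule has_derivative_continuous)
  then show ?case by (simp add: continuous_at_imp_continuous_on)
next
  case (Suc k)
  from Suc.prems obtain f' where f': "\<forall>x\<in>S. has_partials f f' x"
    and c: "\<And>i. C_diff (Suc k) S (f' i)" unfolding C_diff.simps(2)[of "Suc k"] by blast
  with Suc.IH have "\<And>i. C_diff k S (f' i)" by blast
  with f' show ?case by (auto simp del: C_diff.simps(1))
qed

lemma C_diff_continuous: "C_diff k S f \<Longrightarrow> continuous_on S f"
  by (induction k) (simp, metis C_diff_Suc_imp C_diff.simps(1))

lemma C_diff_subset: "C_diff k S f \<Longrightarrow> T \<subseteq> S \<Longrightarrow> C_diff k T f"
proof (induction k arbitrary: f)
  case 0 then show ?case by (auto intro: continuous_on_subset)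
next
  case (Suc k)
  then show ?case by (auto simp del: C_diff.simps(1)) (meson subsetD)
qed

lemma C_diff_cong:
  assumes "open S" "\<And>x. x \<in> S \<Longrightarrow> f x = g x" "C_diff k S f"
  shows "C_diff k S g"
proof (cases k)
  case 0 then show ?thesis using assms continuous_on_cong[of S S f g] by simp
next
  case (Suc l)
  then obtain f' where f': "\<forall>x\<in>S. has_partials f f' x"
    and c: "\<And>i. C_diff l S (f' i)" using assms(3) by auto
  have "has_partials g f' x" if "x \<in> S" for x
    using has_derivative_transform_within_open[OF f'[rule_format, OF that] assms(1) that] assms(2) by blast
  with c Suc show ?thesis by auto
qed

lemma C_diff_Un:
  assumes "open S" "open T" "C_diff k S f" "C_diff k T f"
  shows "C_diff k (S \<union> T) f"
  using assms(3,4)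
proof (induction k arbitrary: f)
  case 0 then show ?case using assms(1,2) by (auto intro: continuous_on_open_Un)
next
  case (Suc k)
  obtain f' where f': "\<And>x. x\<in>S \<Longrightarrow> has_partials f f' x"
    and cf: "\<And>i. C_diff k S (f' i)" using Suc.prems by auto
  obtain g' where g': "\<And>x. x\<in>T \<Longrightarrow> has_partials f g' x"
    and cg: "\<And>i. C_diff k T (g' i)" using Suc.prems by auto
  have eq: "f' i x = g' i x" if x: "x \<in> S" "x \<in> T" for i x
  proof -
    have "(\<lambda>h. \<Sum>i\<in>UNIV. h $ i *\<^sub>R f' i x) = (\<lambda>h. \<Sum>i\<in>UNIV. h $ i *\<^sub>R g' i x)"
      using has_derivative_unique f' g' x by blast
    from fun_cong[OF this, of "axis i 1"] show ?thesis
      by (simp add: axis_def if_distrib[of "\<lambda>a. a *\<^sub>R _"] sum.delta cong: if_cong)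
  qed
  define h' where "h' i x = (if x \<in> S then f' i x else g' i x)" for i x
  have "C_diff k S (h' i)" for i
    by (rule C_diff_cong[OF assms(1) _ cf]) (simp add: h'_def)
  moreover have "C_diff k T (h' i)" for i
    by (rule C_diff_cong[OF assms(2) _ cg]) (auto simp add: h'_def eq)
  ultimately have "C_diff k (S \<union> T) (h' i)" for i using Suc.IH by blast
  moreover have "has_partials f h' x" if "x \<in> S \<union> T" for x
  proof (cases "x \<in> S")
    case True then show ?thesis using f'[OF True] by (simp add: h'_def)
  next
    case False then show ?thesis using g'[of x] that by (simp add: h'_def)
  qed
  ultimately show ?case by (auto simp del: C_diff.simps(1))
qed

lemma C_diff_const: "C_diff k S (\<lambda>x. c)"
proof (induction k arbitrary: c)
  case (Suc k)
  then show ?case unfolding C_diff.simps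
    by (intro exI[of _ "\<lambda>_ _. 0"]) simp
qed simp

lemma C_diff_add: "C_diff k S f \<Longrightarrow> C_diff k S g \<Longrightarrow> C_diff k S (\<lambda>x. f x + g x)"
proof (induction k arbitrary: f g)
  case (Suc k)
  obtain f' where f': "\<And>x. x\<in>S \<Longrightarrow> has_partials f f' x"
    and cf: "\<And>i. C_diff k S (f' i)" using Suc.prems by auto
  obtain g' where g': "\<And>x. x\<in>S \<Longrightarrow> has_partials g g' x"
    and cg: "\<And>i. C_diff k S (g' i)" using Suc.prems by auto
  have "((\<lambda>x. f x + g x) has_derivative (\<lambda>h. \<Sum>i\<in>UNIV. h $ i *\<^sub>R (f' i x + g' i x))) (at x)" if "x \<in> S" for x
    using has_derivative_add[OF f'[OF that] g'[OF that]] by (simp add: scaleR_add_right sum.distrib)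
  moreover have "\<And>i. C_diff k S (\<lambda>x. f' i x + g' i x)" using Suc.IH cf cg by blast
  ultimately show ?case unfolding C_diff.simps by (intro exI[of _ "\<lambda>i x. f' i x + g' i x"]) blast
qed (auto intro: continuous_on_add)

lemma C_diff_mult: "C_diff k S f \<Longrightarrow> C_diff k S g \<Longrightarrow> C_diff k S (\<lambda>x. f x * g x)"
proof (induction k arbitrary: f g)
  case (Suc k)
  obtain f' where f': "\<And>x. x\<in>S \<Longrightarrow> has_partials f f' x"
    and cf: "\<And>i. C_diff k S (f' i)" using Suc.prems by auto
  obtain g' where g': "\<And>x. x\<in>S \<Longrightarrow> has_partials g g' x"
    and cg: "\<And>i. C_diff k S (g' i)" using Suc.prems by auto
  have "((\<lambda>x. f x * g x) has_derivative (\<lambda>h. \<Sum>i\<in>UNIV. h $ i *\<^sub>R (f x * g' i x + f' i x * g x))) (at x)" if "x \<in> S" for x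
    using has_derivative_mult[OF f'[OF that] g'[OF that]]
    by (simp add: scaleR_add_right sum.distrib sum_distrib_left sum_distrib_right)
  moreover have "\<And>i. C_diff k S (\<lambda>x. f x * g' i x + f' i x * g x)"
    using Suc.IH cf cg Suc.prems C_diff_Suc_imp by (intro C_diff_add) blast+
  ultimately show ?case unfolding C_diff.simps by (intro exI[of _ "\<lambda>i x. f x * g' i x + f' i x * g x"]) blast
qed (auto intro: continuous_on_mult)

lemma C_diff_diff: "C_diff k S f \<Longrightarrow> C_diff k S g \<Longrightarrow> C_diff k S (\<lambda>x. f x - g x)"
  using C_diff_add[OF _ C_diff_mult[OF C_diff_const[of k S "-1"]], of f g] by simp

lemma C_diff_inverse:
  "C_diff k S f \<Longrightarrow> (\<And>x. x \<in> S \<Longrightarrow> f x \<noteq> 0) \<Longrightarrow> C_diff k S (\<lambda>x. inverse (f x))"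
proof (induction k arbitrary: f)
  case (Suc k)
  obtain f' where f': "\<And>x. x\<in>S \<Longrightarrow> has_partials f f' x"
    and cf: "\<And>i. C_diff k S (f' i)" using Suc.prems by auto
  have "((\<lambda>x. inverse (f x)) has_derivative
      (\<lambda>h. \<Sum>i\<in>UNIV. h $ i *\<^sub>R (- 1 * (inverse (f x) * f' i x * inverse (f x))))) (at x)" if "x \<in> S" for x
    using Deriv.has_derivative_inverse[OF Suc.prems(2) f', OF that that]
    by (simp add: sum_distrib_left sum_distrib_right sum_negf)
  moreover have "\<And>i. C_diff k S (\<lambda>x. - 1 * (inverse (f x) * f' i x * inverse (f x)))"
    using Suc C_diff_Suc_imp cf by (intro C_diff_mult C_diff_const) blast+
  ultimately show ?case unfolding C_diff.simps
    by (intro exI[of _ "\<lambda>i x. - 1 * (inverse (f x) * f' i x * inverse (f x))"]) blast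
qed (auto intro: continuous_on_inverse)

lemma C_diff_scale:
  "C_diff k S f \<Longrightarrow> (\<And>x. x \<in> T \<Longrightarrow> a *\<^sub>R x \<in> S) \<Longrightarrow> C_diff k T (\<lambda>x. f (a *\<^sub>R x))"
proof (induction k arbitrary: f)
  case 0
  then show ?case
    by (auto intro!: continuous_on_compose2[of S f T "\<lambda>x. a *\<^sub>R x"] continuous_intros)
next
  case (Suc k)
  obtain f' where f': "\<And>x. x\<in>S \<Longrightarrow> has_partials f f' x"
    and cf: "\<And>i. C_diff k S (f' i)" using Suc.prems by auto
  have "((\<lambda>x. f (a *\<^sub>R x)) has_derivative (\<lambda>h. \<Sum>i\<in>UNIV. h $ i *\<^sub>R (of_real a * f' i (a *\<^sub>R x)))) (at x)"
    if "x \<in> T" for x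
  proof -
    have "((\<lambda>x. a *\<^sub>R x) has_derivative (\<lambda>h. a *\<^sub>R h)) (at x)" by (intro derivative_eq_intros) auto
    from has_derivative_compose[OF this f'[OF Suc.prems(2)[OF that]]]
    show ?thesis by (simp add: scaleR_conv_of_real[where 'a=complex] mult_ac)
  qed
  moreover have "\<And>i. C_diff k T (\<lambda>x. of_real a * f' i (a *\<^sub>R x))"
    using Suc cf by (intro C_diff_mult C_diff_const) blast
  ultimately show ?case unfolding C_diff.simps
    by (intro exI[of _ "\<lambda>i x. of_real a * f' i (a *\<^sub>R x)"]) blast
qed

section \<open>The Fourier integral\<close>

abbreviation wave :: "real^'n::finite \<Rightarrow> real^'n \<Rightarrow> complex" where
  "wave \<xi> x \<equiv> exp (- \<i> * of_real (x \<bullet> \<xi>))"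

definition ft :: "(real^'n::finite \<Rightarrow> complex) \<Rightarrow> real^'n \<Rightarrow> complex" where
  "ft g \<xi> = (LINT x|lborel. wave \<xi> x * g x)"

lemma norm_exp_i_inner [simp]: "norm (exp (- (\<i> * complex_of_real a))) = 1"
  by (simp add: norm_exp_eq_Re)

lemma borel_measurable_exp_i_inner [measurable]:
  "(\<lambda>x. exp (- (\<i> * complex_of_real (x \<bullet> \<xi>)))) \<in> borel_measurable borel"
  by (intro borel_measurable_continuous_onI continuous_intros)

lemma integrable_ft:
  assumes "integrable lborel g"
  shows "integrable lborel (\<lambda>x. wave \<xi> x * g x)"
proof (rule Bochner_Integration.integrable_bound[OF assms])
  show "(\<lambda>x. wave \<xi> x * g x) \<in> borel_measurable lborel"
    using borel_measurable_integrable[OF assms] by simp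
qed (auto simp: norm_mult)

lemma norm_ft_le:
  assumes "integrable lborel g"
  shows "norm (ft g \<xi>) \<le> (LINT x|lborel. norm (g x))"
proof -
  have "norm (ft g \<xi>) \<le> (LINT x|lborel. norm (wave \<xi> x * g x))"
    unfolding ft_def by (rule integral_norm_bound)
  then show ?thesis by (simp add: norm_mult)
qed

lemma ft_scale:
  fixes g :: "real^'n::finite \<Rightarrow> complex"
  assumes [measurable]: "g \<in> borel_measurable borel" and a: "a > 0"
  shows "ft (\<lambda>x. g (a *\<^sub>R x)) \<xi> = ft g (inverse a *\<^sub>R \<xi>) / of_real (a ^ CARD('n))"
proof -
  have "ft g (inverse a *\<^sub>R \<xi>) = (a ^ CARD('n)) *\<^sub>R
      (LINT x|lborel. wave (inverse a *\<^sub>R \<xi>) (0 + a *\<^sub>R x) * g (0 + a *\<^sub>R x))"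
    unfolding ft_def using a
    by (subst lborel_affine_integral(2)[where c=a and t=0]) auto
  moreover have "(0 + a *\<^sub>R x) \<bullet> (inverse a *\<^sub>R \<xi>) = x \<bullet> \<xi>" for x using a by simp
  ultimately have "ft g (inverse a *\<^sub>R \<xi>) = (a ^ CARD('n)) *\<^sub>R
      (LINT x|lborel. wave \<xi> x * g (a *\<^sub>R x))" by (simp only: add_0_left)
  then show ?thesis using a by (simp add: ft_def scaleR_conv_of_real[where 'a=complex])
qed

lemma ft_translate:
  fixes g :: "real^'n::finite \<Rightarrow> complex"
  assumes [measurable]: "g \<in> borel_measurable borel"
  shows "ft (\<lambda>y. g (x + y)) \<xi> = exp (\<i> * of_real (x \<bullet> \<xi>)) * ft g \<xi>"
proof -
  have "ft (\<lambda>y. g (x + y)) \<xi> =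
      (LINT y|lborel. exp (\<i> * of_real (x \<bullet> \<xi>)) * (wave \<xi> (x + y) * g (x + y)))"
    unfolding ft_def
    by (intro Bochner_Integration.integral_cong refl)
       (simp add: inner_add_left exp_diff exp_minus distrib_left exp_add field_simps)
  also have "\<dots> = exp (\<i> * of_real (x \<bullet> \<xi>)) * (LINT y|lborel. (wave \<xi> (x + y) * g (x + y)))"
    by simp
  also have "(LINT y|lborel. (wave \<xi> (x + y) * g (x + y))) = ft g \<xi>"
    unfolding ft_def
    by (rule integral_lborel_translation(1)[of "\<lambda>z. wave \<xi> z * g z"]) simp
  finally show ?thesis .
qed

lemma ft_multiplication:
  fixes u v :: "real^'n::finite \<Rightarrow> complex"
  assumes u: "integrable lborel u" and v: "integrable lborel v"
  shows "(LINT y|lborel. ft u y * v y) = (LINT x|lborel. u x * ft v x)"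
proof -
  have [measurable]: "u \<in> borel_measurable borel" "v \<in> borel_measurable borel"
    using u v by (auto dest: borel_measurable_integrable)
  let ?h = "\<lambda>x y. wave y x * (u x * v y)"
  have meas: "(\<lambda>(x, y). ?h x y) \<in> borel_measurable (lborel \<Otimes>\<^sub>M lborel)"
  proof -
    have "(\<lambda>z::(real^'n) \<times> (real^'n). wave (snd z) (fst z)) \<in> borel_measurable borel"
      by (intro borel_measurable_continuous_onI continuous_intros)
    then have [measurable]: "(\<lambda>z::(real^'n) \<times> (real^'n). wave (snd z) (fst z))
        \<in> borel_measurable (borel \<Otimes>\<^sub>M borel)" by (simp add: borel_prod)
    show ?thesis unfolding case_prod_beta by measurable
  qed
  have "integrable (lborel \<Otimes>\<^sub>M lborel) (\<lambda>(x, y). ?h x y)"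
  proof (rule lborel_pair.Fubini_integrable[OF meas])
    show "integrable lborel (\<lambda>x. LINT y|lborel. norm (case (x, y) of (x, y) \<Rightarrow> ?h x y))"
      using u by (simp add: norm_mult)
    show "AE x in lborel. integrable lborel (\<lambda>y. case (x, y) of (x, y) \<Rightarrow> ?h x y)"
    proof (intro AE_I2)
      fix x :: "real^'n"
      have "integrable lborel (\<lambda>y. u x * (wave x y * v y))"
        by (intro integrable_mult_right integrable_ft v)
      then show "integrable lborel (\<lambda>y. case (x, y) of (x, y) \<Rightarrow> ?h x y)"
        by (simp add: inner_commute mult_ac)
    qed
  qed
  from lborel_pair.Fubini_integral[OF this]
  have "(LINT y|lborel. LINT x|lborel. ?h x y) = (LINT x|lborel. LINT y|lborel. ?h x y)" .
  moreover have "(LINT x|lborel. ?h x y) = ft u y * v y" for y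
  proof -
    have "(LINT x|lborel. ?h x y) = (LINT x|lborel. (wave y x * u x) * v y)"
      by (simp add: mult_ac)
    then show ?thesis by (simp add: ft_def)
  qed
  moreover have "(LINT y|lborel. ?h x y) = u x * ft v x" for x
  proof -
    have "(LINT y|lborel. ?h x y) = (LINT y|lborel. u x * (wave x y * v y))"
      by (simp add: mult_ac inner_commute)
    then show ?thesis by (simp add: ft_def)
  qed
  ultimately show ?thesis by simp
qed

text \<open>Inverse Fourier integrals are written \<open>\<lambda>x. ft m (- x)\<close>; no inversion theorem is involved:
  convolving such an integral with \<open>g\<close> multiplies \<open>m\<close> by the Fourier integral of \<open>g\<close>, by
  Fubini's theorem alone.\<close>

lemma convolution_inverse_ft:
  fixes m g :: "real^'n::finite \<Rightarrow> complex"
  assumes m: "integrable lborel m" and g: "integrable lborel g"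
  shows "(LINT y|lborel. ft m (- y) * g (x - y)) = ft (\<lambda>\<xi>. m \<xi> * ft g \<xi>) (- x)"
proof -
  have [measurable]: "g \<in> borel_measurable borel" using g by (auto dest: borel_measurable_integrable)
  have gx: "integrable lborel (\<lambda>y. g (x + y))" using g by (simp add: integral_lborel_translation(2))
  have mm: "(\<lambda>y. ft m y * g (x + y)) \<in> borel_measurable borel"
  proof -
    have [measurable]: "m \<in> borel_measurable borel" using m by (auto dest: borel_measurable_integrable)
    have "(\<lambda>z::(real^'n) \<times> (real^'n). wave (fst z) (snd z)) \<in> borel_measurable borel"
      by (intro borel_measurable_continuous_onI continuous_intros)
    then have [measurable]: "(\<lambda>z::(real^'n) \<times> (real^'n). wave (fst z) (snd z))
        \<in> borel_measurable (borel \<Otimes>\<^sub>M borel)" by (simp add: borel_prod)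
    have "(\<lambda>(\<xi>, x). wave \<xi> x * m x) \<in> borel_measurable (borel \<Otimes>\<^sub>M lborel)"
      unfolding case_prod_beta by measurable
    then have "(\<lambda>\<xi>. LINT x|lborel. wave \<xi> x * m x) \<in> borel_measurable borel"
      by (rule lborel.borel_measurable_lebesgue_integral)
    then have [measurable]: "ft m \<in> borel_measurable borel" unfolding ft_def[abs_def] .
    show ?thesis by measurable
  qed
  have "(LINT y|lborel. ft m (- y) * g (x - y)) = (LINT y|lborel. ft m y * g (x + y))"
    using integral_lborel_reflection(1)[OF mm, of 0] by simp
  also have "\<dots> = (LINT \<xi>|lborel. m \<xi> * ft (\<lambda>y. g (x + y)) \<xi>)"
    by (rule ft_multiplication[OF m gx])
  also have "\<dots> = ft (\<lambda>\<xi>. m \<xi> * ft g \<xi>) (- x)"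
    unfolding ft_translate[OF \<open>g \<in> borel_measurable borel\<close>] ft_def[of "\<lambda>\<xi>. m \<xi> * ft g \<xi>"]
    by (simp add: mult_ac inner_commute)
  finally show ?thesis .
qed

section \<open>Smoothness and decay of Fourier integrals\<close>

definition rapid :: "(real^'n::finite \<Rightarrow> complex) \<Rightarrow> bool" where
  "rapid g \<longleftrightarrow> (\<forall>k. integrable lborel (\<lambda>x. norm x ^ k *\<^sub>R g x))"

lemma rapid_integrable: "rapid g \<Longrightarrow> integrable lborel g"
  unfolding rapid_def by (drule spec[of _ 0]) simp

lemma rapid_coordinate:
  fixes g :: "real^'n::finite \<Rightarrow> complex"
  assumes "rapid g"
  shows "rapid (\<lambda>x. (- \<i> * of_real (x $ i)) * g x)"
  unfolding rapid_def
proof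
  fix k
  have [measurable]: "g \<in> borel_measurable borel"
    using rapid_integrable[OF assms] by (auto dest: borel_measurable_integrable)
  have m: "(\<lambda>x::real^'n. x $ i) \<in> borel_measurable borel"
    by (intro borel_measurable_continuous_onI continuous_intros)
  show "integrable lborel (\<lambda>x. norm x ^ k *\<^sub>R ((- \<i> * of_real (x $ i)) * g x))"
  proof (rule Bochner_Integration.integrable_bound)
    show "integrable lborel (\<lambda>x. norm x ^ Suc k *\<^sub>R g x)" using assms unfolding rapid_def by blast
    show "(\<lambda>x. norm x ^ k *\<^sub>R ((- \<i> * of_real (x $ i)) * g x)) \<in> borel_measurable lborel"
      using m by measurable
    have "norm (norm x ^ k *\<^sub>R ((- \<i> * of_real (x $ i)) * g x)) \<le> norm (norm x ^ Suc k *\<^sub>R g x)" for x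
      using mult_right_mono[OF component_le_norm_cart[of x i], of "norm x ^ k * norm (g x)"]
      by (simp add: norm_mult mult_ac)
    then show "AE x in lborel. norm (norm x ^ k *\<^sub>R ((- \<i> * of_real (x $ i)) * g x))
        \<le> norm (norm x ^ Suc k *\<^sub>R g x)" by simp
  qed
qed

lemma norm_exp_i_Taylor1: "norm (exp (- (\<i> * complex_of_real a)) - 1 + \<i> * of_real a) \<le> a\<^sup>2"
proof -
  have "cmod (iexp (- a) - (\<Sum>k \<le> Suc 0. (\<i> * (- a))^k / fact k)) \<le> \<bar>- a\<bar>^(Suc (Suc 0)) / fact (Suc (Suc 0))"
    using iexp_approx1[of "- a" "Suc 0"] by simp
  then have "norm (exp (- (\<i> * complex_of_real a)) - 1 + \<i> * of_real a) \<le> a\<^sup>2 / 2"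
    by (simp add: power2_eq_square algebra_simps)
  then show ?thesis using zero_le_power2[of a] by linarith
qed

text \<open>Two moments of \<open>g\<close> control the second order Taylor remainder of the exponential, which makes
  differentiation under the integral a direct estimate.\<close>

lemma has_derivative_ft:
  fixes g :: "real^'n::finite \<Rightarrow> complex"
  assumes g: "rapid g"
  shows "(ft g has_derivative (\<lambda>h. \<Sum>i\<in>UNIV. h $ i *\<^sub>R ft (\<lambda>x. (- \<i> * of_real (x $ i)) * g x) \<xi>)) (at \<xi>)"
    (is "(_ has_derivative ?D) _")
proof (rule has_derivativeI_sandwich[where e=1])
  define A where "A = (LINT x|lborel. norm (norm x ^ 2 *\<^sub>R g x))"
  show "bounded_linear ?D" by (intro bounded_linear_intros bounded_linear_vec_nth)
  show "((\<lambda>y. A * norm (y - \<xi>)) \<longlongrightarrow> 0) (at \<xi>)"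
    by (intro tendsto_eq_intros tendsto_mult_right_zero) (auto simp: tendsto_norm_zero_iff LIM_zero)
  fix y assume "y \<noteq> \<xi>"
  let ?h = "y - \<xi>"
  have int: "integrable lborel (\<lambda>x. wave \<xi> x * ((- \<i> * of_real (x $ i)) * g x))" for i
    by (intro integrable_ft rapid_integrable rapid_coordinate g)
  have sum: "?D ?h = (LINT x|lborel. wave \<xi> x * ((- \<i> * of_real (x \<bullet> ?h)) * g x))"
  proof -
    have "?D ?h = (\<Sum>i\<in>UNIV. (LINT x|lborel. ?h $ i *\<^sub>R (wave \<xi> x * ((- \<i> * of_real (x $ i)) * g x))))"
      unfolding ft_def by simp
    also have "\<dots> = (LINT x|lborel. (\<Sum>i\<in>UNIV. ?h $ i *\<^sub>R (wave \<xi> x * ((- \<i> * of_real (x $ i)) * g x))))"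
      by (intro Bochner_Integration.integral_sum[symmetric] integrable_scaleR_right int)
    also have "\<dots> = (LINT x|lborel. wave \<xi> x * ((- \<i> * of_real (x \<bullet> ?h)) * g x))"
      by (intro Bochner_Integration.integral_cong refl)
         (simp add: inner_vec_def sum_distrib_left sum_distrib_right scaleR_conv_of_real[where 'a=complex] sum_negf mult_ac)
    finally show ?thesis .
  qed
  have int2: "integrable lborel (\<lambda>x. wave \<xi> x * ((- \<i> * of_real (x \<bullet> ?h)) * g x))"
  proof -
    have "integrable lborel (\<lambda>x. \<Sum>i\<in>UNIV. ?h $ i *\<^sub>R (wave \<xi> x * ((- \<i> * of_real (x $ i)) * g x)))"
      by (intro Bochner_Integration.integrable_sum integrable_scaleR_right int)
    then show ?thesis
      by (rule back_subst[of "integrable lborel"])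
         (auto simp add: fun_eq_iff inner_vec_def sum_distrib_left sum_distrib_right
           scaleR_conv_of_real[where 'a=complex] sum_negf mult_ac)
  qed
  note I = integrable_ft[OF rapid_integrable[OF g]]
  have eq: "ft g y - ft g \<xi> - ?D ?h = (LINT x|lborel. wave y x * g x
      - wave \<xi> x * g x - wave \<xi> x * ((- \<i> * of_real (x \<bullet> ?h)) * g x))"
    unfolding sum unfolding ft_def
    by (subst Bochner_Integration.integral_diff Bochner_Integration.integral_diff,
        intro Bochner_Integration.integrable_diff I, rule int2)
       (subst Bochner_Integration.integral_diff, rule I, rule I, rule refl)
  have "norm (ft g y - ft g \<xi> - ?D ?h) \<le> (LINT x|lborel. (norm ?h)\<^sup>2 * norm (norm x ^ 2 *\<^sub>R g x))"
    unfolding eq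
  proof (rule order_trans[OF integral_norm_bound], rule integral_mono')
    show "integrable lborel (\<lambda>x. (norm ?h)\<^sup>2 * norm (norm x ^ 2 *\<^sub>R g x))"
      using g unfolding rapid_def by (intro integrable_mult_right integrable_norm) blast
    fix x :: "real^'n"
    have "wave y x = wave \<xi> x * wave ?h x"
      by (simp add: mult_exp_exp inner_diff_right algebra_simps)
    then have "wave y x * g x
      - wave \<xi> x * g x - wave \<xi> x * ((- \<i> * of_real (x \<bullet> ?h)) * g x)
      = wave \<xi> x * (exp (- (\<i> * of_real (x \<bullet> ?h))) - 1 + \<i> * of_real (x \<bullet> ?h)) * g x"
      by (simp add: algebra_simps)
    then have "norm (wave y x * g x
      - wave \<xi> x * g x - wave \<xi> x * ((- \<i> * of_real (x \<bullet> ?h)) * g x))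
      = norm (exp (- (\<i> * of_real (x \<bullet> ?h))) - 1 + \<i> * of_real (x \<bullet> ?h)) * norm (g x)"
      by (simp add: norm_mult)
    also have "\<dots> \<le> (x \<bullet> ?h)\<^sup>2 * norm (g x)"
      by (intro mult_right_mono norm_exp_i_Taylor1) simp
    also have "\<dots> \<le> (norm x * norm ?h)\<^sup>2 * norm (g x)"
      using Cauchy_Schwarz_ineq2[of x ?h]
      by (intro mult_right_mono) (auto simp: abs_le_square_iff[symmetric] abs_mult)
    finally show "norm (wave y x * g x
      - wave \<xi> x * g x - wave \<xi> x * ((- \<i> * of_real (x \<bullet> ?h)) * g x))
      \<le> (norm ?h)\<^sup>2 * norm (norm x ^ 2 *\<^sub>R g x)" by (simp add: power_mult_distrib mult_ac)
  qed simp
  also have "\<dots> = (norm ?h)\<^sup>2 * A" unfolding A_def by simp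
  finally show "norm (ft g y - ft g \<xi> - ?D ?h) / norm ?h \<le> A * norm ?h"
    using \<open>y \<noteq> \<xi>\<close> by (simp add: divide_simps power2_eq_square mult_ac)
qed simp

lemma rapid_C_diff_ft: "rapid g \<Longrightarrow> C_diff k UNIV (ft g)"
proof (induction k arbitrary: g)
  case 0
  then have "isCont (ft g) \<xi>" for \<xi> by (rule has_derivative_continuous[OF has_derivative_ft])
  then show ?case by (simp add: continuous_at_imp_continuous_on)
next
  case (Suc k)
  show ?case unfolding C_diff.simps
    using has_derivative_ft[OF Suc.prems] Suc.IH[OF rapid_coordinate[OF Suc.prems]]
    by (intro exI[of _ "\<lambda>i. ft (\<lambda>x. (- \<i> * of_real (x $ i)) * g x)"]) blast
qed

lemma compact_support_rapid:
  fixes m :: "real^'n::finite \<Rightarrow> complex"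
  assumes "continuous_on UNIV m" "\<And>x. norm x > R \<Longrightarrow> m x = 0"
  shows "rapid m"
  unfolding rapid_def
proof
  fix k
  have "integrable lborel (\<lambda>x::real^'n. indicator (cball 0 R) x *\<^sub>R (norm x ^ k *\<^sub>R m x))"
    by (intro borel_integrable_compact compact_cball continuous_intros continuous_on_subset[OF assms(1)]) simp
  then show "integrable lborel (\<lambda>x. norm x ^ k *\<^sub>R m x)"
    by (rule back_subst[of "integrable lborel"]) (auto simp: fun_eq_iff indicator_def assms(2))
qed

lemma continuous_ft:
  assumes "rapid m"
  shows "continuous_on UNIV (ft m)"
  using rapid_C_diff_ft[OF assms, of 0] by simp

text \<open>The integral of a difference quotient vanishes by translation invariance; dominated
  convergence passes to the limit.\<close>

lemma integral_partial_derivative_eq_0: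
  fixes u :: "real^'n::finite \<Rightarrow> complex"
  assumes der: "\<And>x. has_partials u u' x"
    and cont: "continuous_on UNIV (u' i)"
    and supp: "\<And>x. norm x > R \<Longrightarrow> u x = 0"
  shows "\<And>x. norm x > R \<Longrightarrow> u' i x = 0" and "(LINT x|lborel. u' i x) = 0"
proof -
  have axis: "(\<Sum>j\<in>UNIV. (r *\<^sub>R axis i 1 :: real^'n) $ j *\<^sub>R u' j x) = r *\<^sub>R u' i x" for r x
    by (simp add: axis_def if_distrib[of "\<lambda>a. a *\<^sub>R _"] if_distrib[of "\<lambda>a. _ * a"] sum.delta cong: if_cong)
  show zero: "u' i x = 0" if "norm x > R" for x
  proof -
    have "open {x::real^'n. R < norm x}" by (intro open_Collect_less continuous_intros)
    then have "((\<lambda>_. 0) has_derivative (\<lambda>h. \<Sum>i\<in>UNIV. h $ i *\<^sub>R u' i x)) (at x)"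
      by (rule has_derivative_transform_within_open[OF der]) (use that supp in auto)
    then have "(\<lambda>h. \<Sum>i\<in>UNIV. h $ i *\<^sub>R u' i x) = (\<lambda>h. 0)"
      using has_derivative_unique has_derivative_const by blast
    from fun_cong[OF this, of "1 *\<^sub>R axis i 1"] show ?thesis unfolding axis by simp
  qed
  have contu: "continuous_on UNIV u"
    using has_derivative_continuous[OF der] by (simp add: continuous_at_imp_continuous_on)
  have uint: "integrable lborel u"
    by (rule rapid_integrable[OF compact_support_rapid[OF contu supp]])
  have [measurable]: "u \<in> borel_measurable borel" "u' i \<in> borel_measurable borel"
    using contu cont by (auto intro: borel_measurable_continuous_onI)
  obtain B where B: "\<And>x. norm (u' i x) \<le> B" "0 \<le> B"
  proof -
    have "compact (u' i ` cball 0 R)"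
      by (intro compact_continuous_image continuous_on_subset[OF cont]) auto
    then have "bounded (u' i ` cball 0 R)" by (rule compact_imp_bounded)
    then obtain B where "\<forall>y \<in> u' i ` cball 0 R. norm y \<le> B"
      unfolding bounded_iff by (rule exE)
    then have "\<And>x. norm x \<le> R \<Longrightarrow> norm (u' i x) \<le> B" by simp
    then have "norm (u' i x) \<le> max B 0" for x
      using zero[of x] by (cases "norm x \<le> R") (auto simp: le_max_iff_disj)
    then show thesis using that[of "max B 0"] by simp
  qed
  have line: "((\<lambda>s. u (x + s *\<^sub>R axis i 1)) has_derivative (\<lambda>r. r *\<^sub>R u' i (x + s *\<^sub>R axis i 1))) (at s)" for x s
  proof -
    have "((\<lambda>s. x + s *\<^sub>R axis i 1) has_derivative (\<lambda>r. r *\<^sub>R axis i 1)) (at s)"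
      by (auto intro!: derivative_eq_intros)
    from has_derivative_compose[OF this der] show ?thesis unfolding axis .
  qed
  define t where "t k = 1 / real (Suc k)" for k
  have t: "0 < t k" "t k \<le> 1" for k by (auto simp: t_def)
  have tlim: "filterlim t (at 0) sequentially"
  proof -
    have "t \<longlonglongrightarrow> 0" using LIMSEQ_Suc[OF lim_1_over_n, where 'a1=real] by (simp add: t_def[abs_def])
    then show ?thesis unfolding filterlim_at using t(1)
      by (auto simp: less_imp_neq[THEN not_sym] intro!: always_eventually)
  qed
  let ?s = "\<lambda>k x. inverse (t k) *\<^sub>R (u (x + t k *\<^sub>R axis i 1) - u x)"
  have lim: "(\<lambda>k. ?s k x) \<longlonglongrightarrow> u' i x" for x
  proof -
    have "(\<lambda>h. norm (u (x + h *\<^sub>R axis i 1) - u x - h *\<^sub>R u' i x) / norm h) \<midarrow>0\<rightarrow> 0"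
      using line[of x 0] unfolding has_derivative_at by simp
    from filterlim_compose[OF this tlim]
    have "(\<lambda>k. norm (u (x + t k *\<^sub>R axis i 1) - u x - t k *\<^sub>R u' i x) / norm (t k)) \<longlonglongrightarrow> 0" .
    moreover have "norm (u (x + t k *\<^sub>R axis i 1) - u x - t k *\<^sub>R u' i x) / norm (t k) = norm (?s k x - u' i x)" for k
    proof -
      have "?s k x - u' i x = inverse (t k) *\<^sub>R (u (x + t k *\<^sub>R axis i 1) - u x - t k *\<^sub>R u' i x)"
        using t(1)[of k] by (simp add: scaleR_diff_right)
      then show ?thesis using t(1)[of k] by (simp add: divide_inverse mult.commute)
    qed
    ultimately show ?thesis by (simp add: LIM_zero_iff tendsto_norm_zero_iff)
  qed
  have bound: "norm (?s k x) \<le> B * indicator (cball 0 (R + 1)) x" for k x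
  proof (cases "norm x \<le> R + 1")
    case True
    have "norm (u (x + t k *\<^sub>R axis i 1) - u (x + 0 *\<^sub>R axis i 1)) \<le> B * norm (t k - 0)"
    proof (rule differentiable_bound[of UNIV _ "\<lambda>s r. r *\<^sub>R u' i (x + s *\<^sub>R axis i 1)"])
      show "onorm (\<lambda>r. r *\<^sub>R u' i (x + s *\<^sub>R axis i 1)) \<le> B" for s
        by (rule onorm_le) (simp add: mult.commute[of B] mult_left_mono B)
    qed (use line in auto)
    then have "norm (u (x + t k *\<^sub>R axis i 1) - u x) \<le> B * t k" using t(1)[of k] by simp
    then have "norm (u (x + t k *\<^sub>R axis i 1) - u x) / t k \<le> B" using t(1)[of k] by (simp add: divide_le_eq)
    then show ?thesis using True t(1)[of k] by (simp add: divide_inverse mult.commute)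
  next
    case False
    have "norm (x + t k *\<^sub>R axis i 1) \<ge> norm x - norm (t k *\<^sub>R axis i 1 :: real^'n)"
      by (metis add.commute norm_diff_ineq)
    then have "norm (x + t k *\<^sub>R axis i 1) > R" using False t[of k] by (simp add: norm_axis_1)
    then show ?thesis using False supp by simp
  qed
  have "(\<lambda>k. LINT x|lborel. ?s k x) \<longlonglongrightarrow> (LINT x|lborel. u' i x)"
  proof (rule integral_dominated_convergence)
    show "integrable lborel (\<lambda>x::real^'n. B * indicator (cball 0 (R + 1)) x)"
      by (intro integrable_mult_right integrable_real_indicator) (auto simp: emeasure_lborel_cball_finite[unfolded infinity_ennreal_def])
  qed (use lim bound in auto)
  moreover have "(LINT x|lborel. ?s k x) = 0" for k
  proof -
    have "integrable lborel (\<lambda>x. u (x + t k *\<^sub>R axis i 1))"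
      "(LINT x|lborel. u (x + t k *\<^sub>R axis i 1)) = (LINT x|lborel. u x)"
      using integral_lborel_translation[of u "t k *\<^sub>R axis i 1"] uint by (simp_all add: add.commute)
    then show ?thesis using uint by simp
  qed
  ultimately show "(LINT x|lborel. u' i x) = 0" by (simp only: LIMSEQ_const_iff)
qed

lemma ft_partial_derivative:
  fixes m :: "real^'n::finite \<Rightarrow> complex"
  assumes der: "\<And>x. has_partials m m' x"
    and cont: "continuous_on UNIV (m' i)"
    and supp: "\<And>x. norm x > R \<Longrightarrow> m x = 0"
  shows "ft (m' i) \<xi> = \<i> * of_real (\<xi> $ i) * ft m \<xi>"
proof -
  let ?e = "\<lambda>x. wave \<xi> x"
  define v where "v j x = ?e x * m' j x + (- \<i> * of_real (\<xi> $ j)) * (?e x * m x)" for j x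
  have der2: "has_partials (\<lambda>x. ?e x * m x) v x" for x
  proof -
    have "((\<lambda>x. ?e x) has_derivative (\<lambda>h. (- \<i> * of_real (h \<bullet> \<xi>)) * ?e x)) (at x)"
    proof -
      have "((\<lambda>x. - \<i> * of_real (x \<bullet> \<xi>)) has_derivative (\<lambda>h. - \<i> * of_real (h \<bullet> \<xi>))) (at x)"
        by (auto intro!: derivative_eq_intros)
      from has_derivative_compose[OF this DERIV_exp[unfolded has_field_derivative_def]]
      show ?thesis by (simp add: mult.commute)
    qed
    from has_derivative_mult[OF this der]
    show ?thesis
    proof (rule has_derivative_eq_rhs, intro ext)
      fix h :: "real^'n"
      have ip: "of_real (h \<bullet> \<xi>) = (\<Sum>j\<in>UNIV. h $ j *\<^sub>R complex_of_real (\<xi> $ j))"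
        by (simp add: inner_vec_def scaleR_conv_of_real[where 'a=complex])
      show "?e x * (\<Sum>i\<in>UNIV. h $ i *\<^sub>R m' i x) + - \<i> * complex_of_real (h \<bullet> \<xi>) * ?e x * m x =
          (\<Sum>j\<in>UNIV. h $ j *\<^sub>R v j x)"
        by (simp add: v_def ip sum_distrib_left sum_distrib_right sum.distrib sum_negf sum_subtractf
            scaleR_conv_of_real[where 'a=complex] algebra_simps)
    qed
  qed
  have contm: "continuous_on UNIV m"
    using has_derivative_continuous[OF der] by (simp add: continuous_at_imp_continuous_on)
  have contv: "continuous_on UNIV (v i)"
    unfolding v_def by (intro continuous_intros cont contm)
  have "(LINT x|lborel. v i x) = 0"
    by (rule integral_partial_derivative_eq_0(2)[OF der2 contv, of R]) (simp add: supp)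
  moreover have "integrable lborel (m' i)"
    by (rule rapid_integrable[OF compact_support_rapid[OF cont]])
       (rule integral_partial_derivative_eq_0(1)[OF der cont supp])
  moreover have "integrable lborel m"
    by (rule rapid_integrable[OF compact_support_rapid[OF contm supp]])
  ultimately have "ft (m' i) \<xi> + (- \<i> * of_real (\<xi> $ i)) * ft m \<xi> = 0"
    unfolding v_def ft_def
    using Bochner_Integration.integral_add[OF integrable_ft[of "m' i" \<xi>]
        integrable_mult_right[OF integrable_ft[of m \<xi>], of "- \<i> * of_real (\<xi> $ i)"]]
    by simp
  then show ?thesis by (simp add: eq_iff_diff_eq_0[symmetric])
qed

text \<open>Each integration by parts gains a factor \<open>\<xi> $ i\<close>.\<close>

lemma ft_coordinate_decay:
  fixes m :: "real^'n::finite \<Rightarrow> complex"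
  assumes "C_diff k UNIV m" "\<And>x. norm x > R \<Longrightarrow> m x = 0"
  shows "\<exists>C. \<forall>\<xi>. \<bar>\<xi> $ i\<bar> ^ k * norm (ft m \<xi>) \<le> C"
  using assms
proof (induction k arbitrary: m)
  case 0
  then have "integrable lborel m" by (auto intro: rapid_integrable compact_support_rapid)
  then show ?case using norm_ft_le by auto
next
  case (Suc k)
  obtain m' where m': "\<And>x. has_partials m m' x"
    and c: "\<And>i. C_diff k UNIV (m' i)" using Suc.prems(1) by auto
  note cc = C_diff_continuous[OF c]
  have "m' i x = 0" if "norm x > R" for x
    by (rule integral_partial_derivative_eq_0(1)[OF m' cc Suc.prems(2) that])
  from Suc.IH[OF c this]
  obtain C where "\<And>\<xi>. \<bar>\<xi> $ i\<bar> ^ k * norm (ft (m' i) \<xi>) \<le> C" by blast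
  moreover have "ft (m' i) \<xi> = \<i> * of_real (\<xi> $ i) * ft m \<xi>" for \<xi>
    by (rule ft_partial_derivative[OF m' cc Suc.prems(2)])
  ultimately have "\<bar>\<xi> $ i\<bar> ^ Suc k * norm (ft m \<xi>) \<le> C" for \<xi>
    by (simp add: norm_mult mult_ac)
  then show ?case by blast
qed

text \<open>Some coordinate of \<open>\<xi>\<close> is comparable to \<open>norm \<xi>\<close>, so decay along the coordinates suffices.\<close>

lemma ft_weight_bound:
  fixes m :: "real^'n::finite \<Rightarrow> complex"
  assumes m: "C_diff (CARD('n) + 1) UNIV m" and supp: "\<And>x. norm x > R \<Longrightarrow> m x = 0"
  shows "\<exists>C\<ge>0. \<forall>\<xi>. norm (ft m \<xi>) \<le> C * weight \<xi>"
proof -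
  let ?N = "CARD('n) + 1"
  have "integrable lborel m"
    by (rule rapid_integrable[OF compact_support_rapid[OF C_diff_continuous[OF m] supp]])
  then obtain C0 where C0: "\<And>\<xi>. norm (ft m \<xi>) \<le> C0" using norm_ft_le by blast
  have C0n: "0 \<le> C0" using C0[of 0] norm_ge_zero order_trans by blast
  have "\<exists>C. \<forall>\<xi>. \<bar>\<xi> $ i\<bar> ^ ?N * norm (ft m \<xi>) \<le> C" for i
    by (rule ft_coordinate_decay[OF m supp])
  then obtain D where D: "\<And>i \<xi>. \<bar>\<xi> $ i\<bar> ^ ?N * norm (ft m \<xi>) \<le> D i" by metis
  have Dn: "0 \<le> D i" for i using D[where i=i and \<xi>=0] by simp
  define C where "C = 2 ^ ?N * C0 + (2 * real CARD('n)) ^ ?N * (\<Sum>i\<in>UNIV. D i)"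
  have key: "(1 + norm \<xi>) ^ ?N * norm (ft m \<xi>) \<le> C" for \<xi>
  proof (cases "norm \<xi> \<le> 1")
    case True
    have "(1 + norm \<xi>) ^ ?N * norm (ft m \<xi>) \<le> 2 ^ ?N * C0"
      using True by (intro mult_mono power_mono C0) auto
    also have "\<dots> \<le> C" unfolding C_def using Dn by (simp add: sum_nonneg)
    finally show ?thesis .
  next
    case False
    obtain i where i: "norm \<xi> \<le> real CARD('n) * \<bar>\<xi> $ i\<bar>"
    proof (rule ccontr)
      assume "\<not> thesis"
      then have "\<And>i. \<bar>\<xi> $ i\<bar> < norm \<xi> / real CARD('n)" using that by (force simp: field_simps not_le)
      then have "(\<Sum>i\<in>UNIV. \<bar>\<xi> $ i\<bar>) < (\<Sum>i\<in>(UNIV::'n set). norm \<xi> / real CARD('n))"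
        by (intro sum_strict_mono) auto
      also have "\<dots> = norm \<xi>" by simp
      finally show False using norm_le_l1_cart[of \<xi>] by simp
    qed
    have "1 + norm \<xi> \<le> 2 * real CARD('n) * \<bar>\<xi> $ i\<bar>" using i False by simp
    then have "(1 + norm \<xi>) ^ ?N \<le> (2 * real CARD('n)) ^ ?N * \<bar>\<xi> $ i\<bar> ^ ?N"
      unfolding power_mult_distrib[symmetric] by (intro power_mono) auto
    then have "(1 + norm \<xi>) ^ ?N * norm (ft m \<xi>) \<le> (2 * real CARD('n)) ^ ?N * (\<bar>\<xi> $ i\<bar> ^ ?N * norm (ft m \<xi>))"
      unfolding mult.assoc[symmetric] by (intro mult_right_mono) auto
    also have "\<dots> \<le> (2 * real CARD('n)) ^ ?N * (\<Sum>i\<in>UNIV. D i)"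
    proof (intro mult_left_mono order_trans[OF D])
      show "D i \<le> (\<Sum>i\<in>UNIV. D i)" by (rule member_le_sum) (auto simp: Dn)
    qed simp
    also have "\<dots> \<le> C" unfolding C_def using C0n by simp
    finally show ?thesis .
  qed
  have "norm (ft m \<xi>) \<le> C * weight \<xi>" for \<xi>
  proof -
    have "0 < (1 + norm \<xi>) ^ ?N" by (simp add: add_pos_nonneg)
    then show ?thesis using key[of \<xi>] unfolding weight_def by (simp add: field_simps)
  qed
  moreover have "0 \<le> C" unfolding C_def using C0n Dn by (simp add: sum_nonneg)
  ultimately show ?thesis by blast
qed

section \<open>A Calderon reproducing formula\<close>

text \<open>Normalised to preserve integrals.\<close>

definition dil :: "nat \<Rightarrow> (real^'n::finite \<Rightarrow> complex) \<Rightarrow> real^'n \<Rightarrow> complex" where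
  "dil j g x = 2 ^ (j * CARD('n)) * g (2 ^ j *\<^sub>R x)"

lemma ft_dil:
  fixes g :: "real^'n::finite \<Rightarrow> complex"
  assumes "g \<in> borel_measurable borel"
  shows "ft (dil j g) \<xi> = ft g (inverse (2 ^ j) *\<^sub>R \<xi>)"
proof -
  have "ft (dil j g) \<xi> = 2 ^ (j * CARD('n)) * ft (\<lambda>x. g (2 ^ j *\<^sub>R x)) \<xi>"
    unfolding dil_def ft_def by (simp add: mult.left_commute)
  then show ?thesis using ft_scale[OF assms, of "2 ^ j" \<xi>] by (simp add: power_mult)
qed

lemma dil_inverse_ft:
  fixes m :: "real^'n::finite \<Rightarrow> complex"
  assumes "m \<in> borel_measurable borel"
  shows "dil j (\<lambda>x. ft m (- x)) x = ft (\<lambda>\<xi>. m (inverse (2 ^ j) *\<^sub>R \<xi>)) (- x)"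
  using ft_scale[OF assms, of "inverse (2 ^ j)" "- x"]
  by (simp add: dil_def power_mult power_inverse divide_inverse mult.commute)

lemma integrable_dil:
  fixes g :: "real^'n::finite \<Rightarrow> complex"
  assumes "integrable lborel g"
  shows "integrable lborel (dil j g)"
proof -
  have "g \<in> borel_measurable borel" using assms by (auto dest: borel_measurable_integrable)
  then have "integrable lborel (\<lambda>x. g (0 + 2 ^ j *\<^sub>R x))"
    using lborel_affine_integral(1)[of g "2 ^ j" 0] assms by simp
  then show ?thesis unfolding dil_def[abs_def] by simp
qed

lemma continuous_nonneg_integral_pos:
  fixes f :: "'a::euclidean_space \<Rightarrow> real"
  assumes "integrable lborel f" "\<And>x. 0 \<le> f x" "open S" "S \<noteq> {}" "\<And>x. x \<in> S \<Longrightarrow> f x \<noteq> 0"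
  shows "0 < (LINT x|lborel. f x)"
proof (rule ccontr)
  assume "\<not> ?thesis"
  moreover have "0 \<le> (LINT x|lborel. f x)" using assms(2) by simp
  ultimately have "(LINT x|lborel. f x) = 0" by simp
  then have "AE x in lborel. f x = 0"
    using integral_nonneg_eq_0_iff_AE[OF assms(1)] assms(2) by simp
  then have "AE x in lborel. x \<notin> S" by eventually_elim (use assms(5) in auto)
  then have "S \<in> null_sets lborel" using assms(3) by (subst AE_iff_null_sets) auto
  then have "negligible S" by (auto simp: negligible_iff_null_sets intro: null_sets_completionI)
  then show False using open_not_negligible assms(3,4) by blast
qed

text \<open>Dilating \<open>g\<close> towards the constant \<open>g 0\<close> in the multiplication formula gives the value
  of the integral of \<open>ft M\<close> up to the factor \<open>g 0\<close>, which is all that is needed of Fourier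
  inversion.\<close>

lemma integral_ft_times:
  fixes M g :: "real^'n::finite \<Rightarrow> complex"
  assumes M: "continuous_on UNIV M" "integrable lborel M" "bounded (range M)"
    and fM: "integrable lborel (ft M)"
    and g: "continuous_on UNIV g" "integrable lborel g" "bounded (range g)"
    and fg: "integrable lborel (ft g)"
  shows "(LINT y|lborel. ft M y) * g 0 = M 0 * (LINT \<xi>|lborel. ft g \<xi>)"
proof -
  define e where "e k = 1 / real (Suc k)" for k
  have e: "0 < e k" for k by (simp add: e_def)
  have elim: "e \<longlonglongrightarrow> 0" using LIMSEQ_Suc[OF lim_1_over_n, where 'a1=real] by (simp add: e_def[abs_def])
  have tozero: "(\<lambda>k. F (e k *\<^sub>R x)) \<longlonglongrightarrow> F 0" if "continuous_on UNIV F"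
    for F :: "real^'n \<Rightarrow> complex" and x
  proof -
    have "(\<lambda>k. e k *\<^sub>R x) \<longlonglongrightarrow> 0" using tendsto_scaleR[OF elim tendsto_const[of x]] by simp
    moreover have "isCont F 0" using that by (simp add: continuous_on_eq_continuous_at)
    ultimately show ?thesis by (rule isCont_tendsto_compose[rotated])
  qed
  have [measurable]: "M \<in> borel_measurable borel" "g \<in> borel_measurable borel"
      "ft M \<in> borel_measurable borel" "ft g \<in> borel_measurable borel"
    using M g fM fg by (auto dest: borel_measurable_integrable)
  obtain BM where BM: "\<And>x. norm (M x) \<le> BM" using M(3) unfolding bounded_iff by blast
  obtain Bg where Bg: "\<And>x. norm (g x) \<le> Bg" using g(3) unfolding bounded_iff by blast
  have eq: "(LINT y|lborel. ft M y * g (e k *\<^sub>R y)) = (LINT \<xi>|lborel. M (e k *\<^sub>R \<xi>) * ft g \<xi>)" for k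
  proof -
    have "integrable lborel (\<lambda>y. g (e k *\<^sub>R y))"
      using lborel_affine_integral(1)[of g "e k" 0] g e[of k] by simp
    from ft_multiplication[OF M(2) this]
    have "(LINT y|lborel. ft M y * g (e k *\<^sub>R y))
        = (LINT \<xi>|lborel. M \<xi> * (ft g (inverse (e k) *\<^sub>R \<xi>) / of_real (e k ^ CARD('n))))"
      using e[of k] by (subst (asm) ft_scale) auto
    also have "\<dots> = (e k ^ CARD('n)) *\<^sub>R (LINT \<xi>|lborel. M (e k *\<^sub>R \<xi>) *
        (ft g (inverse (e k) *\<^sub>R (e k *\<^sub>R \<xi>)) / of_real (e k ^ CARD('n))))"
      using e[of k] by (subst lborel_affine_integral(2)[where c="e k" and t=0]) auto
    also have "\<dots> = (LINT \<xi>|lborel. M (e k *\<^sub>R \<xi>) * ft g \<xi>)"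
      using e[of k] by (simp add: scaleR_conv_of_real[where 'a=complex])
    finally show ?thesis .
  qed
  have "(\<lambda>k. LINT y|lborel. ft M y * g (e k *\<^sub>R y)) \<longlonglongrightarrow> (LINT y|lborel. ft M y * g 0)"
  proof (rule integral_dominated_convergence)
    show "integrable lborel (\<lambda>y. norm (ft M y) * Bg)" using fM by simp
    show "AE x in lborel. (\<lambda>k. ft M x * g (e k *\<^sub>R x)) \<longlonglongrightarrow> ft M x * g 0"
      by (intro AE_I2 tendsto_mult tendsto_const tozero g)
    show "AE x in lborel. norm (ft M x * g (e k *\<^sub>R x)) \<le> norm (ft M x) * Bg" for k
      by (intro AE_I2) (auto simp: norm_mult intro!: mult_left_mono Bg)
  qed auto
  moreover have "(\<lambda>k. LINT \<xi>|lborel. M (e k *\<^sub>R \<xi>) * ft g \<xi>) \<longlonglongrightarrow> (LINT \<xi>|lborel. M 0 * ft g \<xi>)"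
  proof (rule integral_dominated_convergence)
    show "integrable lborel (\<lambda>y. BM * norm (ft g y))" using fg by simp
    show "AE x in lborel. (\<lambda>k. M (e k *\<^sub>R x) * ft g x) \<longlonglongrightarrow> M 0 * ft g x"
      by (intro AE_I2 tendsto_mult tendsto_const tozero M)
    show "AE x in lborel. norm (M (e k *\<^sub>R x) * ft g x) \<le> BM * norm (ft g x)" for k
      by (intro AE_I2) (auto simp: norm_mult intro!: mult_right_mono BM)
  qed auto
  ultimately have "(LINT y|lborel. ft M y * g 0) = (LINT \<xi>|lborel. M 0 * ft g \<xi>)"
    unfolding eq by (rule LIMSEQ_unique)
  then show ?thesis by simp
qed

text \<open>With \<open>P = ft \<phi>\<close>, dividing \<open>P\<^sup>2\<close> by the sum \<open>th\<close> of its dyadic dilates gives a function \<open>K\<close> whose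
  dilates form a partition of unity away from the origin. Since \<open>P\<close> vanishes outside of an annulus, five
  terms of this sum are enough where \<open>P\<close> is nonzero. Summing the partition over the low frequencies
  gives \<open>M\<close>, which equals \<open>1\<close> near the origin and has compact support; then \<open>M (\<xi> / 2) - M \<xi> = K (\<xi> / 2)\<close>. The kernels are the inverse Fourier integrals
  \<open>\<Phi>\<close> of \<open>M\<close> and \<open>\<psi>\<close> of \<open>m = P / th\<close>, and \<open>K = m P\<close> becomes the convolution of \<open>\<psi>\<close> with \<open>\<phi>\<close>.
  As \<open>P\<close> is real, \<open>th\<close> is a sum of nonnegative terms and has no zero there; as \<open>P\<close> is nonnegative,
  its integral is positive, which by \<open>integral_ft_times\<close> forces the integral of \<open>\<Phi>\<close> to be nonzero.\<close>

lemma Calderon_formula: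
  fixes \<phi> :: "real^'n::finite \<Rightarrow> complex"
  assumes rapid: "rapid \<phi>" and cont: "continuous_on UNIV \<phi>" and bdd: "bounded (range \<phi>)"
    and pos: "\<And>\<xi>. ft \<phi> \<xi> \<in> \<real> \<and> 0 \<le> Re (ft \<phi> \<xi>)"
    and supp: "\<And>\<xi>. ft \<phi> \<xi> \<noteq> 0 \<Longrightarrow> 1/2 \<le> norm \<xi> \<and> norm \<xi> \<le> 2"
    and low: "\<And>\<xi>. 3/5 \<le> norm \<xi> \<Longrightarrow> norm \<xi> \<le> 5/3 \<Longrightarrow> ft \<phi> \<xi> \<noteq> 0"
  obtains \<Phi> \<psi> C where "continuous_on UNIV \<Phi>" "continuous_on UNIV \<psi>"
    "\<And>x. norm (\<Phi> x) \<le> C * weight x" "\<And>x. norm (\<psi> x) \<le> C * weight x"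
    "(LINT x|lborel. \<Phi> x) \<noteq> 0" "0 \<le> C"
    "\<And>j x. dil (Suc j) \<Phi> x - dil j \<Phi> x = (LINT y|lborel. dil (Suc j) \<psi> y * dil (Suc j) \<phi> (x - y))"
proof -
  define P where "P = ft \<phi>"
  have CP: "C_diff k UNIV P" for k unfolding P_def by (rule rapid_C_diff_ft[OF rapid])
  have P0: "P \<xi> = 0" if "norm \<xi> < 1/2 \<or> 2 < norm \<xi>" for \<xi>
    using supp[of \<xi>] that unfolding P_def by fastforce
  define th where "th \<xi> = (P (4 *\<^sub>R \<xi>))\<^sup>2 + ((P (2 *\<^sub>R \<xi>))\<^sup>2 + ((P (1 *\<^sub>R \<xi>))\<^sup>2 + ((P ((1/2) *\<^sub>R \<xi>))\<^sup>2 + (P ((1/4) *\<^sub>R \<xi>))\<^sup>2)))" for \<xi>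
  have sq: "Im ((P \<xi>)\<^sup>2) = 0 \<and> 0 \<le> Re ((P \<xi>)\<^sup>2) \<and> (3/5 \<le> norm \<xi> \<and> norm \<xi> \<le> 5/3 \<longrightarrow> 0 < Re ((P \<xi>)\<^sup>2))" for \<xi>
  proof -
    have "Im (P \<xi>) = 0" using pos[of \<xi>] unfolding P_def by (simp add: complex_is_Real_iff)
    then show ?thesis using low[of \<xi>] unfolding P_def[symmetric]
      by (auto simp: power2_eq_square complex_eq_iff zero_less_mult_iff)
  qed
  \<comment> \<open>The annuli \<open>3/5 \<le> norm \<xi> \<le> 5/3\<close> of the five dilates overlap and cover the range below.\<close>
  have th_nz: "th \<xi> \<noteq> 0" if r: "1/4 < norm \<xi>" "norm \<xi> < 4" for \<xi>
  proof -
    have "0 < Re (th \<xi>)"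
    proof -
      consider "3/20 \<le> norm \<xi> \<and> norm \<xi> \<le> 5/12" | "3/10 \<le> norm \<xi> \<and> norm \<xi> \<le> 5/6"
        | "3/5 \<le> norm \<xi> \<and> norm \<xi> \<le> 5/3" | "6/5 \<le> norm \<xi> \<and> norm \<xi> \<le> 10/3"
        | "12/5 \<le> norm \<xi> \<and> norm \<xi> \<le> 20/3" using r by argo
      then show ?thesis
        using sq[of "4 *\<^sub>R \<xi>"] sq[of "2 *\<^sub>R \<xi>"] sq[of "1 *\<^sub>R \<xi>"] sq[of "(1/2) *\<^sub>R \<xi>"] sq[of "(1/4) *\<^sub>R \<xi>"]
        unfolding th_def plus_complex.sel norm_scaleR by cases (simp_all only: abs_numeral abs_one abs_divide, linarith+)
    qed
    then show ?thesis by auto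
  qed
  have Cth: "C_diff k UNIV th" for k
    unfolding th_def[abs_def] power2_eq_square
    by (intro C_diff_add C_diff_mult C_diff_scale[OF CP]) auto
  define m where "m \<xi> = P \<xi> * inverse (th \<xi>)" for \<xi>
  have open_norm: "open {\<xi>::real^'n. a < norm \<xi>}" "open {\<xi>::real^'n. norm \<xi> < a}" for a
    by (intro open_Collect_less continuous_intros)+
  have Cm: "C_diff k UNIV m" for k
  proof -
    let ?U = "{\<xi>::real^'n. 1/4 < norm \<xi>} \<inter> {\<xi>. norm \<xi> < 4}"
    let ?V = "{\<xi>::real^'n. norm \<xi> < 1/2} \<union> {\<xi>. 2 < norm \<xi>}"
    have "C_diff k ?U m"
      unfolding m_def[abs_def]
      by (intro C_diff_mult C_diff_inverse C_diff_subset[OF CP] C_diff_subset[OF Cth]) (use th_nz in auto)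
    moreover have "C_diff k ?V m"
      by (rule C_diff_cong[OF open_Un[OF open_norm(2) open_norm(1)] _ C_diff_const[of _ _ 0]])
         (use P0 in \<open>auto simp: m_def\<close>)
    moreover have "?U \<union> ?V = UNIV" by auto
    ultimately show ?thesis
      using C_diff_Un[of ?U ?V k m] open_norm by (metis open_Int open_Un)
  qed
  have m0: "m \<xi> = 0" if "norm \<xi> > 2" for \<xi> using P0[of \<xi>] that by (simp add: m_def)
  define K where "K \<xi> = m \<xi> * P \<xi>" for \<xi>
  have CK: "C_diff k UNIV K" for k unfolding K_def[abs_def] by (intro C_diff_mult Cm CP)
  have K0: "K \<xi> = 0" if "norm \<xi> < 1/2 \<or> 2 < norm \<xi>" for \<xi>
    using P0[OF that] by (simp add: K_def)
  have partition: "K \<xi> + K ((1/2) *\<^sub>R \<xi>) + K ((1/4) *\<^sub>R \<xi>) = 1" if "1 < norm \<xi>" "norm \<xi> < 4" for \<xi>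
  proof -
    define s where "s = (P \<xi>)\<^sup>2 + (P ((1/2) *\<^sub>R \<xi>))\<^sup>2 + (P ((1/4) *\<^sub>R \<xi>))\<^sup>2"
    have z: "P (4 *\<^sub>R \<xi>) = 0" "P (2 *\<^sub>R \<xi>) = 0" "P ((1/8) *\<^sub>R \<xi>) = 0" "P ((1/16) *\<^sub>R \<xi>) = 0"
      by (rule P0, use that in simp)+
    have th: "th \<xi> = s" "th ((1/2) *\<^sub>R \<xi>) = s" "th ((1/4) *\<^sub>R \<xi>) = s"
      unfolding th_def s_def by (simp_all add: z)
    have "s \<noteq> 0" using th_nz[of \<xi>] th that by simp
    then show ?thesis unfolding K_def m_def th
      by (simp add: divide_simps flip: divide_inverse) (simp add: s_def power2_eq_square)
  qed
  \<comment> \<open>For \<open>1 < norm \<xi> < 2\<close> the two branches agree by \<open>partition\<close>, so \<open>M\<close> is smooth across \<open>3/2\<close>.\<close>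
  define M where "M \<xi> = (if norm \<xi> < 3/2 then 1 - K ((1/2) *\<^sub>R \<xi>) else K \<xi>)" for \<xi>
  have CM: "C_diff k UNIV M" for k
  proof -
    have a: "C_diff k {\<xi>::real^'n. norm \<xi> < 2} (\<lambda>\<xi>. 1 - K ((1/2) *\<^sub>R \<xi>))"
      by (intro C_diff_diff C_diff_const C_diff_scale[OF CK]) auto
    have b: "1 - K ((1/2) *\<^sub>R \<xi>) = M \<xi>" if "norm \<xi> < 2" for \<xi>
    proof (cases "norm \<xi> < 3/2")
      case False
      then show ?thesis using partition[of \<xi>] K0[of "(1/4) *\<^sub>R \<xi>"] that by (simp add: M_def algebra_simps)
    qed (simp add: M_def)
    have 1: "C_diff k {\<xi>::real^'n. norm \<xi> < 2} M"
      by (rule C_diff_cong[OF open_norm(2) _ a]) (use b in blast)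
    have c: "K \<xi> = M \<xi>" if "1 < norm \<xi>" for \<xi>
    proof (cases "norm \<xi> < 3/2")
      case True
      then show ?thesis using partition[of \<xi>] K0[of "(1/4) *\<^sub>R \<xi>"] that by (simp add: M_def algebra_simps)
    qed (simp add: M_def)
    have 2: "C_diff k {\<xi>::real^'n. 1 < norm \<xi>} M"
      by (rule C_diff_cong[OF open_norm(1) _ C_diff_subset[OF CK subset_UNIV]]) (use c in blast)
    have "{\<xi>::real^'n. norm \<xi> < 2} \<union> {\<xi>. 1 < norm \<xi>} = UNIV" by auto
    then show ?thesis using C_diff_Un[OF open_norm(2,1) 1 2] by simp
  qed
  have M0: "M \<xi> = 0" if "norm \<xi> > 2" for \<xi> using K0[of \<xi>] that by (simp add: M_def)
  have M_diff: "M ((1/2) *\<^sub>R \<xi>) - M \<xi> = K ((1/2) *\<^sub>R \<xi>)" for \<xi>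
  proof -
    consider "norm \<xi> < 3/2" | "3/2 \<le> norm \<xi>" "norm \<xi> < 3" | "3 \<le> norm \<xi>" by linarith
    then show ?thesis
    proof cases
      case 1 then show ?thesis using K0[of "(1/4) *\<^sub>R \<xi>"] by (simp add: M_def)
    next
      case 2 then show ?thesis using partition[of \<xi>] by (simp add: M_def algebra_simps)
    next
      case 3 then show ?thesis using K0[of \<xi>] by (simp add: M_def)
    qed
  qed
  have rm: "rapid m" "rapid M" "rapid P"
    using compact_support_rapid[OF C_diff_continuous[OF Cm] m0]
      compact_support_rapid[OF C_diff_continuous[OF CM] M0]
      compact_support_rapid[OF C_diff_continuous[OF CP], of 2] P0 by blast+
  note im = rm[THEN rapid_integrable]
  obtain C1 where C1: "\<And>\<xi>. norm (ft m \<xi>) \<le> C1 * weight \<xi>" "0 \<le> C1" using ft_weight_bound[OF Cm m0] by blast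
  obtain C2 where C2: "\<And>\<xi>. norm (ft M \<xi>) \<le> C2 * weight \<xi>" "0 \<le> C2" using ft_weight_bound[OF CM M0] by blast
  define \<Phi> where "\<Phi> x = ft M (- x)" for x
  define \<psi> where "\<psi> x = ft m (- x)" for x
  have c: "continuous_on UNIV \<Phi>" "continuous_on UNIV \<psi>"
    unfolding \<Phi>_def \<psi>_def using rm
    by (auto intro!: continuous_on_compose2[OF continuous_ft] continuous_intros)
  have w: "weight (- x) = weight x" for x :: "real^'n" by (simp add: weight_def)
  have b: "norm (\<Phi> x) \<le> max C1 C2 * weight x" "norm (\<psi> x) \<le> max C1 C2 * weight x" for x
    unfolding \<Phi>_def \<psi>_def using C1(1)[of "- x"] C2(1)[of "- x"]
      mult_right_mono[OF max.cobounded1[of C1 C2] weight_nonneg[of x]]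
      mult_right_mono[OF max.cobounded2[of C2 C1] weight_nonneg[of x]]
    unfolding w by linarith+
  have [measurable]: "M \<in> borel_measurable borel" "m \<in> borel_measurable borel" "\<phi> \<in> borel_measurable borel"
    "ft M \<in> borel_measurable borel"
    using C_diff_continuous[OF CM] C_diff_continuous[OF Cm] cont continuous_ft[OF rm(2)]
    by (auto intro: borel_measurable_continuous_onI)
  have int: "(LINT x|lborel. \<Phi> x) \<noteq> 0"
  proof -
    have fM: "integrable lborel (ft M)"
      by (rule integrable_weight_bound[OF _ C2(1)]) simp
    have bM: "bounded (range M)"
    proof -
      have "compact (M ` cball 0 2)"
        by (intro compact_continuous_image continuous_on_subset[OF C_diff_continuous[OF CM]]) auto
      then have "bounded (insert 0 (M ` cball 0 2))" by (simp add: compact_imp_bounded)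
      then show ?thesis
        by (rule bounded_subset) (use M0 in \<open>force simp: not_le\<close>)
    qed
    have "(LINT y|lborel. ft M y) * \<phi> 0 = M 0 * (LINT \<xi>|lborel. ft \<phi> \<xi>)"
      by (rule integral_ft_times[OF C_diff_continuous[OF CM] im(2) bM fM cont rapid_integrable[OF rapid] bdd])
         (use im(3) in \<open>simp add: P_def\<close>)
    moreover have "M 0 = 1" using K0[of 0] by (simp add: M_def)
    moreover have "(LINT \<xi>|lborel. ft \<phi> \<xi>) \<noteq> 0"
    proof -
      have "0 < (LINT \<xi>|lborel. Re (P \<xi>))"
      proof (rule continuous_nonneg_integral_pos)
        show "integrable lborel (\<lambda>\<xi>. Re (P \<xi>))" using im(3) by simp
        show "0 \<le> Re (P \<xi>)" for \<xi> using pos by (simp add: P_def)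
        let ?S = "{\<xi>::real^'n. 3/5 < norm \<xi>} \<inter> {\<xi>. norm \<xi> < 5/3}"
        show "open ?S" by (intro open_Int open_norm)
        have "axis undefined 1 \<in> ?S" by (simp add: norm_axis_1)
        then show "?S \<noteq> {}" by blast
        show "Re (P \<xi>) \<noteq> 0" if "\<xi> \<in> ?S" for \<xi>
          using low[of \<xi>] pos[of \<xi>] that by (auto simp: P_def complex_is_Real_iff complex_eq_iff)
      qed
      then have "Re (LINT \<xi>|lborel. P \<xi>) \<noteq> 0" using im(3) by simp
      then show ?thesis unfolding P_def by auto
    qed
    ultimately have "(LINT y|lborel. ft M y) \<noteq> 0" by auto
    then show ?thesis unfolding \<Phi>_def using integral_lborel_reflection(1)[of "ft M" 0] by simp
  qed
  have formula: "dil (Suc j) \<Phi> x - dil j \<Phi> x = (LINT y|lborel. dil (Suc j) \<psi> y * dil (Suc j) \<phi> (x - y))" for j x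
  proof -
    let ?a = "inverse (2 ^ Suc j) :: real" and ?b = "inverse (2 ^ j) :: real"
    have scale: "integrable lborel (\<lambda>\<xi>. F (a *\<^sub>R \<xi>))" if "integrable lborel F" "0 < a"
      for F :: "real^'n \<Rightarrow> complex" and a
      using lborel_affine_integral(1)[of F a 0] that by (auto dest: borel_measurable_integrable)
    have "dil (Suc j) \<Phi> x - dil j \<Phi> x = ft (\<lambda>\<xi>. M (?a *\<^sub>R \<xi>)) (- x) - ft (\<lambda>\<xi>. M (?b *\<^sub>R \<xi>)) (- x)"
      unfolding \<Phi>_def[abs_def] by (simp only: dil_inverse_ft[OF \<open>M \<in> borel_measurable borel\<close>])
    also have "\<dots> = ft (\<lambda>\<xi>. M (?a *\<^sub>R \<xi>) - M (?b *\<^sub>R \<xi>)) (- x)"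
      unfolding ft_def right_diff_distrib
      by (rule Bochner_Integration.integral_diff[symmetric]; rule integrable_ft; rule scale[OF im(2)]) auto
    also have "(\<lambda>\<xi>. M (?a *\<^sub>R \<xi>) - M (?b *\<^sub>R \<xi>)) = (\<lambda>\<xi>. m (?a *\<^sub>R \<xi>) * ft (dil (Suc j) \<phi>) \<xi>)"
    proof
      fix \<xi> :: "real^'n"
      show "M (?a *\<^sub>R \<xi>) - M (?b *\<^sub>R \<xi>) = m (?a *\<^sub>R \<xi>) * ft (dil (Suc j) \<phi>) \<xi>"
        using M_diff[of "?b *\<^sub>R \<xi>"] ft_dil[OF \<open>\<phi> \<in> borel_measurable borel\<close>, of "Suc j" \<xi>]
        by (simp add: K_def P_def)
    qed
    also have "ft (\<lambda>\<xi>. m (?a *\<^sub>R \<xi>) * ft (dil (Suc j) \<phi>) \<xi>) (- x) =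
        (LINT y|lborel. ft (\<lambda>\<xi>. m (?a *\<^sub>R \<xi>)) (- y) * dil (Suc j) \<phi> (x - y))"
      by (rule convolution_inverse_ft[symmetric])
         (use scale[OF im(1), of ?a] integrable_dil[OF rapid_integrable[OF rapid]] in simp_all)
    also have "\<dots> = (LINT y|lborel. dil (Suc j) \<psi> y * dil (Suc j) \<phi> (x - y))"
      unfolding \<psi>_def[abs_def] by (simp only: dil_inverse_ft[OF \<open>m \<in> borel_measurable borel\<close>])
    finally show ?thesis .
  qed
  show thesis
    by (rule that[OF c b int _ formula]) (use C1(2) in simp)
qed

section \<open>Approximate identities\<close>

text \<open>Between a compact subset and an open superset of almost the same measure there is room for a small shift.\<close>

lemma borel_symmetric_difference_continuous:
  fixes E :: "'a::euclidean_space set"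
  assumes E: "E \<in> sets borel" "bounded E" and e: "0 < e"
  obtains d where "0 < d"
    "\<And>h. norm h < d \<Longrightarrow> (\<integral>\<^sup>+x. ennreal \<bar>indicator E (x - h) - indicator E x\<bar> \<partial>lborel) \<le> ennreal e"
proof -
  have EL: "E \<in> sets lebesgue" using E by auto
  obtain U where U: "open U" "E \<subseteq> U" "emeasure lebesgue (U - E) < ennreal (e / 4)"
    using sets_lebesgue_outer_open[OF EL, of "e / 4"] e by (metis divide_pos_pos zero_less_numeral)
  obtain T where T: "closed T" "T \<subseteq> E" "emeasure lebesgue (E - T) < ennreal (e / 4)"
    using sets_lebesgue_inner_closed[OF EL, of "e / 4"] e by (metis divide_pos_pos zero_less_numeral)
  have [measurable]: "U \<in> sets borel" "T \<in> sets borel" "E \<in> sets borel" using U T E by auto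
  have "compact T" using T E bounded_subset compact_eq_bounded_closed by blast
  then obtain d where d: "d > 0" "(\<Union>x\<in>T. ball x d) \<subseteq> U"
    using compact_subset_open_imp_ball_epsilon_subset[of T U] U T by blast
  let ?A = "E - T" and ?B = "U - E"
  have mA: "emeasure lborel ?A \<le> ennreal (e / 4)" and mB: "emeasure lborel ?B \<le> ennreal (e / 4)"
    using U(3) T(3) by (auto simp: less_imp_le)
  have main: "(\<integral>\<^sup>+x. ennreal \<bar>indicator E (x - h) - indicator E x\<bar> \<partial>lborel) \<le> ennreal e" if h: "norm h < d" for h
  proof -
    have near: "x - h \<in> U" if "x \<in> T" for x
    proof -
      have "x - h \<in> ball x d" using h by (simp add: dist_norm)
      then show ?thesis using d(2) that by blast
    qed
    have near': "x \<in> U" if "x - h \<in> T" for x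
    proof -
      have "x \<in> ball (x - h) d" using h by (simp add: dist_norm)
      then show ?thesis using d(2) that by blast
    qed
    have shift: "(\<integral>\<^sup>+x. f (x - h) \<partial>lborel) = (\<integral>\<^sup>+x. f x \<partial>lborel)" if "f \<in> borel_measurable borel" for f :: "'a \<Rightarrow> ennreal"
      using nn_integral_lborel_translation[OF that, of "- h"] by (simp add: algebra_simps)
    let ?f = "\<lambda>x. (indicator ?A x + indicator ?B x) :: ennreal"
    have "(\<integral>\<^sup>+x. ennreal \<bar>indicator E (x - h) - indicator E x\<bar> \<partial>lborel)
        \<le> (\<integral>\<^sup>+x. ?f (x - h) + ?f x \<partial>lborel)"
    proof (intro nn_integral_mono)
      fix x
      show "ennreal \<bar>indicator E (x - h) - indicator E x\<bar> \<le> ?f (x - h) + ?f x"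
        using near[of x] near'[of x] T(2) by (auto simp: indicator_def split: if_splits)
    qed
    also have "\<dots> = (\<integral>\<^sup>+x. ?f (x - h) \<partial>lborel) + (\<integral>\<^sup>+x. ?f x \<partial>lborel)"
      by (intro nn_integral_add) measurable
    also have "\<dots> = (\<integral>\<^sup>+x. ?f x \<partial>lborel) + (\<integral>\<^sup>+x. ?f x \<partial>lborel)"
      by (subst shift) auto
    also have "(\<integral>\<^sup>+x. ?f x \<partial>lborel) = emeasure lborel ?A + emeasure lborel ?B"
      by (subst nn_integral_add) auto
    also have "\<dots> + \<dots> \<le> (ennreal (e/4) + ennreal (e/4)) + (ennreal (e/4) + ennreal (e/4))"
      by (intro add_mono mA mB)
    also have "\<dots> = ennreal e" using e by (simp flip: ennreal_plus)
    finally show ?thesis .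
  qed
  show thesis by (rule that[OF d(1) main])
qed

lemma norm_integral_le_nn_integral:
  fixes f :: "'a \<Rightarrow> 'b::{banach, second_countable_topology}"
  shows "ennreal (norm (LINT x|M. f x)) \<le> (\<integral>\<^sup>+x. norm (f x) \<partial>M)"
  by (cases "integrable M f") (simp_all add: integral_norm_bound_ennreal not_integrable_integral_eq)

definition mollify :: "(real^'n::finite \<Rightarrow> complex) \<Rightarrow> (real^'n) set \<Rightarrow> real^'n \<Rightarrow> complex" where
  "mollify g E x = (LINT y|lborel. indicator E y * g (x - y))"

lemma borel_measurable_mollify [measurable]:
  fixes g :: "real^'n::finite \<Rightarrow> complex"
  assumes [measurable]: "g \<in> borel_measurable borel" "E \<in> sets borel"
  shows "mollify g E \<in> borel_measurable borel"
proof -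
  have "(\<lambda>(x, y). indicator E y * g (x - y)) \<in> borel_measurable (borel \<Otimes>\<^sub>M lborel)" by measurable
  then have "(\<lambda>x. LINT y|lborel. indicator E y * g (x - y)) \<in> borel_measurable borel"
    by (rule lborel.borel_measurable_lebesgue_integral)
  then show ?thesis unfolding mollify_def[abs_def] .
qed

lemma borel_measurable_dil [measurable]:
  fixes g :: "real^'n::finite \<Rightarrow> complex"
  assumes [measurable]: "g \<in> borel_measurable borel"
  shows "dil j g \<in> borel_measurable borel"
  unfolding dil_def[abs_def] by measurable

lemma integrable_mollifier:
  fixes g :: "real^'n::finite \<Rightarrow> complex"
  assumes "integrable lborel g" "E \<in> sets borel"
  shows "integrable lborel (\<lambda>y. indicator E y * g (x - y))"
proof -
  have [measurable]: "g \<in> borel_measurable borel" "E \<in> sets borel" using assms by (auto dest: borel_measurable_integrable)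
  have "integrable lborel (\<lambda>y. g (x - y))" using assms by (simp add: integral_lborel_reflection(2))
  then show ?thesis
    by (rule Bochner_Integration.integrable_bound) (auto simp: indicator_def norm_mult)
qed

lemma nn_integral_norm_dil:
  fixes g :: "real^'n::finite \<Rightarrow> complex"
  assumes [measurable]: "g \<in> borel_measurable borel"
  shows "(\<integral>\<^sup>+x. norm (dil j g x) \<partial>lborel) = (\<integral>\<^sup>+x. norm (g x) \<partial>lborel)"
proof -
  have "(\<integral>\<^sup>+x. norm (g x) \<partial>lborel) = ennreal ((2 ^ j) ^ CARD('n)) * (\<integral>\<^sup>+x. norm (g (0 + 2 ^ j *\<^sub>R x)) \<partial>lborel)"
    by (subst nn_integral_lborel_affine[where c="2 ^ j" and t=0]) auto
  also have "\<dots> = (\<integral>\<^sup>+x. ennreal ((2 ^ j) ^ CARD('n)) * norm (g (2 ^ j *\<^sub>R x)) \<partial>lborel)"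
    by (simp add: nn_integral_cmult)
  also have "\<dots> = (\<integral>\<^sup>+x. norm (dil j g x) \<partial>lborel)"
    by (simp add: dil_def norm_mult norm_power power_mult ennreal_mult')
  finally show ?thesis ..
qed

lemma L1_translation_continuous:
  fixes g :: "'a::euclidean_space \<Rightarrow> complex"
  assumes g: "continuous_on UNIV g" and bound: "\<And>x. norm (g x) \<le> C * weight x" and e: "0 < e"
  obtains d where "0 < d" "\<And>h. norm h < d \<Longrightarrow> (LINT x|lborel. norm (g (x + h) - g x)) < e"
proof -
  define Om where "Om h = (LINT x|lborel. norm (g (x + h) - g x))" for h
  have [measurable]: "g \<in> borel_measurable borel" using g by (auto intro: borel_measurable_continuous_onI)
  have C: "0 \<le> C" using order_trans[OF norm_ge_zero bound[of 0]] weight_pos[of "0::'a"] by (simp add: zero_le_mult_iff)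
  have "isCont Om 0"
    unfolding continuous_at_sequentially o_def
  proof (intro allI impI)
    fix h :: "nat \<Rightarrow> 'a" assume h: "h \<longlonglongrightarrow> 0"
    obtain r where r: "\<And>k. norm (h k) \<le> r"
      using convergent_imp_Bseq[OF convergentI[OF h]] unfolding Bseq_def by blast
    have "(\<lambda>k. LINT x|lborel. norm (g (x + h k) - g x)) \<longlonglongrightarrow> (LINT x|(lborel :: 'a measure). 0)"
    proof (rule integral_dominated_convergence)
      let ?D = "(1 + r) ^ (DIM('a) + 1)"
      show "integrable lborel (\<lambda>x::'a. C * (?D * weight x) + C * weight x)"
        using integrable_weight[where 'a='a] by simp
      show "AE x in lborel. (\<lambda>k. norm (g (x + h k) - g x)) \<longlonglongrightarrow> 0"
      proof (intro AE_I2)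
        fix x
        have "isCont g x" using g by (simp add: continuous_on_eq_continuous_at)
        moreover have "(\<lambda>k. x + h k) \<longlonglongrightarrow> x" using tendsto_add[OF tendsto_const h, of x] by simp
        ultimately have "(\<lambda>k. g (x + h k)) \<longlonglongrightarrow> g x" by (rule isCont_tendsto_compose)
        then show "(\<lambda>k. norm (g (x + h k) - g x)) \<longlonglongrightarrow> 0"
          by (simp add: tendsto_norm_zero_iff LIM_zero_iff)
      qed
      fix k
      have "norm (g (x + h k) - g x) \<le> C * (?D * weight x) + C * weight x" for x
      proof -
        have "weight (x + h k) \<le> ?D * weight x" by (rule weight_shift) (use r in simp)
        then have "norm (g (x + h k)) \<le> C * (?D * weight x)"
          using order_trans[OF bound[of "x + h k"] mult_left_mono[OF _ C]] by blast
        then show ?thesis using norm_triangle_ineq4[of "g (x + h k)" "g x"] bound[of x] by linarith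
      qed
      then show "AE x in lborel. norm (norm (g (x + h k) - g x)) \<le> C * (?D * weight x) + C * weight x"
        by simp
    qed auto
    then show "(\<lambda>k. Om (h k)) \<longlonglongrightarrow> Om 0" by (simp add: Om_def)
  qed
  then obtain d where "d > 0" "\<And>h. dist h 0 < d \<Longrightarrow> dist (Om h) (Om 0) < e"
    using e unfolding continuous_at_eps_delta by blast
  then show thesis
    by (intro that[of d]) (auto simp: Om_def dist_real_def)
qed

locale reproducing_kernels =
  fixes \<phi> \<Phi> \<psi> :: "real^'n::finite \<Rightarrow> complex" and C :: real
  assumes cont: "continuous_on UNIV \<phi>" "continuous_on UNIV \<Phi>" "continuous_on UNIV \<psi>"
    and bound: "\<And>x. norm (\<phi> x) \<le> C * weight x" "\<And>x. norm (\<Phi> x) \<le> C * weight x"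
      "\<And>x. norm (\<psi> x) \<le> C * weight x"
    and C_nonneg: "0 \<le> C"
    and mass: "(LINT x|lborel. \<Phi> x) \<noteq> 0"
    and reproducing: "\<And>j x. dil (Suc j) \<Phi> x - dil j \<Phi> x =
      (LINT y|lborel. dil (Suc j) \<psi> y * dil (Suc j) \<phi> (x - y))"
begin

lemma meas [measurable]: "\<phi> \<in> borel_measurable borel" "\<Phi> \<in> borel_measurable borel" "\<psi> \<in> borel_measurable borel"
  using cont by (auto intro: borel_measurable_continuous_onI)

lemma integrable: "integrable lborel \<phi>" "integrable lborel \<Phi>" "integrable lborel \<psi>"
  using integrable_weight_bound bound meas by blast+

lemma dil_phi_bounded: "norm (dil j \<phi> x) \<le> 2 ^ (j * CARD('n)) * C"
proof -
  have "weight y \<le> 1" for y :: "real^'n" 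
    unfolding weight_def using one_le_power[of "1 + norm y" "DIM(real^'n) + 1"]
    by (subst divide_le_eq_1_pos) (auto simp: add_pos_nonneg)
  then have "norm (\<phi> (2 ^ j *\<^sub>R x)) \<le> C"
    using order_trans[OF bound(1) mult_left_mono[OF _ C_nonneg, of _ 1]] by simp
  then show ?thesis unfolding dil_def by (simp add: norm_mult norm_power)
qed

end

locale mollified_set = reproducing_kernels \<phi> \<Phi> \<psi> C
  for \<phi> \<Phi> \<psi> :: "real^'n::finite \<Rightarrow> complex" and C +
  fixes E :: "(real^'n) set"
  assumes E [measurable]: "E \<in> sets borel" and bounded_E: "bounded E"
begin

text \<open>The mollifications \<open>S J\<close> tend to \<open>c\<close> times the characteristic function of \<open>E\<close>.\<close>

definition c :: complex where "c = (LINT x|lborel. \<Phi> x)"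

abbreviation F where "F j \<equiv> mollify (dil j \<phi>) E"
abbreviation S where "S j \<equiv> mollify (dil j \<Phi>) E"

text \<open>A majorant of the \<open>j\<close>-th term of the reproducing formula that is a nonnegative integral, so that
  Tonelli's theorem applies to it.\<close>

definition u :: "nat \<Rightarrow> real^'n \<Rightarrow> ennreal" where
  "u j x = (\<integral>\<^sup>+y. ennreal (norm (dil j \<psi> (x - y))) * ennreal (norm (F j y)) \<partial>lborel)"

lemma finite_measure_E: "emeasure lborel E < \<infinity>"
  using emeasure_bounded_finite[OF bounded_E] by simp

lemma integrable_E: "integrable lborel (\<lambda>y. indicator E y :: complex)" "integrable lborel (\<lambda>y. indicator E y :: real)"
proof -
  show "integrable lborel (\<lambda>y. indicator E y :: real)" using finite_measure_E by (auto simp: integrable_indicator_iff)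
  then show "integrable lborel (\<lambda>y. indicator E y :: complex)"
    by (rule Bochner_Integration.integrable_bound) (auto simp: indicator_def)
qed

text \<open>This is the reproducing formula convolved with the characteristic function, by associativity of convolution.\<close>

lemma mollify_step: "ennreal (norm (S (Suc j) x - S j x)) \<le> u (Suc j) x"
proof -
  let ?p = "dil (Suc j) \<phi>" and ?q = "dil (Suc j) \<psi>"
  let ?h = "\<lambda>y z. indicator E y * (?q z * ?p (x - y - z))"
  have int: "integrable lborel (dil i \<Phi>)" "integrable lborel ?q" for i by (intro integrable_dil integrable)+
  have "integrable (lborel \<Otimes>\<^sub>M lborel) (\<lambda>(y, z). ?h y z)"
  proof (rule Bochner_Integration.integrable_bound)
    let ?B = "2 ^ (Suc j * CARD('n)) * C"
    show "integrable (lborel \<Otimes>\<^sub>M lborel) (\<lambda>(y, z). indicator E y * ?B * norm (?q z))"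
    proof (rule lborel_pair.Fubini_integrable)
      show "integrable lborel (\<lambda>y. LINT z|lborel. norm (case (y, z) of (y, z) \<Rightarrow> indicator E y * ?B * norm (?q z)))"
        using integrable_E(2) C_nonneg by (simp add: abs_mult)
      show "AE y in lborel. integrable lborel (\<lambda>z. case (y, z) of (y, z) \<Rightarrow> indicator E y * ?B * norm (?q z))"
        using int(2) by simp
    qed measurable
    show "AE yz in lborel \<Otimes>\<^sub>M lborel. norm (case yz of (y, z) \<Rightarrow> ?h y z)
      \<le> norm (case yz of (y, z) \<Rightarrow> indicator E y * ?B * norm (?q z))"
    proof (intro AE_I2, clarify)
      fix y z :: "real^'n"
      have "norm (?p (x - y - z)) * norm (?q z) \<le> ?B * norm (?q z)"
        by (intro mult_right_mono dil_phi_bounded) simp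
      then show "norm (?h y z) \<le> norm (indicator E y * ?B * norm (?q z))"
        using C_nonneg by (simp add: norm_mult indicator_def abs_mult mult_ac)
    qed
    show "(\<lambda>(y, z). ?h y z) \<in> borel_measurable (lborel \<Otimes>\<^sub>M lborel)" by measurable
  qed
  from lborel_pair.Fubini_integral[OF this]
  have fub: "(LINT z|lborel. LINT y|lborel. ?h y z) = (LINT y|lborel. LINT z|lborel. ?h y z)" .
  have "S (Suc j) x - S j x = (LINT y|lborel. indicator E y * (dil (Suc j) \<Phi> (x - y) - dil j \<Phi> (x - y)))"
    unfolding mollify_def right_diff_distrib
    by (rule Bochner_Integration.integral_diff[symmetric]; rule integrable_mollifier; intro int E)
  also have "\<dots> = (LINT y|lborel. LINT z|lborel. ?h y z)"
    unfolding reproducing by simp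
  also have "\<dots> = (LINT z|lborel. ?q z * F (Suc j) (x - z))"
  proof -
    have "?h y z = ?q z * (indicator E y * ?p (x - z - y))" for y z
      unfolding cancel_ab_semigroup_add_class.diff_right_commute[of x y z] by (simp add: mult_ac)
    then show ?thesis
      unfolding fub[symmetric] mollify_def by (simp only: Bochner_Integration.integral_mult_right_zero)
  qed
  finally have "ennreal (norm (S (Suc j) x - S j x)) \<le> (\<integral>\<^sup>+z. norm (?q z * F (Suc j) (x - z)) \<partial>lborel)"
    by (simp add: norm_integral_le_nn_integral)
  also have "\<dots> = (\<integral>\<^sup>+z. ennreal (norm (?q z)) * norm (F (Suc j) (x - z)) \<partial>lborel)"
    by (simp add: norm_mult ennreal_mult')
  also have "\<dots> = u (Suc j) x"
    unfolding u_def
    using nn_integral_lborel_reflection[of "\<lambda>z. ennreal (norm (?q z)) * norm (F (Suc j) (x - z))" x] by simp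
  finally show ?thesis .
qed

end

section \<open>Sets that are well approximated by their mollifications\<close>

lemma emeasure_lborel_vimage_translation:
  fixes B :: "'a::euclidean_space set"
  assumes [measurable]: "B \<in> sets borel"
  shows "emeasure lborel {x. t + x \<in> B} = emeasure lborel B"
proof -
  have "emeasure lborel {x. t + x \<in> B} = (\<integral>\<^sup>+x. indicator {x. t + x \<in> B} x \<partial>lborel)"
    by (rule nn_integral_indicator[symmetric]) simp
  also have "\<dots> = (\<integral>\<^sup>+x. indicator B (t + x) \<partial>lborel)" by (simp add: indicator_def)
  also have "\<dots> = emeasure lborel B" by (subst nn_integral_lborel_translation) auto
  finally show ?thesis .
qed

context mollified_set
begin

lemma mollify_telescope: "ennreal (norm (S (J + k) x - S J x)) \<le> (\<Sum>i<k. u (Suc (J + i)) x)"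
proof (induction k)
  case (Suc k)
  have "ennreal (norm (S (J + Suc k) x - S J x)) \<le>
      ennreal (norm (S (J + k) x - S J x) + norm (S (Suc (J + k)) x - S (J + k) x))"
    using norm_triangle_ineq[of "S (J + k) x - S J x" "S (Suc (J + k)) x - S (J + k) x"]
    by (intro ennreal_leI) simp
  also have "\<dots> = ennreal (norm (S (J + k) x - S J x)) + ennreal (norm (S (Suc (J + k)) x - S (J + k) x))"
    by simp
  also have "\<dots> \<le> (\<Sum>i<k. u (Suc (J + i)) x) + u (Suc (J + k)) x"
    by (intro add_mono Suc mollify_step)
  finally show ?case by simp
qed simp

text \<open>Rescaling \<open>\<Phi>\<close> writes the difference as an average of translation errors
  of \<open>E\<close> over shifts by \<open>2 ^ - L w\<close>, and these errors tend to \<open>0\<close>.\<close>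

lemma mollify_L1_limit:
  "(\<lambda>L. \<integral>\<^sup>+x. ennreal (norm (S L x - c * indicator E x)) \<partial>lborel) \<longlonglongrightarrow> 0"
    (is "?I \<longlonglongrightarrow> 0")
    "(\<integral>\<^sup>+x. ennreal (norm (S L x - c * indicator E x)) \<partial>lborel) < \<infinity>"
proof -
  define om where "om h = (\<integral>\<^sup>+x. ennreal \<bar>indicator E (x - h) - indicator E x\<bar> \<partial>lborel)" for h
  have om_meas [measurable]: "om \<in> borel_measurable borel"
  proof -
    have "(\<lambda>(h, x). ennreal \<bar>indicator E (x - h) - indicator E x\<bar>) \<in> borel_measurable (borel \<Otimes>\<^sub>M lborel)"
      by measurable
    then show ?thesis unfolding om_def[abs_def] by (rule lborel.borel_measurable_nn_integral)
  qed
  have om_le: "om h \<le> 2 * emeasure lborel E" for h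
  proof -
    have "om h \<le> (\<integral>\<^sup>+x. indicator E (- h + x) + indicator E x \<partial>lborel)"
      unfolding om_def by (intro nn_integral_mono) (auto simp: indicator_def)
    also have "\<dots> = (\<integral>\<^sup>+x. indicator E (- h + x) \<partial>lborel) + emeasure lborel E"
      by (subst nn_integral_add) auto
    also have "(\<integral>\<^sup>+x. indicator E (- h + x) \<partial>lborel) = emeasure lborel E"
      by (subst nn_integral_lborel_translation) auto
    finally show ?thesis by (simp add: mult_2)
  qed
  have le: "?I L \<le> (\<integral>\<^sup>+w. ennreal (norm (\<Phi> w)) * om (inverse (2 ^ L) *\<^sub>R w) \<partial>lborel)" for L
  proof -
    let ?a = "inverse (2 ^ L) :: real"
    have pt: "ennreal (norm (S L x - c * indicator E x)) \<le>
        (\<integral>\<^sup>+w. ennreal (norm (\<Phi> w)) * ennreal \<bar>indicator E (x - ?a *\<^sub>R w) - indicator E x\<bar> \<partial>lborel)" for x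
    proof -
      have int: "integrable lborel (\<lambda>w. \<Phi> w * indicator E (x - ?a *\<^sub>R w))"
        by (rule Bochner_Integration.integrable_bound[OF integrable(2)]) (auto simp: indicator_def norm_mult)
      have "S L x = (LINT y|lborel. indicator E (x - y) * dil L \<Phi> y)"
        unfolding mollify_def
        using integral_lborel_reflection(1)[of "\<lambda>y. indicator E y * dil L \<Phi> (x - y)" x] by simp
      also have "\<dots> = (?a ^ CARD('n)) *\<^sub>R (LINT w|lborel. indicator E (x - (0 + ?a *\<^sub>R w)) * dil L \<Phi> (0 + ?a *\<^sub>R w))"
        by (subst lborel_affine_integral(2)[where c="?a" and t=0]) auto
      also have "\<dots> = (LINT w|lborel. (?a ^ CARD('n)) *\<^sub>R (indicator E (x - (0 + ?a *\<^sub>R w)) * dil L \<Phi> (0 + ?a *\<^sub>R w)))"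
        by simp
      also have "\<dots> = (LINT w|lborel. \<Phi> w * indicator E (x - ?a *\<^sub>R w))"
        by (intro Bochner_Integration.integral_cong refl)
           (simp add: dil_def power_mult power_inverse scaleR_conv_of_real[where 'a=complex] field_simps)
      finally have "S L x - c * indicator E x =
          (LINT w|lborel. \<Phi> w * indicator E (x - ?a *\<^sub>R w)) - (LINT w|lborel. \<Phi> w * indicator E x)"
        by (simp add: c_def)
      also have "\<dots> = (LINT w|lborel. \<Phi> w * indicator E (x - ?a *\<^sub>R w) - \<Phi> w * indicator E x)"
        by (rule Bochner_Integration.integral_diff[symmetric, OF int]) (simp add: integrable(2))
      finally have "ennreal (norm (S L x - c * indicator E x)) \<le>
          (\<integral>\<^sup>+w. norm (\<Phi> w * indicator E (x - ?a *\<^sub>R w) - \<Phi> w * indicator E x) \<partial>lborel)"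
        by (simp only: norm_integral_le_nn_integral)
      also have "\<dots> = (\<integral>\<^sup>+w. ennreal (norm (\<Phi> w)) * ennreal \<bar>indicator E (x - ?a *\<^sub>R w) - indicator E x\<bar> \<partial>lborel)"
        by (intro nn_integral_cong) (auto simp: indicator_def)
      finally show ?thesis .
    qed
    have "?I L \<le> (\<integral>\<^sup>+x. \<integral>\<^sup>+w. ennreal (norm (\<Phi> w)) * ennreal \<bar>indicator E (x - ?a *\<^sub>R w) - indicator E x\<bar> \<partial>lborel \<partial>lborel)"
      by (intro nn_integral_mono pt)
    also have "\<dots> = (\<integral>\<^sup>+w. \<integral>\<^sup>+x. ennreal (norm (\<Phi> w)) * ennreal \<bar>indicator E (x - ?a *\<^sub>R w) - indicator E x\<bar> \<partial>lborel \<partial>lborel)"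
      by (rule lborel_pair.Fubini') measurable
    also have "\<dots> = (\<integral>\<^sup>+w. ennreal (norm (\<Phi> w)) * om (?a *\<^sub>R w) \<partial>lborel)"
      unfolding om_def by (intro nn_integral_cong nn_integral_cmult) measurable
    finally show ?thesis .
  qed
  let ?w = "\<lambda>w. ennreal (norm (\<Phi> w)) * (2 * emeasure lborel E)"
  have fin: "(\<integral>\<^sup>+w. ?w w \<partial>lborel) < \<infinity>"
    using integrable(2) finite_measure_E
    by (subst nn_integral_multc) (auto simp: integrable_iff_bounded ennreal_mult_less_top)
  have "(\<lambda>L. \<integral>\<^sup>+w. ennreal (norm (\<Phi> w)) * om (inverse (2 ^ L) *\<^sub>R w) \<partial>lborel) \<longlonglongrightarrow> (\<integral>\<^sup>+w. (0::ennreal) \<partial>(lborel::(real^'n) measure))"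
  proof (rule nn_integral_dominated_convergence[where w="?w"])
    show "AE w in lborel. (\<lambda>L. ennreal (norm (\<Phi> w)) * om (inverse (2 ^ L) *\<^sub>R w)) \<longlonglongrightarrow> 0"
    proof (intro AE_I2)
      fix w :: "real^'n"
      have lim: "(\<lambda>L. om (inverse (2 ^ L) *\<^sub>R w)) \<longlonglongrightarrow> 0"
      proof (rule tendsto_zero_ennreal)
        fix e :: real assume e: "0 < e"
        obtain d where d: "0 < d" "\<And>h. norm h < d \<Longrightarrow> om h \<le> ennreal (e / 2)"
          using borel_symmetric_difference_continuous[OF E bounded_E half_gt_zero[OF e]] unfolding om_def by blast
        have "(\<lambda>L. inverse (2 ^ L) *\<^sub>R w) \<longlonglongrightarrow> 0"
          using tendsto_scaleR[OF LIMSEQ_inverse_realpow_zero[of 2] tendsto_const[of w]] by simp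
        then have "eventually (\<lambda>L. norm (inverse (2 ^ L) *\<^sub>R w) < d) sequentially"
          using d(1) by (auto simp: tendsto_iff dist_norm)
        then show "eventually (\<lambda>L. om (inverse (2 ^ L) *\<^sub>R w) < ennreal e) sequentially"
          by eventually_elim (rule le_less_trans[OF d(2)], use e in \<open>auto simp: ennreal_lessI\<close>)
      qed
      show "(\<lambda>L. ennreal (norm (\<Phi> w)) * om (inverse (2 ^ L) *\<^sub>R w)) \<longlonglongrightarrow> 0"
        using tendsto_mult_ennreal[OF tendsto_const lim, of "ennreal (norm (\<Phi> w))"] by simp
    qed
    show "AE w in lborel. ennreal (norm (\<Phi> w)) * om (inverse (2 ^ L) *\<^sub>R w) \<le> ?w w" for L
      by (intro AE_I2 mult_left_mono om_le) simp
  qed (use fin in measurable)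
  then have lim0: "(\<lambda>L. \<integral>\<^sup>+w. ennreal (norm (\<Phi> w)) * om (inverse (2 ^ L) *\<^sub>R w) \<partial>lborel) \<longlonglongrightarrow> 0"
    by simp
  show "?I \<longlonglongrightarrow> 0"
    by (rule tendsto_sandwich[OF always_eventually always_eventually tendsto_const lim0]) (simp, rule allI, rule le)
  have "?I L \<le> (\<integral>\<^sup>+w. ?w w \<partial>lborel)" for L
    by (rule order_trans[OF le]) (intro nn_integral_mono mult_left_mono om_le, simp)
  then show "?I L < \<infinity>" using fin by (rule le_less_trans)
qed

text \<open>Convergence in the mean only holds pointwise along a subsequence, but the telescoping
  bound is uniform in the final index.\<close>

lemma mollify_remainder:
  "AE x in lborel. ennreal (norm (c * indicator E x - S J x)) \<le> (\<Sum>i. u (Suc (J + i)) x)"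
proof -
  let ?v = "\<lambda>L x. S L x - c * indicator E x"
  have int: "integrable lborel (?v L)" for L
    using mollify_L1_limit(2)[of L] by (auto simp: integrable_iff_bounded)
  have "(\<lambda>L. LINT x|lborel. norm (?v L x)) \<longlonglongrightarrow> 0"
  proof -
    have "(\<lambda>L. ennreal (LINT x|lborel. norm (?v L x))) \<longlonglongrightarrow> ennreal 0"
      using mollify_L1_limit(1) int by (simp add: nn_integral_eq_integral)
    then show ?thesis by (subst (asm) tendsto_ennreal_iff) auto
  qed
  from tendsto_L1_AE_subseq[OF int this]
  obtain r where r: "strict_mono r" "AE x in lborel. (\<lambda>n. ?v (r n) x) \<longlonglongrightarrow> 0" by blast
  from r(2) show ?thesis
  proof eventually_elim
    fix x assume lim: "(\<lambda>n. ?v (r n) x) \<longlonglongrightarrow> 0"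
    have "(\<lambda>n. norm (?v (r n) x - ?v J x)) \<longlonglongrightarrow> norm (0 - ?v J x)"
      by (intro tendsto_intros lim)
    then have "(\<lambda>n. ennreal (norm (?v (r n) x - ?v J x))) \<longlonglongrightarrow> ennreal (norm (0 - ?v J x))"
      by (intro tendsto_ennrealI)
    then have "ennreal (norm (0 - ?v J x)) \<le> (\<Sum>i. u (Suc (J + i)) x)"
    proof (rule tendsto_upperbound)
      show "eventually (\<lambda>n. ennreal (norm (?v (r n) x - ?v J x)) \<le> (\<Sum>i. u (Suc (J + i)) x)) sequentially"
        using eventually_ge_at_top[of J]
      proof eventually_elim
        fix n assume "J \<le> n"
        then have "J \<le> r n" using strict_mono_imp_increasing[OF r(1)] order_trans by blast
        then obtain k where k: "r n = J + k" using le_Suc_ex by blast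
        have "ennreal (norm (?v (r n) x - ?v J x)) \<le> (\<Sum>i<k. u (Suc (J + i)) x)"
          using mollify_telescope[of J k x] k by simp
        also have "\<dots> \<le> (\<Sum>i. u (Suc (J + i)) x)" by (rule sum_le_suminf) auto
        finally show "ennreal (norm (?v (r n) x - ?v J x)) \<le> (\<Sum>i. u (Suc (J + i)) x)" .
      qed
    qed simp
    then show "ennreal (norm (c * indicator E x - S J x)) \<le> (\<Sum>i. u (Suc (J + i)) x)" by simp
  qed
qed

lemma mollify_equicontinuous:
  assumes "0 < e"
  obtains d where "0 < d" "\<And>J x h. 2 ^ J * norm h < d \<Longrightarrow> norm (S J (x + h) - S J x) < e"
proof -
  obtain d where d: "0 < d" "\<And>h. norm h < d \<Longrightarrow> (LINT x|lborel. norm (\<Phi> (x + h) - \<Phi> x)) < e"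
    using L1_translation_continuous[OF cont(2) bound(2) assms] by blast
  have "norm (S J (x + h) - S J x) < e" if h: "2 ^ J * norm h < d" for J x h
  proof -
    let ?k = "2 ^ J *\<^sub>R h"
    let ?g = "\<lambda>z. dil J \<Phi> (z + h) - dil J \<Phi> z"
    have intd: "integrable lborel (dil J \<Phi>)" by (intro integrable_dil integrable)
    have intg: "integrable lborel ?g"
      using integral_lborel_translation(2)[of "dil J \<Phi>" h] intd
      by (auto intro!: Bochner_Integration.integrable_diff simp: add.commute)
    have intE: "integrable lborel (\<lambda>y. indicator E y * ?g (x - y))"
      by (rule integrable_mollifier[OF intg E])
    have "S J (x + h) - S J x = (LINT y|lborel. indicator E y * ?g (x - y))"
      unfolding mollify_def right_diff_distrib
      using Bochner_Integration.integral_diff[OF integrable_mollifier[OF intd E, of "x + h"] integrable_mollifier[OF intd E, of x]]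
      by (simp add: algebra_simps)
    also have "norm \<dots> \<le> (LINT y|lborel. norm (indicator E y * ?g (x - y)))" by (rule integral_norm_bound)
    also have "\<dots> \<le> (LINT y|lborel. norm (?g (x - y)))"
    proof (rule integral_mono)
      show "integrable lborel (\<lambda>y. norm (?g (x - y)))"
        using intg integral_lborel_reflection(2)[of ?g x] by simp
    qed (use intE in \<open>auto simp: indicator_def\<close>)
    also have "\<dots> = (LINT z|lborel. norm (?g z))"
      by (rule integral_lborel_reflection(1)[of "\<lambda>z. norm (?g z)"]) measurable
    also have "\<dots> = (LINT w|lborel. norm (\<Phi> (w + ?k) - \<Phi> w))"
    proof -
      have "(LINT w|lborel. norm (\<Phi> (w + ?k) - \<Phi> w)) =
          (\<bar>2 ^ J\<bar> ^ DIM(real^'n)) *\<^sub>R (LINT z|lborel. norm (\<Phi> ((0 + 2 ^ J *\<^sub>R z) + ?k) - \<Phi> (0 + 2 ^ J *\<^sub>R z)))"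
        by (rule lborel_affine_integral(2)) auto
      also have "\<dots> = (LINT z|lborel. (2 ^ J) ^ CARD('n) * norm (\<Phi> ((0 + 2 ^ J *\<^sub>R z) + ?k) - \<Phi> (0 + 2 ^ J *\<^sub>R z)))"
        by simp
      also have "\<dots> = (LINT z|lborel. norm (?g z))"
        by (intro Bochner_Integration.integral_cong refl)
           (simp add: dil_def norm_mult norm_power power_mult scaleR_add_right flip: right_diff_distrib)
      finally show ?thesis ..
    qed
    also have "\<dots> < e" using h by (intro d(2)) simp
    finally show ?thesis .
  qed
  with d(1) that show thesis by blast
qed

text \<open>Shifting \<open>E\<close> off itself in \<open>N\<close> small steps, some step must change \<open>E\<close> on a set of measure
  at least \<open>1 / N\<close> times that of \<open>E\<close>. But at points where both \<open>E\<close> and the shifted set are well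
  approximated at scale \<open>2 ^ - J\<close>, a step much shorter than this scale changes nothing.\<close>

lemma null_if_well_approximated:
  assumes approx: "\<And>\<eta>. 0 < \<eta> \<Longrightarrow> \<exists>J. emeasure lborel {x. norm c / 4 \<le> norm (c * indicator E x - S J x)} \<le> ennreal (\<eta> / 2 ^ J)"
  shows "emeasure lborel E = 0"
proof -
  have c: "0 < norm c" using mass by (simp add: c_def)
  obtain R where R: "0 < R" "\<And>x. x \<in> E \<Longrightarrow> norm x < R"
    using bounded_E unfolding bounded_pos by (metis add.commute add_strict_increasing zero_less_one less_eq_real_def not_le order.strict_trans2 less_add_one)
  obtain d where d: "0 < d" "\<And>J x h. 2 ^ J * norm h < d \<Longrightarrow> norm (S J (x + h) - S J x) < norm c / 4"
    using mollify_equicontinuous[of "norm c / 4"] c by auto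
  let ?D = "\<lambda>h. {x. (x + h \<in> E) \<noteq> (x \<in> E)}"
  have D_meas [measurable]: "?D h \<in> sets borel" for h by measurable
  have D_steps: "emeasure lborel (?D (real N *\<^sub>R h)) \<le> of_nat N * emeasure lborel (?D h)" for N h
  proof (induction N)
    case (Suc N)
    let ?T = "{x. x + real N *\<^sub>R h \<in> ?D h}"
    have [measurable]: "?T \<in> sets borel" by measurable
    have "?D (real (Suc N) *\<^sub>R h) \<subseteq> ?D (real N *\<^sub>R h) \<union> ?T"
      by (auto simp: algebra_simps)
    then have "emeasure lborel (?D (real (Suc N) *\<^sub>R h)) \<le> emeasure lborel (?D (real N *\<^sub>R h) \<union> ?T)"
      by (intro emeasure_mono) auto
    also have "\<dots> \<le> emeasure lborel (?D (real N *\<^sub>R h)) + emeasure lborel ?T"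
      by (intro emeasure_subadditive) auto
    also have "emeasure lborel ?T = emeasure lborel (?D h)"
      using emeasure_lborel_vimage_translation[of "?D h" "real N *\<^sub>R h"] by (simp add: add.commute)
    also have "emeasure lborel (?D (real N *\<^sub>R h)) + \<dots> \<le> of_nat N * emeasure lborel (?D h) + emeasure lborel (?D h)"
      by (intro add_right_mono Suc)
    finally show ?case by (simp add: algebra_simps)
  qed simp
  define v where "v = (2 * R) *\<^sub>R (axis undefined 1 :: real^'n)"
  have v: "norm v = 2 * R" using R(1) by (simp add: v_def norm_axis_1)
  have E_le: "emeasure lborel E \<le> emeasure lborel (?D v)"
  proof (intro emeasure_mono subsetI)
    fix x assume x: "x \<in> E"
    have "norm (x + v) \<ge> norm v - norm x" using norm_diff_ineq[of v x] by (simp add: add.commute)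
    then have "x + v \<notin> E" using R(2)[of x] R(2)[of "x + v"] x v by auto
    with x show "x \<in> ?D v" by simp
  qed simp
  define A where "A = 2 * R / d + 1"
  have A: "0 < A" using R(1) d(1) by (simp add: A_def add_pos_pos)
  have key: "emeasure lborel E \<le> ennreal (4 * A * \<eta>)" if \<eta>: "0 < \<eta>" for \<eta>
  proof -
    obtain J where J: "emeasure lborel {x. norm c / 4 \<le> norm (c * indicator E x - S J x)} \<le> ennreal (\<eta> / 2 ^ J)"
      using approx[OF \<eta>] by blast
    define B where "B = {x. norm c / 4 \<le> norm (c * indicator E x - S J x)}"
    have [measurable]: "B \<in> sets borel" unfolding B_def by measurable
    \<comment> \<open>With this many steps each one is shorter than \<open>d * 2 ^ - J\<close>.\<close>
    define N where "N = nat \<lceil>2 ^ J * A\<rceil>"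
    have N: "2 ^ J * A \<le> real N" "real N \<le> 2 * (2 ^ J * A)"
    proof -
      have "1 \<le> 2 ^ J * A" using mult_mono[of 1 "2 ^ J" 1 A] R(1) d(1) by (simp add: A_def)
      then show "2 ^ J * A \<le> real N" "real N \<le> 2 * (2 ^ J * A)" unfolding N_def by linarith+
    qed
    have Npos: "0 < N" using N(1) A by (metis mult_pos_pos not_less of_nat_0_less_iff zero_less_numeral zero_less_power order.strict_trans2)
    define h where "h = (1 / real N) *\<^sub>R v"
    have small: "2 ^ J * norm h < d"
    proof -
      have "2 ^ J * (2 * R) < d * (2 ^ J * A)" using d(1) by (simp add: A_def field_simps)
      also have "\<dots> \<le> d * real N" using N(1) d(1) by (intro mult_left_mono) auto
      finally show ?thesis using Npos v R(1) by (simp add: h_def field_simps)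
    qed
    have sub: "?D h \<subseteq> B \<union> {x. x + h \<in> B}"
    proof
      fix x assume x: "x \<in> ?D h"
      show "x \<in> B \<union> {x. x + h \<in> B}"
      proof (rule ccontr)
        assume "\<not> ?thesis"
        then have "norm (c * indicator E x - S J x) < norm c / 4"
          "norm (c * indicator E (x + h) - S J (x + h)) < norm c / 4" by (auto simp: B_def)
        moreover have "norm (S J (x + h) - S J x) < norm c / 4" by (rule d(2)[OF small])
        moreover have "norm c \<le> norm (c * indicator E x - S J x) + norm (c * indicator E (x + h) - S J (x + h))
            + norm (S J (x + h) - S J x)"
        proof -
          let ?i = "c * indicator E x" and ?k = "c * indicator E (x + h)"
          have "norm c = norm (?k - ?i)" using x by (auto simp: indicator_def)
          also have "?k - ?i = (?k - S J (x + h)) - (?i - S J x) + (S J (x + h) - S J x)" by simp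
          also have "norm \<dots> \<le> norm (?k - S J (x + h)) + norm (?i - S J x) + norm (S J (x + h) - S J x)"
            by (intro order_trans[OF norm_triangle_ineq] add_right_mono norm_triangle_ineq4)
          finally show ?thesis by simp
        qed
        ultimately show False using c by linarith
      qed
    qed
    have "emeasure lborel (?D h) \<le> emeasure lborel (B \<union> {x. x + h \<in> B})"
      by (intro emeasure_mono sub) measurable
    also have "\<dots> \<le> emeasure lborel B + emeasure lborel {x. x + h \<in> B}"
      by (intro emeasure_subadditive) auto
    also have "emeasure lborel {x. x + h \<in> B} = emeasure lborel B"
      using emeasure_lborel_vimage_translation[of B h] by (simp add: add.commute)
    also have "emeasure lborel B + emeasure lborel B \<le> ennreal (\<eta> / 2 ^ J) + ennreal (\<eta> / 2 ^ J)"
      using J by (intro add_mono) (simp_all add: B_def)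
    finally have Dh: "emeasure lborel (?D h) \<le> ennreal (2 * (\<eta> / 2 ^ J))"
      using \<eta> by (simp flip: ennreal_plus)
    have "emeasure lborel E \<le> emeasure lborel (?D (real N *\<^sub>R h))"
      using E_le Npos by (simp add: h_def)
    also have "\<dots> \<le> of_nat N * ennreal (2 * (\<eta> / 2 ^ J))"
      by (rule order_trans[OF D_steps]) (intro mult_left_mono Dh, simp)
    also have "\<dots> = ennreal (real N * (2 * (\<eta> / 2 ^ J)))"
      unfolding ennreal_of_nat_eq_real_of_nat
      by (rule ennreal_mult'[symmetric]) (use \<eta> in simp)
    also have "\<dots> \<le> ennreal ((2 * (2 ^ J * A)) * (2 * (\<eta> / 2 ^ J)))"
      using \<eta> N(2) by (intro ennreal_leI mult_right_mono) auto
    also have "(2 * (2 ^ J * A)) * (2 * (\<eta> / 2 ^ J)) = 4 * A * \<eta>" by simp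
    finally show ?thesis .
  qed
  have "emeasure lborel E \<le> ennreal e" if "0 < e" for e
    using key[of "e / (4 * A)"] A that by simp
  then show ?thesis by (metis ennreal_le_epsilon add_0 le_zero_eq)
qed

text \<open>By Markov's inequality, a part \<open>V\<close> of the remainder with small integral only has to be discarded
  on a set of small measure.\<close>

lemma null_if_remainder_small:
  assumes "\<And>\<eta>. 0 < \<eta> \<Longrightarrow> \<exists>J V. V \<in> borel_measurable borel \<and>
    (AE x in lborel. (\<Sum>i. u (Suc (J + i)) x) \<le> ennreal (norm c / 8) + V x) \<and>
    (\<integral>\<^sup>+x. V x \<partial>lborel) \<le> ennreal (\<eta> / 2 ^ J)"
  shows "emeasure lborel E = 0"
proof (rule null_if_well_approximated)
  fix \<eta> :: real assume \<eta>: "0 < \<eta>"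
  have c: "0 < norm c" using mass by (simp add: c_def)
  let ?\<eta> = "\<eta> * (norm c / 8)"
  obtain J V where [measurable]: "V \<in> borel_measurable borel"
    and V: "AE x in lborel. (\<Sum>i. u (Suc (J + i)) x) \<le> ennreal (norm c / 8) + V x"
    and int: "(\<integral>\<^sup>+x. V x \<partial>lborel) \<le> ennreal (?\<eta> / 2 ^ J)"
    using assms[of ?\<eta>] \<eta> c by auto
  let ?k = "ennreal (8 / norm c)"
  have "emeasure lborel {x. norm c / 4 \<le> norm (c * indicator E x - S J x)}
      \<le> emeasure lborel {x\<in>UNIV. 1 \<le> ?k * V x}"
  proof (rule emeasure_mono_AE)
    show "AE x in lborel. x \<in> {x. norm c / 4 \<le> norm (c * indicator E x - S J x)} \<longrightarrow> x \<in> {x\<in>UNIV. 1 \<le> ?k * V x}"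
      using V mollify_remainder[of J]
    proof (eventually_elim, intro impI)
      fix x
      assume a: "(\<Sum>i. u (Suc (J + i)) x) \<le> ennreal (norm c / 8) + V x"
        and b: "ennreal (norm (c * indicator E x - S J x)) \<le> (\<Sum>i. u (Suc (J + i)) x)"
        and "x \<in> {x. norm c / 4 \<le> norm (c * indicator E x - S J x)}"
      then have "ennreal (norm c / 4) \<le> ennreal (norm (c * indicator E x - S J x))" by (intro ennreal_leI) simp
      also note b also note a
      finally have le: "ennreal (norm c / 4) \<le> ennreal (norm c / 8) + V x" .
      have "1 \<le> ?k * V x"
      proof (cases "V x")
        case (real r)
        then have "ennreal (norm c / 4) \<le> ennreal (norm c / 8 + r)" using le by simp
        then have "norm c / 4 \<le> norm c / 8 + r" using real(1) c by (subst (asm) ennreal_le_iff) auto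
        then have "1 \<le> 8 / norm c * r" using c by (simp add: field_simps)
        then show ?thesis using real c by (simp flip: ennreal_mult' ennreal_1)
      qed (use c in \<open>simp add: ennreal_mult_top\<close>)
      then show "x \<in> {x\<in>UNIV. 1 \<le> ?k * V x}" by simp
    qed
  qed measurable
  also have "\<dots> \<le> ?k * (\<integral>\<^sup>+x. V x * indicator UNIV x \<partial>lborel)"
    by (rule nn_integral_Markov_inequality) auto
  also have "\<dots> \<le> ?k * ennreal (?\<eta> / 2 ^ J)"
    using int by (intro mult_left_mono) auto
  also have "\<dots> = ennreal (\<eta> / 2 ^ J)"
    using c \<eta> by (simp flip: ennreal_mult')
  finally show "\<exists>J. emeasure lborel {x. norm c / 4 \<le> norm (c * indicator E x - S J x)} \<le> ennreal (\<eta> / 2 ^ J)"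
    by blast
qed

end

section \<open>Dyadic cubes and criteria for null sets\<close>

definition same_cell :: "nat \<Rightarrow> real^'n::finite \<Rightarrow> real^'n \<Rightarrow> bool" where
  "same_cell j y z \<longleftrightarrow> (\<forall>i. \<lfloor>2 ^ j * y $ i\<rfloor> = \<lfloor>2 ^ j * z $ i\<rfloor>)"

lemma same_cell_measurable [measurable]:
  "Measurable.pred (borel \<Otimes>\<^sub>M borel) (\<lambda>(y, z::real^'n::finite). same_cell j y z)"
proof -
  have [measurable]: "(\<lambda>x::real^'n. x $ i) \<in> borel_measurable borel" for i
    by (intro borel_measurable_continuous_onI continuous_intros)
  have "Measurable.pred (borel \<Otimes>\<^sub>M borel) (\<lambda>yz::(real^'n) \<times> (real^'n).
      real_of_int \<lfloor>2 ^ j * fst yz $ i\<rfloor> = real_of_int \<lfloor>2 ^ j * snd yz $ i\<rfloor>)" for i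
    unfolding pred_def by (rule borel_measurable_eq) measurable
  then have "Measurable.pred (borel \<Otimes>\<^sub>M borel) (\<lambda>yz::(real^'n) \<times> (real^'n).
      \<forall>i\<in>UNIV. real_of_int \<lfloor>2 ^ j * fst yz $ i\<rfloor> = real_of_int \<lfloor>2 ^ j * snd yz $ i\<rfloor>)"
    by (intro pred_intros_finite(3) finite)
  then show ?thesis unfolding same_cell_def case_prod_beta by simp
qed

lemma same_cell_measurable1 [measurable]: "{y. same_cell j y (z::real^'n::finite)} \<in> sets borel"
  using measurable_compose[OF _ same_cell_measurable[where j=j], of "\<lambda>y. (y, z)" borel]
  by (simp add: pred_def)

lemma dyadic_cube_eq:
  "dyadic_cube j k = {y. \<forall>i. \<lfloor>2 powi j * y $ i\<rfloor> = k $ (i::'n::finite)}"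
proof -
  have pos: "0 < (2::real) powi j" by simp
  show ?thesis
  proof (intro set_eqI iffI)
    fix y :: "real^'n" assume "y \<in> dyadic_cube j k"
    then obtain x where x: "y = 2 powi (- j) *\<^sub>R (x + (\<chi> i. of_int (k $ i)))" "\<forall>i. 0 \<le> x $ i \<and> x $ i < 1"
      unfolding dyadic_cube_def by blast
    have "2 powi j * y $ i = x $ i + of_int (k $ i)" for i
      unfolding x(1) using pos by (simp add: power_int_minus)
    then show "y \<in> {y. \<forall>i. \<lfloor>2 powi j * y $ i\<rfloor> = k $ i}"
      using x(2) by (simp add: floor_eq_iff)
  next
    fix y :: "real^'n" assume "y \<in> {y. \<forall>i. \<lfloor>2 powi j * y $ i\<rfloor> = k $ i}"
    then have y: "\<And>i. \<lfloor>2 powi j * y $ i\<rfloor> = k $ i" by simp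
    define x where "x = 2 powi j *\<^sub>R y - (\<chi> i. of_int (k $ i))"
    have "y = 2 powi (- j) *\<^sub>R (x + (\<chi> i. of_int (k $ i)))"
      unfolding x_def using pos by (simp add: power_int_minus)
    moreover have "\<forall>i. 0 \<le> x $ i \<and> x $ i < 1"
      using y by (auto simp: x_def floor_eq_iff algebra_simps)
    ultimately show "y \<in> dyadic_cube j k" unfolding dyadic_cube_def by blast
  qed
qed

lemma dyadic_cube_same_cell:
  "{y. same_cell j y z} = dyadic_cube (int j) (\<chi> i. \<lfloor>2 ^ j * z $ i\<rfloor>)"
  by (simp add: dyadic_cube_eq same_cell_def)

lemma dyadic_cube_borel [measurable]: "dyadic_cube j (k :: int^'n::finite) \<in> sets borel"
proof -
  have [measurable]: "(\<lambda>x::real^'n. x $ i) \<in> borel_measurable borel" for i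
    by (intro borel_measurable_continuous_onI continuous_intros)
  have "Measurable.pred borel (\<lambda>y::real^'n. \<forall>i. real_of_int \<lfloor>2 powi j * y $ i\<rfloor> = real_of_int (k $ i))"
    by measurable
  then show ?thesis unfolding dyadic_cube_eq by (simp add: pred_def)
qed

lemma emeasure_dyadic_cube:
  "emeasure lborel (dyadic_cube j (k :: int^'n::finite)) = ennreal (1 / (2 powi j) ^ CARD('n))"
proof -
  let ?Q = "{x::real^'n. \<forall>i. 0 \<le> x $ i \<and> x $ i < 1}"
  let ?c = "2 powi j :: real"
  have pos: "0 < ?c" by simp
  have Q0: "?Q = dyadic_cube 0 0" by (auto simp: dyadic_cube_eq floor_eq_iff)
  have [measurable]: "?Q \<in> sets borel" unfolding Q0 by measurable
  have unit: "emeasure lborel (box 0 (1::real^'n)) = 1" "emeasure lborel (cbox 0 (1::real^'n)) = 1"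
  proof -
    have "(1::real^'n) \<bullet> b = 1" if "b \<in> Basis" for b
      using that by (auto simp: Basis_vec_def inner_axis)
    then show "emeasure lborel (box 0 (1::real^'n)) = 1" "emeasure lborel (cbox 0 (1::real^'n)) = 1"
      by (simp_all add: emeasure_lborel_box_eq emeasure_lborel_cbox_eq)
  qed
  have Q: "emeasure lborel ?Q = 1"
  proof (rule antisym)
    have "emeasure lborel ?Q \<le> emeasure lborel (cbox 0 (1::real^'n))"
      by (intro emeasure_mono) (auto simp: mem_box_cart less_imp_le)
    then show "emeasure lborel ?Q \<le> 1" unfolding unit .
    have "emeasure lborel (box 0 (1::real^'n)) \<le> emeasure lborel ?Q"
      by (intro emeasure_mono) (auto simp: mem_box_cart less_imp_le)
    then show "1 \<le> emeasure lborel ?Q" unfolding unit .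
  qed
  let ?k = "(\<chi> i. of_int (k $ i)) :: real^'n"
  have "1 = (\<integral>\<^sup>+x. indicator ?Q x \<partial>lborel)" using Q by simp
  also have "\<dots> = ennreal (?c ^ CARD('n)) * (\<integral>\<^sup>+x. indicator ?Q (- ?k + ?c *\<^sub>R x) \<partial>lborel)"
    using pos by (subst nn_integral_lborel_affine[where c="?c" and t="- ?k"]) auto
  also have "(\<lambda>x. indicator ?Q (- ?k + ?c *\<^sub>R x)) = (indicator (dyadic_cube j k) :: real^'n \<Rightarrow> ennreal)"
    unfolding dyadic_cube_eq by (auto simp: indicator_def fun_eq_iff floor_eq_iff algebra_simps)
  finally have eq: "1 = ennreal (?c ^ CARD('n)) * emeasure lborel (dyadic_cube j k)" by simp
  have "ennreal (1 / ?c ^ CARD('n)) * 1 = (ennreal (1 / ?c ^ CARD('n)) * ennreal (?c ^ CARD('n))) * emeasure lborel (dyadic_cube j k)"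
    unfolding mult.assoc eq[symmetric] ..
  also have "ennreal (1 / ?c ^ CARD('n)) * ennreal (?c ^ CARD('n)) = 1"
    using pos by (simp flip: ennreal_mult')
  finally show ?thesis by simp
qed

context mollified_set
begin

lemma null_if_uniform_decay:
  assumes r: "0 < r" "r < 1" and A: "0 \<le> A" and u: "\<And>j x. u (Suc j) x \<le> ennreal (A * r ^ j)"
  shows "emeasure lborel E = 0"
proof (rule null_if_remainder_small)
  fix \<eta> :: real assume "0 < \<eta>"
  have c: "0 < norm c" using mass by (simp add: c_def)
  have "(\<lambda>J. A / (1 - r) * r ^ J) \<longlonglongrightarrow> A / (1 - r) * 0"
    using r by (intro tendsto_mult tendsto_const LIMSEQ_realpow_zero) auto
  then have "eventually (\<lambda>J. A / (1 - r) * r ^ J < norm c / 8) sequentially"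
    by (rule order_tendstoD(2)) (use c in simp)
  then obtain J where J: "A / (1 - r) * r ^ J < norm c / 8" by (auto simp: eventually_sequentially)
  have "(\<Sum>i. u (Suc (J + i)) x) \<le> ennreal (norm c / 8) + 0" for x
  proof -
    have "(\<Sum>i. u (Suc (J + i)) x) \<le> (\<Sum>i. ennreal (A * r ^ J * r ^ i))"
    proof (intro suminf_le summableI)
      fix i
      show "u (Suc (J + i)) x \<le> ennreal (A * r ^ J * r ^ i)"
        using u[of "J + i" x] by (simp add: power_add mult.assoc)
    qed
    also have "\<dots> = ennreal (\<Sum>i. A * r ^ J * r ^ i)"
      using A r by (intro suminf_ennreal2 summable_mult) auto
    also have "(\<Sum>i. A * r ^ J * r ^ i) = A / (1 - r) * r ^ J"
      using r by (subst suminf_mult) (auto simp: suminf_geometric)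
    also have "ennreal \<dots> \<le> ennreal (norm c / 8)" using J by (intro ennreal_leI) simp
    finally show ?thesis by simp
  qed
  then show "\<exists>J V. V \<in> borel_measurable borel \<and>
    (AE x in lborel. (\<Sum>i. u (Suc (J + i)) x) \<le> ennreal (norm c / 8) + V x) \<and>
    (\<integral>\<^sup>+x. V x \<partial>lborel) \<le> ennreal (\<eta> / 2 ^ J)"
    by (intro exI[of _ J] exI[of _ "\<lambda>_. 0"]) auto
qed

text \<open>The parts of \<open>F j\<close> below the threshold \<open>l * r ^ i\<close> contribute a geometric series, which is small
  for small \<open>l\<close>; the parts above go into \<open>V\<close>. The threshold decreases with \<open>i\<close> to make this series
  converge, and slowly enough for the upper parts to stay summable in the application.\<close>

lemma null_if_truncations_small:
  assumes r: "0 < r" "r < 1"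
    and small: "\<And>l \<eta>. 0 < l \<Longrightarrow> 0 < \<eta> \<Longrightarrow> \<exists>J. (\<Sum>i. \<integral>\<^sup>+y. ennreal (norm (F (Suc (J + i)) y)) *
      indicator {y. l * r ^ i < norm (F (Suc (J + i)) y)} y \<partial>lborel) \<le> ennreal (\<eta> / 2 ^ J)"
  shows "emeasure lborel E = 0"
proof (rule null_if_remainder_small)
  fix \<eta> :: real assume \<eta>: "0 < \<eta>"
  have c: "0 < norm c" using mass by (simp add: c_def)
  define I where "I = (LINT x|lborel. norm (\<psi> x))"
  have I: "0 \<le> I" "(\<integral>\<^sup>+x. norm (dil j \<psi> x) \<partial>lborel) = ennreal I" for j
    unfolding nn_integral_norm_dil[OF meas(3)] I_def using integrable(3) by (simp_all add: nn_integral_eq_integral)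
  \<comment> \<open>The factor makes the geometric series below at most \<open>norm c / 8\<close>; \<open>I + 1\<close> avoids dividing by \<open>0\<close>.\<close>
  define l where "l = norm c / 8 * (1 - r) / (I + 1)"
  have l: "0 < l" using c r I(1) by (simp add: l_def)
  obtain J where J: "(\<Sum>i. \<integral>\<^sup>+y. ennreal (norm (F (Suc (J + i)) y)) *
      indicator {y. l * r ^ i < norm (F (Suc (J + i)) y)} y \<partial>lborel) \<le> ennreal (\<eta> / (I + 1) / 2 ^ J)"
    using small[OF l, of "\<eta> / (I + 1)"] \<eta> I(1) by auto
  define G where "G i y = ennreal (norm (F (Suc (J + i)) y)) * indicator {y. l * r ^ i < norm (F (Suc (J + i)) y)} y" for i y
  have [measurable]: "G i \<in> borel_measurable borel" for i unfolding G_def by measurable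
  define W where "W i x = (\<integral>\<^sup>+y. ennreal (norm (dil (Suc (J + i)) \<psi> (x - y))) * G i y \<partial>lborel)" for i x
  have Wm [measurable]: "W i \<in> borel_measurable borel" for i
  proof -
    have "(\<lambda>(x, y). ennreal (norm (dil (Suc (J + i)) \<psi> (x - y))) * G i y) \<in> borel_measurable (borel \<Otimes>\<^sub>M lborel)"
      by measurable
    then show ?thesis unfolding W_def[abs_def] by (rule lborel.borel_measurable_nn_integral)
  qed
  have u_le: "u (Suc (J + i)) x \<le> ennreal (l * I * r ^ i) + W i x" for i x
  proof -
    let ?k = "\<lambda>y. ennreal (norm (dil (Suc (J + i)) \<psi> (x - y)))"
    have "u (Suc (J + i)) x \<le> (\<integral>\<^sup>+y. ?k y * ennreal (l * r ^ i) + ?k y * G i y \<partial>lborel)"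
      unfolding u_def
    proof (intro nn_integral_mono)
      fix y
      have "ennreal (norm (F (Suc (J + i)) y)) \<le> ennreal (l * r ^ i) + G i y"
        by (cases "l * r ^ i < norm (F (Suc (J + i)) y)") (auto simp: G_def ennreal_leI)
      then have "?k y * ennreal (norm (F (Suc (J + i)) y)) \<le> ?k y * (ennreal (l * r ^ i) + G i y)"
        by (intro mult_left_mono) auto
      then show "?k y * ennreal (norm (F (Suc (J + i)) y)) \<le> ?k y * ennreal (l * r ^ i) + ?k y * G i y"
        by (simp add: distrib_left)
    qed
    also have "\<dots> = (\<integral>\<^sup>+y. ?k y * ennreal (l * r ^ i) \<partial>lborel) + W i x"
      unfolding W_def by (rule nn_integral_add) measurable
    also have "(\<integral>\<^sup>+y. ?k y * ennreal (l * r ^ i) \<partial>lborel) = (\<integral>\<^sup>+y. ?k y \<partial>lborel) * ennreal (l * r ^ i)"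
      by (rule nn_integral_multc) measurable
    also have "(\<integral>\<^sup>+y. ?k y \<partial>lborel) = ennreal I"
      unfolding I(2)[of "Suc (J + i)", symmetric] by (rule nn_integral_lborel_reflection) measurable
    also have "ennreal I * ennreal (l * r ^ i) = ennreal (l * I * r ^ i)"
      using I(1) by (simp add: mult_ac flip: ennreal_mult')
    finally show ?thesis .
  qed
  let ?V = "\<lambda>x. \<Sum>i. W i x"
  have "(\<Sum>i. u (Suc (J + i)) x) \<le> ennreal (norm c / 8) + ?V x" for x
  proof -
    have "(\<Sum>i. u (Suc (J + i)) x) \<le> (\<Sum>i. ennreal (l * I * r ^ i) + W i x)"
      by (intro suminf_le summableI u_le)
    also have "\<dots> = (\<Sum>i. ennreal (l * I * r ^ i)) + ?V x"
      by (intro suminf_add[symmetric] summableI)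
    also have "(\<Sum>i. ennreal (l * I * r ^ i)) = ennreal (\<Sum>i. l * I * r ^ i)"
      using l I(1) r by (intro suminf_ennreal2 summable_mult) auto
    also have "(\<Sum>i. l * I * r ^ i) = l * I / (1 - r)"
      using r by (subst suminf_mult) (auto simp: suminf_geometric)
    also have "l * I / (1 - r) = norm c / 8 * (I / (I + 1))" using r I(1) by (simp add: l_def)
    also have "\<dots> \<le> norm c / 8" using I(1) by (intro mult_left_le) auto
    finally show ?thesis by (simp add: ennreal_leI add_right_mono)
  qed
  moreover have "(\<integral>\<^sup>+x. ?V x \<partial>lborel) \<le> ennreal (\<eta> / 2 ^ J)"
  proof -
    have Wi: "(\<integral>\<^sup>+x. W i x \<partial>lborel) = ennreal I * (\<integral>\<^sup>+y. G i y \<partial>lborel)" for i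
    proof -
      have "(\<integral>\<^sup>+x. W i x \<partial>lborel) =
          (\<integral>\<^sup>+y. \<integral>\<^sup>+x. ennreal (norm (dil (Suc (J + i)) \<psi> (x - y))) * G i y \<partial>lborel \<partial>lborel)"
        unfolding W_def by (rule lborel_pair.Fubini'[symmetric]) measurable
      also have "\<dots> = (\<integral>\<^sup>+y. ennreal I * G i y \<partial>lborel)"
      proof (intro nn_integral_cong)
        fix y
        have "(\<integral>\<^sup>+x. ennreal (norm (dil (Suc (J + i)) \<psi> (x - y))) \<partial>lborel) = ennreal I"
          unfolding I(2)[of "Suc (J + i)", symmetric]
          using nn_integral_lborel_translation[of "\<lambda>x. ennreal (norm (dil (Suc (J + i)) \<psi> x))" "- y"] by simp
        then show "(\<integral>\<^sup>+x. ennreal (norm (dil (Suc (J + i)) \<psi> (x - y))) * G i y \<partial>lborel) = ennreal I * G i y"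
          by (subst nn_integral_multc) auto
      qed
      finally show ?thesis by (simp add: nn_integral_cmult)
    qed
    have "(\<integral>\<^sup>+x. ?V x \<partial>lborel) = (\<Sum>i. \<integral>\<^sup>+x. W i x \<partial>lborel)"
      by (rule nn_integral_suminf) measurable
    also have "\<dots> = ennreal I * (\<Sum>i. \<integral>\<^sup>+y. G i y \<partial>lborel)"
      unfolding Wi by (rule ennreal_suminf_cmult)
    also have "\<dots> \<le> ennreal I * ennreal (\<eta> / (I + 1) / 2 ^ J)"
      using J unfolding G_def by (intro mult_left_mono) auto
    also have "\<dots> = ennreal (I * (\<eta> / (I + 1) / 2 ^ J))"
      by (rule ennreal_mult'[symmetric]) (use I(1) in simp)
    also have "\<dots> \<le> ennreal (\<eta> / 2 ^ J)"
    proof (rule ennreal_leI)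
      have "I * (\<eta> / (I + 1) / 2 ^ J) = (\<eta> / 2 ^ J) * (I / (I + 1))" by (simp add: mult_ac)
      also have "\<dots> \<le> \<eta> / 2 ^ J" using I(1) \<eta> by (intro mult_left_le) auto
      finally show "I * (\<eta> / (I + 1) / 2 ^ J) \<le> \<eta> / 2 ^ J" .
    qed
    finally show ?thesis .
  qed
  ultimately show "\<exists>J V. V \<in> borel_measurable borel \<and>
    (AE x in lborel. (\<Sum>i. u (Suc (J + i)) x) \<le> ennreal (norm c / 8) + V x) \<and>
    (\<integral>\<^sup>+x. V x \<partial>lborel) \<le> ennreal (\<eta> / 2 ^ J)"
    by (intro exI[of _ J] exI[of _ ?V]) auto
qed

text \<open>On a cell of the grid of scale \<open>2 ^ - j\<close> the weight at that scale is essentially constant,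
  so the kernel may be averaged over the cell before it is integrated against \<open>F j\<close>.\<close>

lemma u_le_cell_averages:
  assumes A: "0 \<le> A"
    and avg: "\<And>z. (\<integral>\<^sup>+y. ennreal (norm (F j y)) * indicator {y. same_cell j y z} y \<partial>lborel) \<le> ennreal (A / 2 ^ (j * CARD('n)))"
  shows "u j x \<le> ennreal (C * (1 + real CARD('n)) ^ (CARD('n) + 1) * (LINT w|lborel. weight (w::real^'n)) * A)"
proof -
  let ?N = "CARD('n)"
  define V :: real where "V = 2 ^ (j * ?N)"
  have V: "0 < V" by (simp add: V_def)
  define D where "D = C * (1 + real ?N) ^ (?N + 1)"
  have D: "0 \<le> D" using C_nonneg by (simp add: D_def)
  define I where "I = (LINT w|lborel. weight (w::real^'n))"
  let ?w = "\<lambda>z. V * weight (2 ^ j *\<^sub>R (x - z))"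
  have cell: "emeasure lborel {z. same_cell j z y} = ennreal (1 / V)" for y :: "real^'n"
    unfolding dyadic_cube_same_cell emeasure_dyadic_cube V_def by (simp add: power_mult)
  have sym: "same_cell j y z = same_cell j z y" for y z :: "real^'n" by (auto simp: same_cell_def)
  have kernel: "ennreal (norm (dil j \<psi> (x - y))) \<le>
      (\<integral>\<^sup>+z. ennreal (V * (D * ?w z)) * indicator {z. same_cell j z y} z \<partial>lborel)" for y
  proof -
    have "ennreal (norm (dil j \<psi> (x - y))) = ennreal (norm (dil j \<psi> (x - y)) * V) * ennreal (1 / V)"
      using V by (subst ennreal_mult[symmetric]) auto
    also have "\<dots> = (\<integral>\<^sup>+z. ennreal (norm (dil j \<psi> (x - y)) * V) * indicator {z. same_cell j z y} z \<partial>lborel)"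
      by (subst nn_integral_cmult_indicator) (simp_all add: cell)
    also have "\<dots> \<le> (\<integral>\<^sup>+z. ennreal (V * (D * ?w z)) * indicator {z. same_cell j z y} z \<partial>lborel)"
    proof (intro nn_integral_mono)
      fix z
      have "norm (dil j \<psi> (x - y)) * V \<le> V * (D * ?w z)" if zy: "same_cell j z y"
      proof -
        have coord: "\<bar>(2 ^ j *\<^sub>R (z - y)) $ i\<bar> \<le> 1" for i
        proof -
          have "\<lfloor>2 ^ j * z $ i\<rfloor> = \<lfloor>2 ^ j * y $ i\<rfloor>" using zy by (simp add: same_cell_def)
          then have "\<bar>2 ^ j * z $ i - 2 ^ j * y $ i\<bar> \<le> 1" by linarith
          then show ?thesis by (simp add: right_diff_distrib)
        qed
        have "norm (2 ^ j *\<^sub>R (z - y)) \<le> (\<Sum>i\<in>UNIV. \<bar>(2 ^ j *\<^sub>R (z - y)) $ i\<bar>)" by (rule norm_le_l1_cart)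
        also have "\<dots> \<le> (\<Sum>i\<in>(UNIV::'n set). 1)" by (intro sum_mono coord)
        finally have "norm (2 ^ j *\<^sub>R (x - y) - 2 ^ j *\<^sub>R (x - z)) \<le> real ?N"
          by (simp add: algebra_simps)
        from weight_shift[OF this]
        have "C * weight (2 ^ j *\<^sub>R (x - y)) \<le> C * ((1 + real ?N) ^ (?N + 1) * weight (2 ^ j *\<^sub>R (x - z)))"
          using C_nonneg by (intro mult_left_mono) auto
        then have "norm (\<psi> (2 ^ j *\<^sub>R (x - y))) \<le> D * weight (2 ^ j *\<^sub>R (x - z))"
          using order_trans[OF bound(3)[of "2 ^ j *\<^sub>R (x - y)"]] by (simp add: D_def mult.assoc)
        then have "V * norm (\<psi> (2 ^ j *\<^sub>R (x - y))) * V \<le> V * (D * weight (2 ^ j *\<^sub>R (x - z))) * V"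
          using V by (intro mult_right_mono mult_left_mono) auto
        moreover have "norm (dil j \<psi> (x - y)) = V * norm (\<psi> (2 ^ j *\<^sub>R (x - y)))"
          by (simp add: dil_def V_def norm_mult norm_power)
        ultimately show ?thesis by (simp add: mult_ac)
      qed
      then show "ennreal (norm (dil j \<psi> (x - y)) * V) * indicator {z. same_cell j z y} z
          \<le> ennreal (V * (D * ?w z)) * indicator {z. same_cell j z y} z"
        by (cases "same_cell j z y") (auto simp: ennreal_leI)
    qed
    finally show ?thesis .
  qed
  have "u j x \<le> (\<integral>\<^sup>+y. \<integral>\<^sup>+z. ennreal (V * (D * ?w z)) * (ennreal (norm (F j y)) * indicator {y. same_cell j y z} y) \<partial>lborel \<partial>lborel)"
    unfolding u_def
  proof (intro nn_integral_mono)
    fix y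
    have "ennreal (norm (dil j \<psi> (x - y))) * ennreal (norm (F j y)) \<le>
        (\<integral>\<^sup>+z. ennreal (V * (D * ?w z)) * indicator {z. same_cell j z y} z \<partial>lborel) * ennreal (norm (F j y))"
      by (intro mult_right_mono kernel) simp
    also have "\<dots> = (\<integral>\<^sup>+z. ennreal (V * (D * ?w z)) * indicator {z. same_cell j z y} z * ennreal (norm (F j y)) \<partial>lborel)"
      by (rule nn_integral_multc[symmetric]) measurable
    also have "\<dots> = (\<integral>\<^sup>+z. ennreal (V * (D * ?w z)) * (ennreal (norm (F j y)) * indicator {y. same_cell j y z} y) \<partial>lborel)"
      by (intro nn_integral_cong) (simp add: indicator_def sym[of y] mult_ac)
    finally show "ennreal (norm (dil j \<psi> (x - y))) * ennreal (norm (F j y)) \<le>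
       (\<integral>\<^sup>+z. ennreal (V * (D * ?w z)) * (ennreal (norm (F j y)) * indicator {y. same_cell j y z} y) \<partial>lborel)" .
  qed
  also have "\<dots> = (\<integral>\<^sup>+z. \<integral>\<^sup>+y. ennreal (V * (D * ?w z)) * (ennreal (norm (F j y)) * indicator {y. same_cell j y z} y) \<partial>lborel \<partial>lborel)"
    by (rule lborel_pair.Fubini'[symmetric]) measurable
  also have "\<dots> \<le> (\<integral>\<^sup>+z. ennreal (D * A) * ennreal (?w z) \<partial>lborel)"
  proof (intro nn_integral_mono)
    fix z
    have "(\<integral>\<^sup>+y. ennreal (V * (D * ?w z)) * (ennreal (norm (F j y)) * indicator {y. same_cell j y z} y) \<partial>lborel)
      = ennreal (V * (D * ?w z)) * (\<integral>\<^sup>+y. ennreal (norm (F j y)) * indicator {y. same_cell j y z} y \<partial>lborel)"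
      by (rule nn_integral_cmult) measurable
    also have "\<dots> \<le> ennreal (V * (D * ?w z)) * ennreal (A / V)"
      using avg[of z] by (intro mult_left_mono) (auto simp: V_def)
    also have "\<dots> = ennreal (V * (D * ?w z) * (A / V))"
      by (rule ennreal_mult'[symmetric]) (use V D in simp)
    also have "V * (D * ?w z) * (A / V) = (D * A) * ?w z" using V by simp
    also have "ennreal \<dots> = ennreal (D * A) * ennreal (?w z)"
      by (rule ennreal_mult') (use A D in simp)
    finally show "(\<integral>\<^sup>+y. ennreal (V * (D * ?w z)) * (ennreal (norm (F j y)) * indicator {y. same_cell j y z} y) \<partial>lborel)
      \<le> ennreal (D * A) * ennreal (?w z)" .
  qed
  also have "\<dots> = ennreal (D * A) * (\<integral>\<^sup>+z. ennreal (?w z) \<partial>lborel)"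
    by (rule nn_integral_cmult) measurable
  also have "(\<integral>\<^sup>+z. ennreal (?w z) \<partial>lborel) = ennreal I"
  proof -
    have "(\<integral>\<^sup>+z. ennreal (?w z) \<partial>lborel) = (\<integral>\<^sup>+z. ennreal (V * weight (2 ^ j *\<^sub>R z :: real^'n)) \<partial>lborel)"
      using nn_integral_lborel_reflection[of "\<lambda>z::real^'n. ennreal (V * weight (2 ^ j *\<^sub>R z))" x] by simp
    also have "\<dots> = ennreal V * (\<integral>\<^sup>+z. ennreal (weight (0 + 2 ^ j *\<^sub>R z :: real^'n)) \<partial>lborel)"
      using V by (simp add: ennreal_mult' nn_integral_cmult)
    also have "\<dots> = (\<integral>\<^sup>+z. ennreal (weight (z::real^'n)) \<partial>lborel)"
      by (subst nn_integral_lborel_affine[where c="2 ^ j" and t=0]) (simp_all add: V_def power_mult)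
    also have "\<dots> = ennreal I"
      unfolding I_def using integrable_weight[where 'a="real^'n"] by (simp add: nn_integral_eq_integral)
    finally show ?thesis .
  qed
  also have "ennreal (D * A) * ennreal I = ennreal (D * A * I)"
    by (rule ennreal_mult'[symmetric]) (use A D in simp)
  finally show ?thesis by (simp add: D_def I_def mult_ac)
qed

lemma null_if_cell_averages_decay:
  assumes r: "0 < r" "r < 1" and A: "0 \<le> A"
    and avg: "\<And>j z. (\<integral>\<^sup>+y. ennreal (norm (F (Suc j) y)) * indicator {y. same_cell (Suc j) y z} y \<partial>lborel)
      \<le> ennreal (A * r ^ j / 2 ^ (Suc j * CARD('n)))"
  shows "emeasure lborel E = 0"
proof (rule null_if_uniform_decay[OF r])
  let ?B = "C * (1 + real CARD('n)) ^ (CARD('n) + 1) * (LINT w|lborel. weight (w::real^'n))"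
  show "0 \<le> ?B * A" using C_nonneg A by simp
  show "u (Suc j) x \<le> ennreal (?B * A * r ^ j)" for j x
    using u_le_cell_averages[of "A * r ^ j" "Suc j" x] avg[of j] A r by (simp add: mult.assoc)
qed

end

context mollified_set
begin

text \<open>At distance at least \<open>1\<close> from \<open>E\<close> only the part of \<open>\<phi>\<close> outside of a ball of radius \<open>2 ^ j\<close>
  contributes, and two moments of \<open>\<phi>\<close> give the factor \<open>4 ^ - j\<close>. It beats \<open>2 ^ - j\<close>, so what happens far
  from \<open>E\<close> is negligible.\<close>

lemma mollify_far:
  assumes rapid: "rapid \<phi>" and D [measurable]: "D \<in> sets borel"
    and far: "\<And>x y. x \<notin> D \<Longrightarrow> y \<in> E \<Longrightarrow> 1 \<le> norm (x - y)"
  obtains B where "0 \<le> B"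
    "\<And>j. (\<integral>\<^sup>+x. ennreal (norm (F j x)) * indicator (- D) x \<partial>lborel) \<le> ennreal (B / 4 ^ j)"
proof -
  let ?g = "\<lambda>w. (norm w)\<^sup>2 *\<^sub>R \<phi> w"
  have gint: "integrable lborel ?g" using rapid unfolding rapid_def by blast
  define I where "I = (LINT w|lborel. norm (?g w))"
  define mE where "mE = measure lborel E"
  have mE: "emeasure lborel E = ennreal mE" unfolding mE_def using finite_measure_E
    by (intro emeasure_eq_ennreal_measure) simp
  have I: "0 \<le> I" "(\<integral>\<^sup>+w. norm (?g w) \<partial>lborel) = ennreal I"
    unfolding I_def using gint by (simp_all add: nn_integral_eq_integral del: norm_scaleR)
  have main: "(\<integral>\<^sup>+x. ennreal (norm (F j x)) * indicator (- D) x \<partial>lborel) \<le> ennreal (mE * I / 4 ^ j)" for j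
  proof -
    let ?k = "\<lambda>z. ennreal ((norm z)\<^sup>2 * norm (dil j \<phi> z))"
    have kint: "(\<integral>\<^sup>+z. ?k z \<partial>lborel) = ennreal (I / 4 ^ j)"
    proof -
      have "(norm z)\<^sup>2 * norm (dil j \<phi> z) = 1 / 4 ^ j * norm (dil j ?g z)" for z :: "real^'n"
      proof -
        have "(4::real) ^ j = 2 ^ j * 2 ^ j" by (simp flip: power_mult_distrib)
        then show ?thesis by (simp add: dil_def norm_mult norm_power power2_eq_square)
      qed
      then have "(\<integral>\<^sup>+z. ?k z \<partial>lborel) = (\<integral>\<^sup>+z. ennreal (1 / 4 ^ j) * ennreal (norm (dil j ?g z)) \<partial>lborel)"
        by (simp add: ennreal_mult'[symmetric] del: norm_scaleR)
      also have "\<dots> = ennreal (1 / 4 ^ j) * (\<integral>\<^sup>+z. ennreal (norm (dil j ?g z)) \<partial>lborel)"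
        by (rule nn_integral_cmult) measurable
      also have "\<dots> = ennreal (1 / 4 ^ j) * ennreal I"
        by (subst nn_integral_norm_dil) (simp_all only: I(2), measurable)
      finally show ?thesis by (simp add: ennreal_mult'[symmetric])
    qed
    have "(\<integral>\<^sup>+x. ennreal (norm (F j x)) * indicator (- D) x \<partial>lborel)
        \<le> (\<integral>\<^sup>+x. \<integral>\<^sup>+y. indicator E y * ?k (x - y) \<partial>lborel \<partial>lborel)"
    proof (intro nn_integral_mono)
      fix x
      show "ennreal (norm (F j x)) * indicator (- D) x \<le> (\<integral>\<^sup>+y. indicator E y * ?k (x - y) \<partial>lborel)"
      proof (cases "x \<in> D")
        case False
        have "ennreal (norm (F j x)) \<le> (\<integral>\<^sup>+y. norm (indicator E y * dil j \<phi> (x - y)) \<partial>lborel)"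
          unfolding mollify_def by (rule norm_integral_le_nn_integral)
        also have "\<dots> \<le> (\<integral>\<^sup>+y. indicator E y * ?k (x - y) \<partial>lborel)"
        proof (intro nn_integral_mono)
          fix y
          show "ennreal (norm (indicator E y * dil j \<phi> (x - y))) \<le> indicator E y * ?k (x - y)"
          proof (cases "y \<in> E")
            case True
            have "1 * norm (dil j \<phi> (x - y)) \<le> (norm (x - y))\<^sup>2 * norm (dil j \<phi> (x - y))"
              using far[OF False True] by (intro mult_right_mono one_le_power) auto
            then show ?thesis using True by (simp add: ennreal_leI)
          qed simp
        qed
        finally show ?thesis using False by simp
      qed simp
    qed
    also have "\<dots> = (\<integral>\<^sup>+y. \<integral>\<^sup>+x. indicator E y * ?k (x - y) \<partial>lborel \<partial>lborel)"
      by (rule lborel_pair.Fubini'[symmetric]) measurable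
    also have "\<dots> = (\<integral>\<^sup>+y. indicator E y * ennreal (I / 4 ^ j) \<partial>lborel)"
    proof (intro nn_integral_cong)
      fix y
      have "(\<integral>\<^sup>+x. ?k (x - y) \<partial>lborel) = ennreal (I / 4 ^ j)"
        using nn_integral_lborel_translation[of ?k "- y"] kint by simp
      then show "(\<integral>\<^sup>+x. indicator E y * ?k (x - y) \<partial>lborel) = indicator E y * ennreal (I / 4 ^ j)"
        by (subst nn_integral_cmult) simp_all
    qed
    also have "\<dots> = ennreal mE * ennreal (I / 4 ^ j)"
      by (subst nn_integral_multc) (simp_all add: mE)
    also have "\<dots> = ennreal (mE * I / 4 ^ j)"
      by (simp add: ennreal_mult'[symmetric] mE_def)
    finally show ?thesis .
  qed
  show thesis by (rule that[of "mE * I", OF _ main]) (use I in \<open>simp add: mE_def\<close>)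
qed

text \<open>Above the height \<open>b\<close>, a function is at most \<open>b powr (1 - p)\<close> times its \<open>p\<close>-th power. For
  \<open>b = l * r ^ i\<close> with \<open>r = 2 powr (- 1 / (2 * p))\<close> this factor grows at most like \<open>2 powr (i / 2)\<close>,
  while the hypothesis decays like \<open>2 ^ - i\<close>; the product is summable.\<close>

lemma null_if_Lp_truncations_small:
  assumes rapid: "rapid \<phi>" and p: "1 \<le> p" and D [measurable]: "D \<in> sets borel"
    and far: "\<And>x y. x \<notin> D \<Longrightarrow> y \<in> E \<Longrightarrow> 1 \<le> norm (x - y)"
    and hyp: "\<And>l \<sigma>. 0 < l \<Longrightarrow> 0 < \<sigma> \<Longrightarrow> \<exists>J0. \<forall>J\<ge>J0. \<forall>i.
      (\<integral>\<^sup>+y. ennreal (norm (F (Suc (J + i)) y) powr p) *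
        indicator (D \<inter> {y. l * (2 powr (- 1 / (2 * p))) ^ i < norm (F (Suc (J + i)) y)}) y \<partial>lborel)
      \<le> ennreal (\<sigma> / 2 ^ Suc (J + i))"
  shows "emeasure lborel E = 0"
proof -
  define r where "r = 2 powr (- 1 / (2 * p))"
  have r: "0 < r" "r < 1" using p powr_less_mono[of "- 1 / (2 * p)" 0 2] by (auto simp: r_def)
  define \<rho> where "\<rho> = 2 powr (- 1 / 2 :: real)"
  have \<rho>: "0 < \<rho>" "\<rho> < 1" using powr_less_mono[of "- 1 / 2" 0 "2::real"] by (auto simp: \<rho>_def)
  obtain B where B: "0 \<le> B"
    "\<And>j. (\<integral>\<^sup>+x. ennreal (norm (F j x)) * indicator (- D) x \<partial>lborel) \<le> ennreal (B / 4 ^ j)"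
    by (rule mollify_far[OF rapid D far]) (assumption | rule that)+
  show ?thesis
  proof (rule null_if_truncations_small[OF r])
    fix l \<eta> :: real assume l: "0 < l" and \<eta>: "0 < \<eta>"
    define K where "K = l powr (1 - p)"
    have K: "0 < K" using l by (simp add: K_def)
    define \<sigma> where "\<sigma> = \<eta> * (1 - \<rho>) / (2 * K)"
    have \<sigma>: "0 < \<sigma>" using \<eta> K \<rho> by (simp add: \<sigma>_def)
    obtain J0 where J0: "\<And>J i. J \<ge> J0 \<Longrightarrow>
      (\<integral>\<^sup>+y. ennreal (norm (F (Suc (J + i)) y) powr p) *
        indicator (D \<inter> {y. l * r ^ i < norm (F (Suc (J + i)) y)}) y \<partial>lborel)
      \<le> ennreal (\<sigma> / 2 ^ Suc (J + i))"
      using hyp[OF l \<sigma>] unfolding r_def by blast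
    obtain J1 where J1: "2 * B / \<eta> \<le> 2 ^ J1"
      using real_arch_pow[of 2 "2 * B / \<eta>"] by (auto intro: less_imp_le)
    define J where "J = max J0 J1"
    have J: "J0 \<le> J" "2 * B / \<eta> \<le> 2 ^ J"
    proof -
      have "(2::real) ^ J1 \<le> 2 ^ J" by (rule power_increasing) (simp_all add: J_def)
      then show "2 * B / \<eta> \<le> 2 ^ J" using J1 by linarith
    qed (simp add: J_def)
    have term_le: "(\<integral>\<^sup>+y. ennreal (norm (F (Suc (J + i)) y)) *
        indicator {y. l * r ^ i < norm (F (Suc (J + i)) y)} y \<partial>lborel)
        \<le> ennreal (K * \<sigma> / 2 ^ J * \<rho> ^ i + B / 4 ^ J * (1/2) ^ Suc i)" for i
    proof -
      let ?f = "\<lambda>y. norm (F (Suc (J + i)) y)"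
      let ?b = "l * r ^ i"
      have b: "0 < ?b" using l r by simp
      have K_le: "?b powr (1 - p) \<le> K * 2 powr (real i / 2)"
      proof -
        have "?b powr (1 - p) = K * (r ^ i) powr (1 - p)"
          using l r by (simp add: powr_mult K_def)
        also have "(r ^ i) powr (1 - p) = 2 powr (- 1 / (2 * p) * real i * (1 - p))"
          unfolding r_def by (simp add: powr_powr flip: powr_realpow)
        also have "\<dots> \<le> 2 powr (real i / 2)"
        proof (rule powr_mono)
          have "- 1 / (2 * p) * real i * (1 - p) = real i / 2 * ((p - 1) / p)"
            using p by (simp add: field_simps)
          also have "\<dots> \<le> real i / 2" using p by (intro mult_left_le) auto
          finally show "- 1 / (2 * p) * real i * (1 - p) \<le> real i / 2" .
        qed simp
        finally show ?thesis using K by simp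
      qed
      have pt: "ennreal (?f y) * indicator {y. ?b < ?f y} y \<le>
          ennreal (?b powr (1 - p)) * (ennreal (?f y powr p) * indicator (D \<inter> {y. ?b < ?f y}) y)
          + ennreal (?f y) * indicator (- D) y" for y
      proof (cases "?b < ?f y \<and> y \<in> D")
        case True
        have "?f y = ?f y powr (1 - p) * ?f y powr p"
          using True b by (simp flip: powr_add)
        also have "\<dots> \<le> ?b powr (1 - p) * ?f y powr p"
          using True b p by (intro mult_right_mono powr_mono2') auto
        finally show ?thesis using True by (simp add: ennreal_leI ennreal_mult'[symmetric])
      qed (auto simp: indicator_def)
      have "(\<integral>\<^sup>+y. ennreal (?f y) * indicator {y. ?b < ?f y} y \<partial>lborel) \<le>
          (\<integral>\<^sup>+y. ennreal (?b powr (1 - p)) * (ennreal (?f y powr p) * indicator (D \<inter> {y. ?b < ?f y}) y)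
          + ennreal (?f y) * indicator (- D) y \<partial>lborel)"
        by (intro nn_integral_mono pt)
      also have "\<dots> = ennreal (?b powr (1 - p)) * (\<integral>\<^sup>+y. ennreal (?f y powr p) * indicator (D \<inter> {y. ?b < ?f y}) y \<partial>lborel)
          + (\<integral>\<^sup>+y. ennreal (?f y) * indicator (- D) y \<partial>lborel)"
        by (subst nn_integral_add, measurable) (subst nn_integral_cmult, measurable)
      also have "\<dots> \<le> ennreal (?b powr (1 - p)) * ennreal (\<sigma> / 2 ^ Suc (J + i)) + ennreal (B / 4 ^ Suc (J + i))"
        by (intro add_mono mult_left_mono J0 J B) simp
      also have "\<dots> = ennreal (?b powr (1 - p) * (\<sigma> / 2 ^ Suc (J + i)) + B / 4 ^ Suc (J + i))"
      proof -
        have "ennreal (?b powr (1 - p)) * ennreal (\<sigma> / 2 ^ Suc (J + i)) = ennreal (?b powr (1 - p) * (\<sigma> / 2 ^ Suc (J + i)))"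
          by (rule ennreal_mult'[symmetric]) simp
        moreover have "0 \<le> ?b powr (1 - p) * (\<sigma> / 2 ^ Suc (J + i))" "0 \<le> B / 4 ^ Suc (J + i)"
          using \<sigma> B(1) by simp_all
        ultimately show ?thesis by (simp only: ennreal_plus)
      qed
      also have "\<dots> \<le> ennreal (K * \<sigma> / 2 ^ J * \<rho> ^ i + B / 4 ^ J * (1/2) ^ Suc i)"
      proof (intro ennreal_leI add_mono)
        have \<rho>i: "\<rho> ^ i = 2 powr (real i / 2) / 2 ^ i"
        proof -
          have "\<rho> ^ i = 2 powr (real i / 2 - real i)"
            unfolding \<rho>_def by (simp add: powr_powr flip: powr_realpow)
          also have "\<dots> = 2 powr (real i / 2) / 2 ^ i"
            unfolding powr_diff by (simp add: powr_realpow)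
          finally show ?thesis .
        qed
        have "?b powr (1 - p) * (\<sigma> / 2 ^ Suc (J + i)) \<le> (K * 2 powr (real i / 2)) * (\<sigma> / 2 ^ (J + i))"
          using \<sigma> K by (intro mult_mono K_le) (auto simp: field_simps)
        also have "\<dots> = K * \<sigma> / 2 ^ J * \<rho> ^ i" by (simp add: \<rho>i power_add)
        finally show "?b powr (1 - p) * (\<sigma> / 2 ^ Suc (J + i)) \<le> K * \<sigma> / 2 ^ J * \<rho> ^ i" .
        have "B / 4 ^ Suc (J + i) = B / 4 ^ J * (1/4) ^ Suc i"
          by (simp add: power_add power_divide)
        also have "\<dots> \<le> B / 4 ^ J * (1/2) ^ Suc i"
          using B(1) by (intro mult_left_mono power_mono) auto
        finally show "B / 4 ^ Suc (J + i) \<le> B / 4 ^ J * (1/2) ^ Suc i" .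
      qed
      finally show ?thesis .
    qed
    have "(\<Sum>i. \<integral>\<^sup>+y. ennreal (norm (F (Suc (J + i)) y)) *
        indicator {y. l * r ^ i < norm (F (Suc (J + i)) y)} y \<partial>lborel)
        \<le> (\<Sum>i. ennreal (K * \<sigma> / 2 ^ J * \<rho> ^ i + B / 4 ^ J * (1/2) ^ Suc i))"
      by (intro suminf_le summableI term_le)
    also have "\<dots> = ennreal (\<Sum>i. K * \<sigma> / 2 ^ J * \<rho> ^ i + B / 4 ^ J * (1/2) ^ Suc i)"
      using K \<sigma> B(1) \<rho> by (intro suminf_ennreal2 summable_add summable_mult) auto
    also have "(\<Sum>i. K * \<sigma> / 2 ^ J * \<rho> ^ i + B / 4 ^ J * (1/2) ^ Suc i) = K * \<sigma> / 2 ^ J * (1 / (1 - \<rho>)) + B / 4 ^ J"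
    proof -
      have "(\<lambda>i. K * \<sigma> / 2 ^ J * \<rho> ^ i) sums (K * \<sigma> / 2 ^ J * (1 / (1 - \<rho>)))"
        using \<rho> by (intro sums_mult geometric_sums) auto
      moreover have "(\<lambda>i. B / 4 ^ J * (1/2) ^ Suc i) sums (B / 4 ^ J * 1)"
        by (intro sums_mult power_half_series)
      ultimately show ?thesis using sums_unique[OF sums_add] by fastforce
    qed
    also have "K * \<sigma> / 2 ^ J * (1 / (1 - \<rho>)) = \<eta> / 2 / 2 ^ J"
      using K \<rho> by (simp add: \<sigma>_def)
    also have "B / 4 ^ J \<le> \<eta> / 2 / 2 ^ J"
    proof -
      have "(4::real) ^ J = 2 ^ J * 2 ^ J" by (simp flip: power_mult_distrib)
      moreover have "2 * B \<le> \<eta> * 2 ^ J" using J(2) \<eta> by (simp add: field_simps)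
      ultimately show ?thesis by (simp add: field_simps)
    qed
    finally have "(\<Sum>i. \<integral>\<^sup>+y. ennreal (norm (F (Suc (J + i)) y)) *
        indicator {y. l * r ^ i < norm (F (Suc (J + i)) y)} y \<partial>lborel) \<le> ennreal (\<eta> / 2 ^ J)"
      by (simp add: ennreal_leI)
    then show "\<exists>J. (\<Sum>i. \<integral>\<^sup>+y. ennreal (norm (F (Suc (J + i)) y)) *
        indicator {y. l * r ^ i < norm (F (Suc (J + i)) y)} y \<partial>lborel) \<le> ennreal (\<eta> / 2 ^ J)"
      by blast
  qed
qed

end

section \<open>Kernels of an admissible pair\<close>

lemma schwartz_rapid:
  fixes \<phi> :: "real^'n::finite \<Rightarrow> complex"
  assumes "\<phi> \<in> schwartz_space"
  shows "continuous_on UNIV \<phi>" "rapid \<phi>" "bounded (range \<phi>)" "\<exists>C\<ge>0. \<forall>x. norm (\<phi> x) \<le> C * weight x"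
proof -
  have "smooth \<phi>" and all: "\<forall>k is. bounded (range (\<lambda>x. (1 + norm x) ^ k *\<^sub>R partial_derivs is \<phi> x))"
    using assms unfolding schwartz_space_def by simp_all
  have bdd: "bounded (range (\<lambda>x. (1 + norm x) ^ k *\<^sub>R \<phi> x))" for k
    using all[rule_format, of k "[]"] by simp
  from \<open>smooth \<phi>\<close> have "partial_derivs [] \<phi> differentiable_on UNIV" unfolding smooth_def by blast
  then show cont: "continuous_on UNIV \<phi>" by (simp add: differentiable_imp_continuous_on)
  have [measurable]: "\<phi> \<in> borel_measurable borel" using cont by (rule borel_measurable_continuous_onI)
  show "bounded (range \<phi>)" using bdd[of 0] by simp
  have B: "\<exists>C\<ge>0. \<forall>x. (1 + norm x) ^ k * norm (\<phi> x) \<le> C" for k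
  proof -
    obtain C where "\<forall>y\<in>range (\<lambda>x. (1 + norm x) ^ k *\<^sub>R \<phi> x). norm y \<le> C"
      using bdd[of k] unfolding bounded_iff by (rule exE)
    then have C: "(1 + norm x) ^ k * norm (\<phi> x) \<le> C" for x by simp
    have "0 \<le> C" by (rule order_trans[OF _ C[of 0]]) simp
    with C show ?thesis by blast
  qed
  have W: "\<exists>C\<ge>0. \<forall>x. norm x ^ k * norm (\<phi> x) \<le> C * weight x" for k
  proof -
    obtain C where C: "0 \<le> C" "\<And>x. (1 + norm x) ^ (k + (DIM(real^'n) + 1)) * norm (\<phi> x) \<le> C" using B by blast
    have "norm x ^ k * norm (\<phi> x) \<le> C * weight x" for x
    proof -
      have pos: "0 < (1 + norm x) ^ (DIM(real^'n) + 1)" by (simp add: add_pos_nonneg)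
      have "norm x ^ k * norm (\<phi> x) * (1 + norm x) ^ (DIM(real^'n) + 1) \<le>
          (1 + norm x) ^ k * norm (\<phi> x) * (1 + norm x) ^ (DIM(real^'n) + 1)"
        using pos by (intro mult_right_mono power_mono) auto
      also have "\<dots> \<le> C" using C(2)[of x] by (simp add: power_add mult_ac)
      finally show ?thesis unfolding weight_def using pos by (simp add: pos_le_divide_eq)
    qed
    with C(1) show ?thesis by blast
  qed
  show "\<exists>C\<ge>0. \<forall>x. norm (\<phi> x) \<le> C * weight x" using W[of 0] by simp
  show "rapid \<phi>" unfolding rapid_def
  proof
    fix k
    obtain C where "\<And>x. norm x ^ k * norm (\<phi> x) \<le> C * weight x" using W by blast
    then show "integrable lborel (\<lambda>x. norm x ^ k *\<^sub>R \<phi> x)"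
      by (intro integrable_weight_bound[of _ C]) simp_all
  qed
qed

lemma fourier_transform_eq_ft:
  fixes \<phi> :: "real^'n::finite \<Rightarrow> complex"
  assumes [measurable]: "\<phi> \<in> borel_measurable borel"
  shows "fourier_transform \<phi> \<xi> = of_real ((2 * pi) powr (- real CARD('n) / 2)) * ft \<phi> \<xi>"
  unfolding fourier_transform_def ft_def
  by (subst integral_completion) auto

lemma kernels_of_admissible_pair:
  assumes "admissible_pair \<phi>0 \<phi>"
  obtains \<Phi> \<psi> C where "reproducing_kernels \<phi> \<Phi> \<psi> C" "rapid \<phi>"
proof -
  have S: "\<phi> \<in> schwartz_space" using assms by (simp add: admissible_pair_def)
  note sw = schwartz_rapid[OF S]
  have m: "\<phi> \<in> borel_measurable borel" using sw(1) by (rule borel_measurable_continuous_onI)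
  define k :: real where "k = (2 * pi) powr (- real CARD('a) / 2)"
  have k: "0 < k" by (simp add: k_def)
  have ftk: "fourier_transform \<phi> \<xi> = of_real k * ft \<phi> \<xi>" for \<xi>
    using fourier_transform_eq_ft[OF m] by (simp add: k_def)
  have pos: "ft \<phi> \<xi> \<in> \<real> \<and> 0 \<le> Re (ft \<phi> \<xi>)" for \<xi>
  proof -
    have "fourier_transform \<phi> \<xi> \<in> \<real> \<and> 0 \<le> Re (fourier_transform \<phi> \<xi>)"
      using assms by (simp add: admissible_pair_def)
    then show ?thesis using k by (simp add: ftk complex_is_Real_iff zero_le_mult_iff)
  qed
  have supp: "1/2 \<le> norm \<xi> \<and> norm \<xi> \<le> 2" if "ft \<phi> \<xi> \<noteq> 0" for \<xi>
  proof -
    have "\<xi> \<in> closure {\<xi>. fourier_transform \<phi> \<xi> \<noteq> 0}"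
      using that k by (intro subsetD[OF closure_subset]) (simp add: ftk)
    moreover have "closure {\<xi>. fourier_transform \<phi> \<xi> \<noteq> 0} \<subseteq> {\<xi>. 1/2 \<le> norm \<xi> \<and> norm \<xi> \<le> 2}"
      using assms by (simp add: admissible_pair_def)
    ultimately have "\<xi> \<in> {\<xi>. 1/2 \<le> norm \<xi> \<and> norm \<xi> \<le> 2}" by (rule subsetD[rotated])
    then show ?thesis by simp
  qed
  have low: "ft \<phi> \<xi> \<noteq> 0" if "3/5 \<le> norm \<xi>" "norm \<xi> \<le> 5/3" for \<xi>
  proof -
    from assms obtain C where "C > 0"
      "\<forall>\<xi>. 3/5 \<le> norm \<xi> \<and> norm \<xi> \<le> 5/3 \<longrightarrow> C \<le> norm (fourier_transform \<phi> \<xi>)"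
      unfolding admissible_pair_def by (elim conjE exE)
    then have "0 < norm (fourier_transform \<phi> \<xi>)" using that by fastforce
    then show ?thesis by (auto simp: ftk)
  qed
  obtain \<Phi> \<psi> C where K: "continuous_on UNIV \<Phi>" "continuous_on UNIV \<psi>"
    "\<And>x. norm (\<Phi> x) \<le> C * weight x" "\<And>x. norm (\<psi> x) \<le> C * weight x"
    "(LINT x|lborel. \<Phi> x) \<noteq> 0" "0 \<le> C"
    "\<And>j x. dil (Suc j) \<Phi> x - dil j \<Phi> x = (LINT y|lborel. dil (Suc j) \<psi> y * dil (Suc j) \<phi> (x - y))"
    by (rule Calderon_formula[OF sw(2,1,3) pos supp low]) (assumption | rule that)+
  obtain C' where C': "0 \<le> C'" "\<And>x. norm (\<phi> x) \<le> C' * weight x" using sw(4) by blast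
  have le: "C * weight x \<le> (C + C') * weight x" "C' * weight x \<le> (C + C') * weight x" for x :: "real^'a"
    using K(6) C'(1) by (intro mult_right_mono; simp)+
  have "reproducing_kernels \<phi> \<Phi> \<psi> (C + C')"
    using K C' sw(1) by unfold_locales (auto intro: order_trans[OF _ le(1)] order_trans[OF _ le(2)])
  then show thesis using that sw(2) by blast
qed

section \<open>Consequences of finite quasi-norms\<close>

lemma ennreal_powr_mono: "x \<le> y \<Longrightarrow> 0 < a \<Longrightarrow> ennreal_powr x a \<le> ennreal_powr y a"
  by (cases x; cases y) (auto simp: ennreal_powr_def top_unique intro!: ennreal_leI powr_mono2)

lemma ennreal_powr_ennreal [simp]: "0 \<le> x \<Longrightarrow> ennreal_powr (ennreal x) a = ennreal (x powr a)"
  by (simp add: ennreal_powr_def)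

lemma ennreal_powr_inverse: "0 < a \<Longrightarrow> ennreal_powr (ennreal_powr x a) (1 / a) = x"
  by (cases x) (auto simp: ennreal_powr_def powr_powr)

lemma ennreal_powr_inverse': "0 < a \<Longrightarrow> ennreal_powr (ennreal_powr x (1 / a)) a = x"
  by (cases x) (auto simp: ennreal_powr_def powr_powr)

lemma ennreal_powr_top [simp]: "ennreal_powr top a = top"
  by (simp add: ennreal_powr_def)

lemma ennreal_powr_cmult:
  assumes "0 < c" "0 < a"
  shows "ennreal_powr (ennreal c * x) a = ennreal (c powr a) * ennreal_powr x a"
proof (cases x)
  case (real r)
  then have eq: "ennreal c * x = ennreal (c * r)" using assms by (simp add: ennreal_mult)
  have "ennreal_powr (ennreal c * x) a = ennreal (c powr a * r powr a)"
    unfolding eq using real assms by (simp add: powr_mult)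
  also have "\<dots> = ennreal (c powr a) * ennreal (r powr a)" by (rule ennreal_mult') simp
  finally show ?thesis using real by simp
qed (use assms in \<open>simp add: ennreal_mult_top\<close>)

lemma ennreal_powr_measurable [measurable]:
  assumes [measurable]: "f \<in> borel_measurable M"
  shows "(\<lambda>x. ennreal_powr (f x) a) \<in> borel_measurable M"
  unfolding ennreal_powr_def by measurable

lemma Lp_norm_finite_exponent:
  assumes "1 \<le> p" "p < \<infinity>"
  shows "0 < enn2real p" "1 \<le> enn2real p" "enn2real (1 / p) = 1 / enn2real p"
    "Lp_norm M p f = ennreal_powr (\<integral>\<^sup>+ x. ennreal_powr (f x) (enn2real p) \<partial>M) (1 / enn2real p)"
proof -
  obtain r where r: "p = ennreal r" "0 \<le> r" using assms(2) by (cases p) auto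
  then have "1 \<le> r" using assms(1) by (simp flip: ennreal_1)
  moreover have "1 / p = ennreal (1 / r)"
    using r \<open>1 \<le> r\<close> by (simp add: divide_ennreal flip: ennreal_1)
  ultimately show "0 < enn2real p" "1 \<le> enn2real p" "enn2real (1 / p) = 1 / enn2real p"
    using r by auto
  show "Lp_norm M p f = ennreal_powr (\<integral>\<^sup>+ x. ennreal_powr (f x) (enn2real p) \<partial>M) (1 / enn2real p)"
    using r by (simp add: Lp_norm_def)
qed

lemma Lp_norm_mono:
  assumes "1 \<le> p" "p < \<infinity>" "\<And>x. f x \<le> g x"
  shows "Lp_norm M p f \<le> Lp_norm M p g"
  unfolding Lp_norm_finite_exponent(4)[OF assms(1,2)]
  using Lp_norm_finite_exponent(1)[OF assms(1,2)]
  by (intro ennreal_powr_mono nn_integral_mono assms(3)) auto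

lemma Lp_norm_cmult:
  assumes p: "1 \<le> p" "p < \<infinity>" and c: "0 < c" and [measurable]: "f \<in> borel_measurable M"
  shows "Lp_norm M p (\<lambda>x. ennreal c * f x) = ennreal c * Lp_norm M p f"
proof -
  note pp = Lp_norm_finite_exponent[OF p]
  let ?p = "enn2real p"
  have "(\<integral>\<^sup>+ x. ennreal_powr (ennreal c * f x) ?p \<partial>M) = ennreal (c powr ?p) * (\<integral>\<^sup>+ x. ennreal_powr (f x) ?p \<partial>M)"
    using c pp(1) by (simp add: ennreal_powr_cmult nn_integral_cmult)
  then show ?thesis
    unfolding pp(4) using c pp(1) by (simp add: ennreal_powr_cmult powr_powr)
qed

lemma lq_norm_from_ge:
  assumes "0 < q"
  shows "a (J + k) \<le> lq_norm_from J q a"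
proof (cases "q = \<infinity>")
  case True then show ?thesis by (auto simp: lq_norm_from_def intro: SUP_upper)
next
  case False
  have q: "0 < enn2real q" using assms False by (simp add: enn2real_positive_iff less_top)
  let ?f = "\<lambda>k. ennreal_powr (a (J + k)) (enn2real q)"
  have "?f k \<le> (\<Sum>k. ?f k)" using sum_le_suminf[OF summableI, of "{k}" ?f] by simp
  then have "ennreal_powr (?f k) (1 / enn2real q) \<le> ennreal_powr (\<Sum>k. ?f k) (1 / enn2real q)"
    using q by (intro ennreal_powr_mono) auto
  then show ?thesis using False q by (simp add: lq_norm_from_def ennreal_powr_inverse)
qed

lemma lq_norm_from_finite_tendsto_0:
  assumes q: "0 < q" "q < \<infinity>" and fin: "lq_norm_from 0 q a < \<infinity>" and e: "0 < e"
  shows "eventually (\<lambda>k. a k \<le> ennreal e) sequentially"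
proof -
  let ?q = "enn2real q"
  have q': "0 < ?q" using q by (simp add: enn2real_positive_iff)
  let ?f = "\<lambda>k. ennreal_powr (a k) ?q"
  have "(\<Sum>k. ?f k) \<noteq> top"
  proof -
    have "q \<noteq> \<infinity>" using q(2) by auto
    then show ?thesis using fin by (auto simp: lq_norm_from_def)
  qed
  then have nt: "?f k \<noteq> top" for k
    using sum_le_suminf[OF summableI, of "{k}" ?f] by (auto simp: top_unique)
  then have f: "?f k = ennreal (enn2real (?f k))" for k by (simp add: less_top)
  have "summable (\<lambda>k. enn2real (?f k))"
    using \<open>(\<Sum>k. ?f k) \<noteq> top\<close> f by (intro summable_suminf_not_top) auto
  then have "(\<lambda>k. enn2real (?f k)) \<longlonglongrightarrow> 0" by (rule summable_LIMSEQ_zero)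
  then have "eventually (\<lambda>k. enn2real (?f k) < e powr ?q) sequentially"
    by (rule order_tendstoD(2)) (use e in simp)
  then show ?thesis
  proof eventually_elim
    fix k assume "enn2real (?f k) < e powr ?q"
    then have "?f k \<le> ennreal (e powr ?q)" by (subst f) (simp add: ennreal_leI)
    then have "ennreal_powr (?f k) (1 / ?q) \<le> ennreal_powr (ennreal (e powr ?q)) (1 / ?q)"
      using q' by (intro ennreal_powr_mono) auto
    then show "a k \<le> ennreal e" using q' e by (simp add: ennreal_powr_inverse powr_powr)
  qed
qed

lemma nn_integral_lebesgue_on:
  assumes f: "f \<in> borel_measurable borel" and P: "P \<in> sets borel"
  shows "(\<integral>\<^sup>+x. f x \<partial>lebesgue_on P) = (\<integral>\<^sup>+x. f x * indicator P x \<partial>lborel)"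
proof -
  have "(\<integral>\<^sup>+x. f x \<partial>lebesgue_on P) = (\<integral>\<^sup>+x. f x * indicator P x \<partial>lebesgue)"
    using P by (subst nn_integral_restrict_space) auto
  also have "\<dots> = (\<integral>\<^sup>+x. f x * indicator P x \<partial>lborel)"
    using f P by (intro nn_integral_completion)
  finally show ?thesis .
qed

lemma cmult_le_ennreal:
  assumes "0 < c" "ennreal c * x \<le> ennreal y"
  shows "x \<le> ennreal (y / c)"
proof (cases x)
  case (real r)
  then have "ennreal (c * r) \<le> ennreal y" using assms by (simp add: ennreal_mult)
  show ?thesis
  proof (cases "0 \<le> y")
    case True
    then have "c * r \<le> y" using \<open>ennreal (c * r) \<le> ennreal y\<close> by (simp add: ennreal_le_iff)
    then have "r \<le> y / c" using assms(1) by (simp add: pos_le_divide_eq mult.commute)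
    then show ?thesis using real by (simp add: ennreal_leI)
  next
    case False
    then have "c * r \<le> 0" using \<open>ennreal (c * r) \<le> ennreal y\<close> by (simp add: ennreal_neg ennreal_eq_0_iff)
    then have "r = 0" using assms(1) real by (simp add: mult_le_0_iff)
    then show ?thesis using real by simp
  qed
qed (use assms in \<open>simp add: ennreal_mult_top top_unique\<close>)

text \<open>Averages are controlled by \<open>L\<^sup>p\<close> averages, through \<open>t \<le> a + t powr p * a powr (1 - p)\<close>.\<close>

lemma integral_le_Lp_norm:
  fixes f :: "'a::euclidean_space \<Rightarrow> real"
  assumes p: "1 \<le> p" and [measurable]: "f \<in> borel_measurable borel" "P \<in> sets borel"
    and f: "\<And>x. 0 \<le> f x" and v: "emeasure lborel P = ennreal v" "0 < v" and N: "0 \<le> N" and a: "0 < a"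
    and Lp: "Lp_norm (lebesgue_on P) p (\<lambda>x. ennreal (f x)) \<le> ennreal (N * a * v powr enn2real (1 / p))"
  shows "(\<integral>\<^sup>+x. ennreal (f x) * indicator P x \<partial>lborel) \<le> ennreal ((1 + N + N powr enn2real p) * a * v)"
proof (cases "p = \<infinity>")
  case True
  have "esssup (lebesgue_on P) (\<lambda>x. ennreal (f x)) \<le> ennreal (N * a)"
    using Lp v(2) True by (simp add: Lp_norm_def)
  then have "AE x in lebesgue_on P. ennreal (f x) \<le> ennreal (N * a)"
    using esssup_AE[of "\<lambda>x. ennreal (f x)" "lebesgue_on P"] by (auto elim: eventually_mono)
  then have "(\<integral>\<^sup>+x. ennreal (f x) \<partial>lebesgue_on P) \<le> (\<integral>\<^sup>+x. ennreal (N * a) \<partial>lebesgue_on P)"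
    by (rule nn_integral_mono_AE)
  then have "(\<integral>\<^sup>+x. ennreal (f x) * indicator P x \<partial>lborel) \<le> (\<integral>\<^sup>+x. ennreal (N * a) * indicator P x \<partial>lborel)"
    by (subst (asm) (1 2) nn_integral_lebesgue_on) auto
  also have "\<dots> = ennreal (N * a) * ennreal v" by (subst nn_integral_cmult_indicator) (auto simp: v)
  also have "\<dots> = ennreal (N * a * v)" using N a by (simp add: ennreal_mult')
  also have "\<dots> \<le> ennreal ((1 + N + N powr enn2real p) * a * v)"
    using N a v(2) by (intro ennreal_leI mult_right_mono) auto
  finally show ?thesis .
next
  case False
  then have p': "p < \<infinity>" by (simp add: less_top)
  note pp = Lp_norm_finite_exponent[OF p p']
  let ?p = "enn2real p"
  let ?I = "\<integral>\<^sup>+x. ennreal (f x powr ?p) * indicator P x \<partial>lborel"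
  have "Lp_norm (lebesgue_on P) p (\<lambda>x. ennreal (f x)) = ennreal_powr ?I (1 / ?p)"
    unfolding pp(4) using f by (simp add: nn_integral_lebesgue_on)
  then have "ennreal_powr (ennreal_powr ?I (1 / ?p)) ?p \<le> ennreal_powr (ennreal (N * a * v powr (1 / ?p))) ?p"
    using Lp pp(1,3) by (intro ennreal_powr_mono) auto
  then have I: "?I \<le> ennreal (N powr ?p * a powr ?p * v)"
    using pp(1) N a v(2) by (simp add: ennreal_powr_inverse' powr_mult powr_powr)
  have pt: "ennreal (f x) \<le> ennreal a + ennreal (a powr (1 - ?p)) * ennreal (f x powr ?p)" for x
  proof -
    have "f x \<le> a + a powr (1 - ?p) * f x powr ?p"
    proof (cases "f x \<le> a")
      case True then show ?thesis by (simp add: add_increasing2)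
    next
      case False
      have "f x = f x powr (1 - ?p) * f x powr ?p" using False a by (simp flip: powr_add)
      also have "\<dots> \<le> a powr (1 - ?p) * f x powr ?p"
        using False a pp(2) by (intro mult_right_mono powr_mono2') auto
      finally show ?thesis using a by simp
    qed
    then have "ennreal (f x) \<le> ennreal (a + a powr (1 - ?p) * f x powr ?p)" by (rule ennreal_leI)
    then show ?thesis using a by (simp add: ennreal_mult')
  qed
  have "(\<integral>\<^sup>+x. ennreal (f x) * indicator P x \<partial>lborel) \<le>
      (\<integral>\<^sup>+x. ennreal a * indicator P x + ennreal (a powr (1 - ?p)) * (ennreal (f x powr ?p) * indicator P x) \<partial>lborel)"
    using pt by (intro nn_integral_mono) (auto simp: indicator_def)
  also have "\<dots> = ennreal a * ennreal v + ennreal (a powr (1 - ?p)) * ?I"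
    by (subst nn_integral_add, measurable)
       (subst nn_integral_cmult_indicator, simp, subst nn_integral_cmult, measurable, simp add: v)
  also have "\<dots> \<le> ennreal a * ennreal v + ennreal (a powr (1 - ?p)) * ennreal (N powr ?p * a powr ?p * v)"
    by (intro add_left_mono mult_left_mono I) simp
  also have "\<dots> = ennreal (a * v + a powr (1 - ?p) * (N powr ?p * a powr ?p * v))"
    using a v(2) by (simp add: ennreal_mult')
  also have "a powr (1 - ?p) * (N powr ?p * a powr ?p * v) = N powr ?p * (a powr (1 - ?p) * a powr ?p) * v"
    by (simp add: mult_ac)
  also have "a powr (1 - ?p) * a powr ?p = a" using a by (simp flip: powr_add)
  also have "ennreal (a * v + N powr ?p * a * v) \<le> ennreal ((1 + N + N powr ?p) * a * v)"
    using N a v(2) by (intro ennreal_leI) (simp add: algebra_simps)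
  finally show ?thesis .
qed

lemma nn_integral_UN_le:
  fixes P :: "'b \<Rightarrow> 'a::euclidean_space set"
  assumes "finite K" and [measurable]: "f \<in> borel_measurable borel" "\<And>k. P k \<in> sets borel"
  shows "(\<integral>\<^sup>+x. f x * indicator (\<Union>k\<in>K. P k) x \<partial>lborel) \<le> (\<Sum>k\<in>K. \<integral>\<^sup>+x. f x * indicator (P k) x \<partial>lborel)"
proof -
  have "(\<integral>\<^sup>+x. f x * indicator (\<Union>k\<in>K. P k) x \<partial>lborel) \<le> (\<integral>\<^sup>+x. (\<Sum>k\<in>K. f x * indicator (P k) x) \<partial>lborel)"
  proof (intro nn_integral_mono)
    fix x
    show "f x * indicator (\<Union>k\<in>K. P k) x \<le> (\<Sum>k\<in>K. f x * indicator (P k) x)"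
    proof (cases "x \<in> (\<Union>k\<in>K. P k)")
      case True
      then obtain k where k: "k \<in> K" "x \<in> P k" by blast
      then have "f x * indicator (\<Union>k\<in>K. P k) x = f x * indicator (P k) x" using True by simp
      also have "\<dots> \<le> (\<Sum>k\<in>K. f x * indicator (P k) x)"
        using member_le_sum[OF k(1), of "\<lambda>k. f x * indicator (P k) x"] assms(1) by simp
      finally show ?thesis .
    qed simp
  qed
  also have "\<dots> = (\<Sum>k\<in>K. \<integral>\<^sup>+x. f x * indicator (P k) x \<partial>lborel)"
    by (rule nn_integral_sum) measurable
  finally show ?thesis .
qed

section \<open>Null sets from bounds on dyadic cubes\<close>

lemma measure_dyadic_cube:
  "measure lebesgue (dyadic_cube j (k :: int^'n::finite)) = 1 / (2 powi j) ^ CARD('n)"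
  using emeasure_dyadic_cube[of j k] by (simp add: measure_def)

lemma measure_dyadic_cube_nat:
  "measure lebesgue (dyadic_cube (int j) (k :: int^'n::finite)) = 2 powr (- (real j * real CARD('n)))"
proof -
  have "(2::real) powr (- (real j * real CARD('n))) = 1 / 2 ^ (j * CARD('n))"
    by (simp add: powr_minus divide_inverse flip: powr_realpow)
  then show ?thesis unfolding measure_dyadic_cube by (simp add: power_mult)
qed

context mollified_set
begin

text \<open>On the cubes of edge length \<open>2 ^ - j\<close> the bound for the term \<open>j\<close> of the quasi-norm says
  that the averages of \<open>F j\<close> are of size \<open>2 ^ (- j (s + n \<tau> - n / p))\<close>.\<close>

lemma null_if_cube_norms_bounded:
  assumes p: "1 \<le> p" and s: "s > real CARD('n) * (enn2real (1 / p) - \<tau>)" and N: "0 \<le> N"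
    and le: "\<And>j k. ennreal (2 powr (real (Suc j) * s)) * Lp_norm (lebesgue_on (dyadic_cube (int (Suc j)) k)) p
        (\<lambda>x. ennreal (norm (F (Suc j) x)))
      \<le> ennreal (N * measure lebesgue (dyadic_cube (int (Suc j)) k) powr \<tau>)"
  shows "emeasure lborel E = 0"
proof -
  let ?n = "real CARD('n)" and ?ip = "enn2real (1 / p)"
  define \<epsilon> where "\<epsilon> = s - ?n * (?ip - \<tau>)"
  have \<epsilon>: "0 < \<epsilon>" using s by (simp add: \<epsilon>_def)
  define r where "r = 2 powr (- \<epsilon>)"
  have r: "0 < r" "r < 1" using \<epsilon> powr_less_mono[of "- \<epsilon>" 0 2] by (auto simp: r_def)
  define A where "A = 1 + N + N powr enn2real p"
  have A: "0 \<le> A" using N by (simp add: A_def)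
  show ?thesis
  proof (rule null_if_cell_averages_decay[OF r A])
    fix j and z :: "real^'n"
    define k :: "int^'n" where "k = (\<chi> i. \<lfloor>2 ^ Suc j * z $ i\<rfloor>)"
    let ?P = "dyadic_cube (int (Suc j)) k"
    define v where "v = 2 powr (- (real (Suc j) * ?n))"
    have v: "measure lebesgue ?P = v" "emeasure lborel ?P = ennreal v" "0 < v"
    proof -
      show m: "measure lebesgue ?P = v" unfolding v_def by (rule measure_dyadic_cube_nat)
      have "emeasure lborel ?P = ennreal (measure lebesgue ?P)"
        unfolding measure_dyadic_cube emeasure_dyadic_cube ..
      then show "emeasure lborel ?P = ennreal v" unfolding m .
    qed (simp add: v_def)
    have cell: "{y. same_cell (Suc j) y z} = ?P" unfolding k_def by (rule dyadic_cube_same_cell)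
    let ?a = "r ^ Suc j"
    have "Lp_norm (lebesgue_on ?P) p (\<lambda>x. ennreal (norm (F (Suc j) x))) \<le> ennreal (N * v powr \<tau> / 2 powr (real (Suc j) * s))"
      using le[of j k] unfolding v(1) by (intro cmult_le_ennreal) auto
    also have "N * v powr \<tau> / 2 powr (real (Suc j) * s) = N * ?a * v powr ?ip"
    proof -
      have "v powr \<tau> / 2 powr (real (Suc j) * s) = 2 powr (- (real (Suc j) * ?n) * \<tau> - real (Suc j) * s)"
        unfolding v_def powr_powr powr_diff[of 2, symmetric] ..
      also have "- (real (Suc j) * ?n) * \<tau> - real (Suc j) * s = - \<epsilon> * real (Suc j) + - (real (Suc j) * ?n) * ?ip"
        by (simp add: \<epsilon>_def algebra_simps)
      also have "2 powr (- \<epsilon> * real (Suc j) + - (real (Suc j) * ?n) * ?ip) = ?a * v powr ?ip"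
        unfolding powr_add v_def powr_powr r_def powr_realpow[OF r(1)[unfolded r_def], symmetric] ..
      finally show ?thesis by (simp add: mult.assoc flip: times_divide_eq_right)
    qed
    finally have Lp: "Lp_norm (lebesgue_on ?P) p (\<lambda>x. ennreal (norm (F (Suc j) x))) \<le> ennreal (N * ?a * v powr ?ip)" .
    have "(\<integral>\<^sup>+x. ennreal (norm (F (Suc j) x)) * indicator ?P x \<partial>lborel) \<le> ennreal (A * ?a * v)"
      unfolding A_def by (rule integral_le_Lp_norm[OF p _ _ _ v(2,3) N _ Lp]) (use r in auto)
    also have "\<dots> \<le> ennreal (A * r ^ j / 2 ^ (Suc j * CARD('n)))"
    proof (intro ennreal_leI)
      have v': "v = 1 / 2 ^ (Suc j * CARD('n))"
      proof -
        have "(2::real) ^ (Suc j * CARD('n)) = 2 powr (real (Suc j) * ?n)"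
          unfolding of_nat_mult[symmetric] by (rule powr_realpow[symmetric]) simp
        then show ?thesis unfolding v_def powr_minus by (simp only: inverse_eq_divide)
      qed
      have "A * ?a * v \<le> A * r ^ j * v"
        using A r v(3) power_decreasing[of j "Suc j" r] by (intro mult_right_mono mult_left_mono) auto
      then show "A * ?a * v \<le> A * r ^ j / 2 ^ (Suc j * CARD('n))" unfolding v' by simp
    qed
    finally show "(\<integral>\<^sup>+y. ennreal (norm (F (Suc j) y)) * indicator {y. same_cell (Suc j) y z} y \<partial>lborel)
      \<le> ennreal (A * r ^ j / 2 ^ (Suc j * CARD('n)))" unfolding cell .
  qed
qed

text \<open>Every orthant needs its own cube, since dyadic cubes do not cross the coordinate hyperplanes.\<close>

lemma dyadic_cover:
  obtains m :: nat and K :: "(int^'n) set" where "finite K"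
    "\<And>x y. x \<notin> (\<Union>k\<in>K. dyadic_cube (- int m) k) \<Longrightarrow> y \<in> E \<Longrightarrow> 1 \<le> norm (x - y)"
proof -
  obtain R where R: "\<And>y. y \<in> E \<Longrightarrow> norm y \<le> R" using bounded_E unfolding bounded_iff by blast
  obtain m where m: "R + 1 < 2 ^ m" using real_arch_pow[of 2 "R + 1"] by auto
  define K :: "(int^'n) set" where "K = range (\<lambda>f::'n \<Rightarrow> bool. \<chi> i. if f i then - 1 else 0)"
  have "finite K" unfolding K_def by simp
  moreover have "1 \<le> norm (x - y)" if x: "x \<notin> (\<Union>k\<in>K. dyadic_cube (- int m) k)" and y: "y \<in> E" for x y :: "real^'n"
  proof -
    have "\<not> (\<forall>i. - (2 ^ m) \<le> x $ i \<and> x $ i < 2 ^ m)"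
    proof
      assume small: "\<forall>i. - (2 ^ m) \<le> x $ i \<and> x $ i < 2 ^ m"
      let ?k = "(\<chi> i. if x $ i < 0 then - 1 else 0) :: int^'n"
      have "?k \<in> K" unfolding K_def by (rule range_eqI[of _ _ "\<lambda>i. x $ i < 0"]) simp
      moreover have "x \<in> dyadic_cube (- int m) ?k"
        unfolding dyadic_cube_eq
      proof (clarify)
        fix i
        have "- (2 ^ m) \<le> x $ i" "x $ i < 2 ^ m" using small by auto
        then show "\<lfloor>2 powi (- int m) * x $ i\<rfloor> = ?k $ i"
          by (simp add: floor_eq_iff power_int_minus field_simps mult_less_0_iff)
      qed
      ultimately show False using x by blast
    qed
    then obtain i where "\<not> (- (2 ^ m) \<le> x $ i \<and> x $ i < 2 ^ m)" by blast
    then have "2 ^ m \<le> \<bar>x $ i\<bar>" by (cases "x $ i < 0") auto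
    then have "2 ^ m \<le> norm x" using component_le_norm_cart[of x i] by linarith
    moreover have "norm x - norm y \<le> norm (x - y)" by (rule norm_triangle_ineq2)
    ultimately show ?thesis using R[OF y] m by linarith
  qed
  ultimately show thesis using that by blast
qed

lemma null_if_cube_norms_tend_to_0:
  assumes rapid: "rapid \<phi>" and p: "1 \<le> p" "p < \<infinity>"
    and ev: "\<And>m k e. 0 < e \<Longrightarrow> eventually (\<lambda>j. ennreal (2 powr (real j * enn2real (1 / p))) *
      Lp_norm (lebesgue_on (dyadic_cube (- int m) k)) p (\<lambda>x. ennreal (norm (F j x))) \<le> ennreal e) sequentially"
  shows "emeasure lborel E = 0"
proof -
  note pp = Lp_norm_finite_exponent[OF p]
  let ?p = "enn2real p"
  obtain m and K :: "(int^'n) set" where K: "finite K"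
    "\<And>x y. x \<notin> (\<Union>k\<in>K. dyadic_cube (- int m) k) \<Longrightarrow> y \<in> E \<Longrightarrow> 1 \<le> norm (x - y)"
    by (rule dyadic_cover) blast
  let ?P = "\<lambda>k. dyadic_cube (- int m) k"
  let ?D = "\<Union>k\<in>K. ?P k"
  have D: "?D \<in> sets borel" using K(1) by auto
  show ?thesis
  proof (rule null_if_Lp_truncations_small[OF rapid pp(2) D K(2)])
    fix l \<sigma> :: real assume \<sigma>: "0 < \<sigma>"
    define e where "e = (\<sigma> / (real (card K) + 1)) powr (1 / ?p)"
    have e: "0 < e" using \<sigma> by (simp add: e_def)
    have ep: "e powr ?p = \<sigma> / (real (card K) + 1)"
      using \<sigma> pp(1) by (simp add: e_def powr_powr)
    have "eventually (\<lambda>j. \<forall>k\<in>K. ennreal (2 powr (real j * enn2real (1 / p))) *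
      Lp_norm (lebesgue_on (?P k)) p (\<lambda>x. ennreal (norm (F j x))) \<le> ennreal e) sequentially"
      using K(1) ev[OF e] by (intro eventually_ball_finite) auto
    then obtain J0 where J0: "\<And>j k. J0 \<le> j \<Longrightarrow> k \<in> K \<Longrightarrow> ennreal (2 powr (real j * enn2real (1 / p))) *
      Lp_norm (lebesgue_on (?P k)) p (\<lambda>x. ennreal (norm (F j x))) \<le> ennreal e"
      unfolding eventually_sequentially by blast
    have main: "(\<integral>\<^sup>+y. ennreal (norm (F j y) powr ?p) * indicator ?D y \<partial>lborel) \<le> ennreal (\<sigma> / 2 ^ j)" if j: "J0 \<le> j" for j
    proof -
      have cube: "(\<integral>\<^sup>+y. ennreal (norm (F j y) powr ?p) * indicator (?P k) y \<partial>lborel) \<le> ennreal (e powr ?p / 2 ^ j)"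
        (is "?I k \<le> _") if k: "k \<in> K" for k
      proof -
        have "Lp_norm (lebesgue_on (?P k)) p (\<lambda>x. ennreal (norm (F j x))) \<le> ennreal (e / 2 powr (real j * (1 / ?p)))"
          using J0[OF j k] unfolding pp(3) by (intro cmult_le_ennreal) auto
        moreover have "Lp_norm (lebesgue_on (?P k)) p (\<lambda>x. ennreal (norm (F j x))) = ennreal_powr (?I k) (1 / ?p)"
          unfolding pp(4) by (simp add: nn_integral_lebesgue_on)
        ultimately have "ennreal_powr (ennreal_powr (?I k) (1 / ?p)) ?p \<le> ennreal_powr (ennreal (e / 2 powr (real j * (1 / ?p)))) ?p"
          using pp(1) by (intro ennreal_powr_mono) auto
        also have "\<dots> = ennreal (e powr ?p / 2 ^ j)"
          using e pp(1) by (simp add: powr_divide powr_powr powr_realpow)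
        finally show ?thesis using pp(1) by (simp add: ennreal_powr_inverse')
      qed
      have "(\<integral>\<^sup>+y. ennreal (norm (F j y) powr ?p) * indicator ?D y \<partial>lborel) \<le> (\<Sum>k\<in>K. ?I k)"
        by (rule nn_integral_UN_le[OF K(1)]) measurable
      also have "\<dots> \<le> (\<Sum>k\<in>K. ennreal (e powr ?p / 2 ^ j))" by (intro sum_mono cube)
      also have "\<dots> = ennreal (real (card K) * (e powr ?p / 2 ^ j))"
        by (subst ennreal_mult') (simp_all add: ennreal_of_nat_eq_real_of_nat)
      also have "\<dots> \<le> ennreal (\<sigma> / 2 ^ j)"
      proof (rule ennreal_leI)
        have "real (card K) * (e powr ?p / 2 ^ j) = (\<sigma> / 2 ^ j) * (real (card K) / (real (card K) + 1))"
          unfolding ep by (simp add: mult.commute)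
        also have "\<dots> \<le> \<sigma> / 2 ^ j" using \<sigma> by (intro mult_left_le) auto
        finally show "real (card K) * (e powr ?p / 2 ^ j) \<le> \<sigma> / 2 ^ j" .
      qed
      finally show ?thesis .
    qed
    show "\<exists>J0. \<forall>J\<ge>J0. \<forall>i. (\<integral>\<^sup>+y. ennreal (norm (F (Suc (J + i)) y) powr ?p) *
        indicator (?D \<inter> {y. l * (2 powr (- 1 / (2 * ?p))) ^ i < norm (F (Suc (J + i)) y)}) y \<partial>lborel)
      \<le> ennreal (\<sigma> / 2 ^ Suc (J + i))"
    proof (intro exI[of _ J0] allI impI)
      fix J i assume "J0 \<le> J"
      have "(\<integral>\<^sup>+y. ennreal (norm (F (Suc (J + i)) y) powr ?p) *
        indicator (?D \<inter> {y. l * (2 powr (- 1 / (2 * ?p))) ^ i < norm (F (Suc (J + i)) y)}) y \<partial>lborel) \<le>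
        (\<integral>\<^sup>+y. ennreal (norm (F (Suc (J + i)) y) powr ?p) * indicator ?D y \<partial>lborel)"
        by (intro nn_integral_mono mult_left_mono) (auto simp: indicator_def)
      also have "\<dots> \<le> ennreal (\<sigma> / 2 ^ Suc (J + i))" using \<open>J0 \<le> J\<close> by (intro main) simp
      finally show "(\<integral>\<^sup>+y. ennreal (norm (F (Suc (J + i)) y) powr ?p) *
        indicator (?D \<inter> {y. l * (2 powr (- 1 / (2 * ?p))) ^ i < norm (F (Suc (J + i)) y)}) y \<partial>lborel)
        \<le> ennreal (\<sigma> / 2 ^ Suc (J + i))" .
    qed
  qed
qed

text \<open>If \<open>norm (F j y)\<close> exceeds \<open>l * r ^ i\<close> with \<open>j = Suc (J + i)\<close>, then the maximal function \<open>h\<close>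
  exceeds \<open>l * 2 powr (J / p)\<close> at \<open>y\<close>. The integral of \<open>h powr p\<close> over such points tends to \<open>0\<close> as
  \<open>J\<close> grows, uniformly in \<open>i\<close>.\<close>

lemma null_if_maximal_function_Lp:
  assumes rapid: "rapid \<phi>" and p: "1 \<le> p" "p < \<infinity>"
    and fin: "\<And>m k. Lp_norm (lebesgue_on (dyadic_cube (- int m) k)) p
      (\<lambda>x. SUP j. ennreal (2 powr (real (Suc j) * enn2real (1 / p)) * norm (F (Suc j) x))) < \<infinity>"
  shows "emeasure lborel E = 0"
proof -
  note pp = Lp_norm_finite_exponent[OF p]
  let ?p = "enn2real p"
  obtain m and K :: "(int^'n) set" where K: "finite K"
    "\<And>x y. x \<notin> (\<Union>k\<in>K. dyadic_cube (- int m) k) \<Longrightarrow> y \<in> E \<Longrightarrow> 1 \<le> norm (x - y)"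
    by (rule dyadic_cover) blast
  let ?P = "\<lambda>k. dyadic_cube (- int m) k"
  let ?D = "\<Union>k\<in>K. ?P k"
  have D [measurable]: "?D \<in> sets borel" using K(1) by auto
  define h where "h x = (SUP j. ennreal (2 powr (real (Suc j) * enn2real (1 / p)) * norm (F (Suc j) x)))" for x
  have [measurable]: "h \<in> borel_measurable borel" unfolding h_def by measurable
  let ?w = "\<lambda>x. ennreal_powr (h x) ?p * indicator ?D x"
  have wfin: "(\<integral>\<^sup>+x. ?w x \<partial>lborel) < \<infinity>"
  proof -
    have "(\<integral>\<^sup>+x. ennreal_powr (h x) ?p * indicator (?P k) x \<partial>lborel) < \<infinity>" (is "?I k < _") for k
    proof -
      have "Lp_norm (lebesgue_on (?P k)) p h = ennreal_powr (?I k) (1 / ?p)"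
        unfolding pp(4) by (simp add: nn_integral_lebesgue_on)
      then have "ennreal_powr (?I k) (1 / ?p) \<noteq> top" using fin[of m k] unfolding h_def by (simp add: less_top)
      then show ?thesis by (cases "?I k") auto
    qed
    then have "(\<Sum>k\<in>K. \<integral>\<^sup>+x. ennreal_powr (h x) ?p * indicator (?P k) x \<partial>lborel) < \<infinity>"
      using K(1) by simp
    then show ?thesis by (intro le_less_trans[OF nn_integral_UN_le[OF K(1)]]) auto
  qed
  show ?thesis
  proof (rule null_if_Lp_truncations_small[OF rapid pp(2) D K(2)])
    fix l \<sigma> :: real assume l: "0 < l" and \<sigma>: "0 < \<sigma>"
    define T where "T J = ennreal (l * 2 powr (real J / ?p))" for J
    let ?v = "\<lambda>J x. ?w x * indicator {x. T J < h x} x"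
    have lim: "(\<lambda>J. \<integral>\<^sup>+x. ?v J x \<partial>lborel) \<longlonglongrightarrow> (\<integral>\<^sup>+x. (0::ennreal) \<partial>(lborel :: (real^'n) measure))"
    proof (rule nn_integral_dominated_convergence[where w="?w"])
      show "AE x in lborel. ?v J x \<le> ?w x" for J by (intro AE_I2) (simp add: indicator_def)
      have "AE x in lborel. ?w x \<noteq> \<infinity>" by (rule nn_integral_PInf_AE) (use wfin in auto)
      then show "AE x in lborel. (\<lambda>J. ?v J x) \<longlonglongrightarrow> 0"
      proof eventually_elim
        fix x assume "?w x \<noteq> \<infinity>"
        \<comment> \<open>Where \<open>h\<close> is finite, the threshold \<open>T J\<close> eventually exceeds it.\<close>
        then consider "x \<notin> ?D" | "h x \<noteq> top" by (cases "x \<in> ?D") (auto simp: ennreal_powr_def split: if_splits)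
        then show "(\<lambda>J. ?v J x) \<longlonglongrightarrow> 0"
        proof cases
          case 2
          then obtain t where t: "h x = ennreal t" "0 \<le> t" by (cases "h x") auto
          define b where "b = (2::real) powr (1 / ?p)"
          have b: "1 < b" using pp(1) powr_less_mono[of 0 "1 / ?p" 2] by (simp add: b_def)
          obtain J0 where J0: "t / l < b ^ J0" using real_arch_pow[OF b] by blast
          have "?v J x = 0" if "J0 \<le> J" for J
          proof -
            have "t / l \<le> b ^ J" using J0 power_increasing[OF that, of b] b by linarith
            also have "b ^ J = 2 powr (real J / ?p)" unfolding b_def by (simp add: powr_powr flip: powr_realpow)
            finally have "h x \<le> T J" unfolding t(1) T_def using l by (intro ennreal_leI) (simp add: field_simps)
            then show ?thesis by (simp add: not_less)
          qed
          then show ?thesis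
            by (intro tendsto_eventually) (auto simp: eventually_sequentially)
        qed simp
      qed
    qed (use wfin in \<open>auto simp: T_def\<close>)
    then have "eventually (\<lambda>J. (\<integral>\<^sup>+x. ?v J x \<partial>lborel) < ennreal \<sigma>) sequentially"
      by (intro order_tendstoD(2)) (use \<sigma> in auto)
    then obtain J0 where J0: "\<And>J. J0 \<le> J \<Longrightarrow> (\<integral>\<^sup>+x. ?v J x \<partial>lborel) < ennreal \<sigma>"
      unfolding eventually_sequentially by blast
    show "\<exists>J0. \<forall>J\<ge>J0. \<forall>i. (\<integral>\<^sup>+y. ennreal (norm (F (Suc (J + i)) y) powr ?p) *
        indicator (?D \<inter> {y. l * (2 powr (- 1 / (2 * ?p))) ^ i < norm (F (Suc (J + i)) y)}) y \<partial>lborel)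
      \<le> ennreal (\<sigma> / 2 ^ Suc (J + i))"
    proof (intro exI[of _ J0] allI impI)
      fix J i assume J: "J0 \<le> J"
      let ?j = "Suc (J + i)"
      let ?G = "{y. l * (2 powr (- 1 / (2 * ?p))) ^ i < norm (F ?j y)}"
      have pt: "ennreal (norm (F ?j y) powr ?p) * indicator (?D \<inter> ?G) y \<le> ennreal (1 / 2 ^ ?j) * ?v J y" for y
      proof (cases "y \<in> ?D \<inter> ?G")
        case True
        define a where "a = 2 powr (real ?j / ?p) * norm (F ?j y)"
        have "ennreal a \<le> h y"
          unfolding h_def a_def using pp(3) by (intro SUP_upper2[of "J + i"]) auto
        have rooti: "(2 powr (- 1 / (2 * ?p))) ^ i = (2::real) powr (- (real i / (2 * ?p)))"
          by (simp add: powr_powr flip: powr_realpow)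
        have "l * 2 powr (real J / ?p) \<le> l * 2 powr (real ?j / ?p - real i / (2 * ?p))"
        proof (intro mult_left_mono powr_mono)
          have "real ?j / ?p - real i / (2 * ?p) - real J / ?p = (1 + real i / 2) / ?p"
            using pp(1) by (simp add: field_simps)
          also have "\<dots> \<ge> 0" using pp(1) by simp
          finally show "real J / ?p \<le> real ?j / ?p - real i / (2 * ?p)" by simp
        qed (use l in auto)
        also have "\<dots> = 2 powr (real ?j / ?p) * (l * (2 powr (- 1 / (2 * ?p))) ^ i)"
          unfolding rooti diff_conv_add_uminus powr_add by (rule mult.left_commute)
        also have "\<dots> < a" unfolding a_def using True by (intro mult_strict_left_mono) auto
        finally have "T J < ennreal a" unfolding T_def using l by (intro ennreal_lessI) (auto intro: le_less_trans[rotated])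
        then have "T J < h y" using \<open>ennreal a \<le> h y\<close> by (rule less_le_trans)
        have "norm (F ?j y) powr ?p = 1 / 2 ^ ?j * a powr ?p"
        proof -
          have "(2 powr (real ?j / ?p)) powr ?p = (2::real) ^ ?j"
            unfolding powr_powr using pp(1) by (simp add: powr_realpow del: of_nat_Suc power_Suc)
          then show ?thesis unfolding a_def by (simp add: powr_mult del: of_nat_Suc power_Suc)
        qed
        then have "ennreal (norm (F ?j y) powr ?p) = ennreal (1 / 2 ^ ?j) * ennreal_powr (ennreal a) ?p"
          by (simp add: a_def ennreal_mult'[symmetric] del: power_Suc)
        also have "\<dots> \<le> ennreal (1 / 2 ^ ?j) * ennreal_powr (h y) ?p"
          using pp(1) by (intro mult_left_mono ennreal_powr_mono \<open>ennreal a \<le> h y\<close>) auto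
        finally show ?thesis using True \<open>T J < h y\<close> by simp
      qed simp
      have "(\<integral>\<^sup>+y. ennreal (norm (F ?j y) powr ?p) * indicator (?D \<inter> ?G) y \<partial>lborel) \<le>
          (\<integral>\<^sup>+y. ennreal (1 / 2 ^ ?j) * ?v J y \<partial>lborel)"
        by (intro nn_integral_mono pt)
      also have "\<dots> = ennreal (1 / 2 ^ ?j) * (\<integral>\<^sup>+y. ?v J y \<partial>lborel)"
        by (rule nn_integral_cmult) (simp add: T_def)
      also have "\<dots> \<le> ennreal (1 / 2 ^ ?j) * ennreal \<sigma>"
        using J0[OF J] by (intro mult_left_mono) auto
      also have "\<dots> = ennreal (\<sigma> / 2 ^ ?j)" by (simp add: ennreal_mult'[symmetric] del: power_Suc)
      finally show "(\<integral>\<^sup>+y. ennreal (norm (F ?j y) powr ?p) * indicator (?D \<inter> ?G) y \<partial>lborel) \<le> ennreal (\<sigma> / 2 ^ ?j)" .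
    qed
  qed
qed

end

section \<open>Characteristic functions in Besov-type and Triebel--Lizorkin-type spaces\<close>

lemma besov_type_norm_bound:
  assumes "besov_type_norm \<phi>0 \<phi> s \<tau> p q f < \<infinity>"
  obtains N where "0 \<le> N" "\<And>j k. lq_norm_from (nat j) q (\<lambda>i. ennreal (2 powr (real i * s)) *
      Lp_norm (lebesgue_on (dyadic_cube j k)) p
        (\<lambda>x. ennreal (norm (distr_convolution (dyadic_dilate \<phi>0 \<phi> i) f x))))
    \<le> ennreal (N * measure lebesgue (dyadic_cube j k) powr \<tau>)"
proof -
  obtain N where N: "besov_type_norm \<phi>0 \<phi> s \<tau> p q f = ennreal N" "0 \<le> N"
    using assms by (cases "besov_type_norm \<phi>0 \<phi> s \<tau> p q f") auto
  have "lq_norm_from (nat j) q (\<lambda>i. ennreal (2 powr (real i * s)) *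
      Lp_norm (lebesgue_on (dyadic_cube j k)) p
        (\<lambda>x. ennreal (norm (distr_convolution (dyadic_dilate \<phi>0 \<phi> i) f x))))
    \<le> ennreal (N * measure lebesgue (dyadic_cube j k) powr \<tau>)" (is "?L \<le> _") for j k
  proof -
    let ?m = "measure lebesgue (dyadic_cube j k) powr \<tau>"
    have m: "0 < ?m" by (simp add: measure_dyadic_cube)
    have "ennreal (1 / ?m) * ?L \<le> ennreal N"
      unfolding N(1)[symmetric] besov_type_norm_def by (rule SUP_upper2[of "(j, k)"]) (auto simp: Let_def)
    then show ?thesis using cmult_le_ennreal[of "1 / ?m" ?L N] m by simp
  qed
  with N(2) that show thesis by blast
qed

lemma triebel_lizorkin_type_norm_bound:
  assumes "triebel_lizorkin_type_norm \<phi>0 \<phi> s \<tau> p q f < \<infinity>"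
  obtains N where "0 \<le> N" "\<And>j k. Lp_norm (lebesgue_on (dyadic_cube j k)) p (\<lambda>x.
        lq_norm_from (nat j) q (\<lambda>i. ennreal (2 powr (real i * s)) *
          ennreal (norm (distr_convolution (dyadic_dilate \<phi>0 \<phi> i) f x))))
    \<le> ennreal (N * measure lebesgue (dyadic_cube j k) powr \<tau>)"
proof -
  obtain N where N: "triebel_lizorkin_type_norm \<phi>0 \<phi> s \<tau> p q f = ennreal N" "0 \<le> N"
    using assms by (cases "triebel_lizorkin_type_norm \<phi>0 \<phi> s \<tau> p q f") auto
  have "Lp_norm (lebesgue_on (dyadic_cube j k)) p (\<lambda>x.
        lq_norm_from (nat j) q (\<lambda>i. ennreal (2 powr (real i * s)) *
          ennreal (norm (distr_convolution (dyadic_dilate \<phi>0 \<phi> i) f x))))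
    \<le> ennreal (N * measure lebesgue (dyadic_cube j k) powr \<tau>)" (is "?L \<le> _") for j k
  proof -
    let ?m = "measure lebesgue (dyadic_cube j k) powr \<tau>"
    have m: "0 < ?m" by (simp add: measure_dyadic_cube)
    have "ennreal (1 / ?m) * ?L \<le> ennreal N"
      unfolding N(1)[symmetric] triebel_lizorkin_type_norm_def by (rule SUP_upper2[of "(j, k)"]) (auto simp: Let_def)
    then show ?thesis using cmult_le_ennreal[of "1 / ?m" ?L N] m by simp
  qed
  with N(2) that show thesis by blast
qed

lemma distr_convolution_indicator:
  fixes \<phi> :: "real^'n::finite \<Rightarrow> complex"
  assumes \<phi>: "\<phi> \<in> borel_measurable borel" and E': "E' \<in> sets lebesgue" and E: "E \<in> sets borel"
    and eq: "E \<union> T = E'" "T \<in> null_sets lebesgue"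
  shows "distr_convolution (dyadic_dilate \<phi>0 \<phi> (Suc j)) (regular_distribution (indicator E')) x
    = mollify (dil (Suc j) \<phi>) E x"
proof -
  have dil: "dyadic_dilate \<phi>0 \<phi> (Suc j) = dil (Suc j) \<phi>"
    unfolding dyadic_dilate_def dil_def by simp
  have [measurable]: "(\<lambda>y. dil (Suc j) \<phi> (x - y)) \<in> borel_measurable borel" using \<phi> by measurable
  have "distr_convolution (dyadic_dilate \<phi>0 \<phi> (Suc j)) (regular_distribution (indicator E')) x
    = (LINT y|lebesgue. indicator E' y * dil (Suc j) \<phi> (x - y))"
    by (simp add: distr_convolution_def regular_distribution_def dil)
  also have "\<dots> = (LINT y|lebesgue. indicator E y * dil (Suc j) \<phi> (x - y))"
  proof (rule integral_cong_AE)
    have "(\<lambda>y. dil (Suc j) \<phi> (x - y)) \<in> borel_measurable lebesgue"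
      by (intro measurable_completion) simp
    then show "(\<lambda>y. indicator E' y * dil (Suc j) \<phi> (x - y)) \<in> borel_measurable lebesgue"
      "(\<lambda>y. indicator E y * dil (Suc j) \<phi> (x - y)) \<in> borel_measurable lebesgue"
      using E' E by (auto intro!: borel_measurable_times borel_measurable_indicator)
    show "AE y in lebesgue. indicator E' y * dil (Suc j) \<phi> (x - y) = indicator E y * dil (Suc j) \<phi> (x - y)"
      using AE_not_in[OF eq(2)] by eventually_elim (use eq(1) in \<open>auto simp: indicator_def\<close>)
  qed
  also have "\<dots> = (LINT y|lborel. indicator E y * dil (Suc j) \<phi> (x - y))"
    using E by (intro integral_completion) simp
  finally show ?thesis by (simp add: mollify_def)
qed

theorem theorem4p7:
  fixes E :: "(real^'n::finite) set"
    and \<phi>0 \<phi> :: "real^'n \<Rightarrow> complex"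
    and s \<tau> :: real and p :: ennreal
  assumes "admissible_pair \<phi>0 \<phi>"
    and "bounded E" and "E \<in> sets lebesgue" and "emeasure lebesgue E > 0"
    and "1 \<le> p" and "0 < \<tau>"
  shows
    "(\<forall>q::ennreal. 0 < q \<and> q < \<infinity> \<longrightarrow>
        regular_distribution (indicator E) \<notin> besov_type_space \<phi>0 \<phi> (enn2real (1 / p)) \<tau> p q) \<and>
     (p < \<infinity> \<longrightarrow> (\<forall>q::ennreal. 1 \<le> q \<longrightarrow>
        regular_distribution (indicator E)
          \<notin> triebel_lizorkin_type_space \<phi>0 \<phi> (enn2real (1 / p)) \<tau> p q)) \<and>
     (s > real CARD('n) * (enn2real (1 / p) - \<tau>) \<longrightarrow> (\<forall>q::ennreal. 1 \<le> q \<longrightarrow>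
        regular_distribution (indicator E) \<notin> besov_type_space \<phi>0 \<phi> s \<tau> p q)) \<and>
     (p < \<infinity> \<longrightarrow> s > real CARD('n) * (enn2real (1 / p) - \<tau>) \<longrightarrow> (\<forall>q::ennreal. 1 \<le> q \<longrightarrow>
        regular_distribution (indicator E) \<notin> triebel_lizorkin_type_space \<phi>0 \<phi> s \<tau> p q))"
proof -
  note p = \<open>1 \<le> p\<close>
  obtain \<Phi> \<psi> C where K: "reproducing_kernels \<phi> \<Phi> \<psi> C" and rapid: "rapid \<phi>"
    by (rule kernels_of_admissible_pair[OF assms(1)])
  \<comment> \<open>A Borel set that differs from \<open>E\<close> by a null set gives the same distribution.\<close>
  obtain E1 T where E1: "fsigma E1" "T \<in> null_sets lebesgue" "E1 \<union> T = E"
    using lebesgue_set_almost_fsigma[OF assms(3)] by metis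
  have E1_borel: "E1 \<in> sets borel"
    using E1(1) by (auto elim!: fsigma.cases)
  interpret mollified_set \<phi> \<Phi> \<psi> C E1
  proof (intro mollified_set.intro mollified_set_axioms.intro K E1_borel)
    show "bounded E1" using bounded_subset[OF assms(2)] E1(3) by blast
  qed
  have not_null: "emeasure lborel E1 \<noteq> 0"
  proof
    assume "emeasure lborel E1 = 0"
    then have "E1 \<in> null_sets lebesgue"
      using E1_borel by (intro null_sets_completionI) (simp add: null_sets_def)
    then have "E \<in> null_sets lebesgue" using E1(2,3) null_sets.Un by blast
    then show False using assms(4) by (simp add: null_sets_def)
  qed
  let ?f = "regular_distribution (indicator E)"
  let ?G = "\<lambda>i x. distr_convolution (dyadic_dilate \<phi>0 \<phi> i) ?f x"
  have G: "?G (Suc j) x = F (Suc j) x" for j x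
    by (rule distr_convolution_indicator[OF meas(1) assms(3) E1_borel E1(3,2)])
  have F_meas: "(\<lambda>x. ennreal (norm (F j x))) \<in> borel_measurable (lebesgue_on P)" for j P
    by (intro measurable_restrict_space1 measurable_completion) simp
  have iii: False
    if fin: "besov_type_norm \<phi>0 \<phi> s \<tau> p q ?f < \<infinity>" and "0 < q" "s > real CARD('n) * (enn2real (1 / p) - \<tau>)" for q s
  proof -
    obtain N where N: "0 \<le> N" "\<And>j k. lq_norm_from (nat j) q (\<lambda>i. ennreal (2 powr (real i * s)) *
      Lp_norm (lebesgue_on (dyadic_cube j k)) p (\<lambda>x. ennreal (norm (?G i x))))
      \<le> ennreal (N * measure lebesgue (dyadic_cube j k) powr \<tau>)"
      by (rule besov_type_norm_bound[OF fin]) (assumption | rule that)+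
    have "emeasure lborel E1 = 0"
    proof (rule null_if_cube_norms_bounded[OF p that(3) N(1)])
      fix j and k :: "int^'n"
      let ?a = "\<lambda>i. ennreal (2 powr (real i * s)) *
        Lp_norm (lebesgue_on (dyadic_cube (int (Suc j)) k)) p (\<lambda>x. ennreal (norm (?G i x)))"
      have "?a (Suc j) \<le> lq_norm_from (Suc j) q ?a" using lq_norm_from_ge[OF that(2), of ?a "Suc j" 0] by simp
      also have "\<dots> \<le> ennreal (N * measure lebesgue (dyadic_cube (int (Suc j)) k) powr \<tau>)"
        using N(2)[of "int (Suc j)" k] by (simp only: nat_int)
      finally show "ennreal (2 powr (real (Suc j) * s)) * Lp_norm (lebesgue_on (dyadic_cube (int (Suc j)) k)) p
          (\<lambda>x. ennreal (norm (F (Suc j) x)))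
        \<le> ennreal (N * measure lebesgue (dyadic_cube (int (Suc j)) k) powr \<tau>)"
        by (simp only: G)
    qed
    with not_null show False by simp
  qed
  have iv: False
    if fin: "triebel_lizorkin_type_norm \<phi>0 \<phi> s \<tau> p q ?f < \<infinity>" and "0 < q" "p < \<infinity>"
      "s > real CARD('n) * (enn2real (1 / p) - \<tau>)" for q s
  proof -
    obtain N where N: "0 \<le> N" "\<And>j k. Lp_norm (lebesgue_on (dyadic_cube j k)) p (\<lambda>x.
        lq_norm_from (nat j) q (\<lambda>i. ennreal (2 powr (real i * s)) * ennreal (norm (?G i x))))
      \<le> ennreal (N * measure lebesgue (dyadic_cube j k) powr \<tau>)"
      by (rule triebel_lizorkin_type_norm_bound[OF fin]) (assumption | rule that)+
    have "emeasure lborel E1 = 0"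
    proof (rule null_if_cube_norms_bounded[OF p that(4) N(1)])
      fix j and k :: "int^'n"
      let ?P = "dyadic_cube (int (Suc j)) k"
      let ?a = "\<lambda>x i. ennreal (2 powr (real i * s)) * ennreal (norm (?G i x))"
      have "ennreal (2 powr (real (Suc j) * s)) * Lp_norm (lebesgue_on ?P) p (\<lambda>x. ennreal (norm (F (Suc j) x)))
          = Lp_norm (lebesgue_on ?P) p (\<lambda>x. ?a x (Suc j))"
        unfolding G by (rule Lp_norm_cmult[symmetric, OF p that(3) _ F_meas]) simp
      also have "\<dots> \<le> Lp_norm (lebesgue_on ?P) p (\<lambda>x. lq_norm_from (Suc j) q (?a x))"
      proof (intro Lp_norm_mono p that(3))
        show "?a x (Suc j) \<le> lq_norm_from (Suc j) q (?a x)" for x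
          using lq_norm_from_ge[OF that(2), of "?a x" "Suc j" 0] by simp
      qed
      also have "\<dots> \<le> ennreal (N * measure lebesgue ?P powr \<tau>)"
        using N(2)[of "int (Suc j)" k] by (simp only: nat_int)
      finally show "ennreal (2 powr (real (Suc j) * s)) * Lp_norm (lebesgue_on ?P) p
          (\<lambda>x. ennreal (norm (F (Suc j) x))) \<le> ennreal (N * measure lebesgue ?P powr \<tau>)" .
    qed
    with not_null show False by simp
  qed
  have i: False
    if fin: "besov_type_norm \<phi>0 \<phi> (enn2real (1 / p)) \<tau> p q ?f < \<infinity>" and "0 < q" "q < \<infinity>" for q
  proof (cases "p < \<infinity>")
    case False
    \<comment> \<open>Here the smoothness is \<open>0\<close>, which exceeds \<open>- n \<tau>\<close>.\<close>
    then have "p = \<infinity>" using less_top[of p] by auto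
    then show False using iii[OF that(1,2)] \<open>0 < \<tau>\<close> by simp
  next
    case True
    let ?s = "enn2real (1 / p)"
    obtain N where N: "0 \<le> N" "\<And>j k. lq_norm_from (nat j) q (\<lambda>i. ennreal (2 powr (real i * ?s)) *
      Lp_norm (lebesgue_on (dyadic_cube j k)) p (\<lambda>x. ennreal (norm (?G i x))))
      \<le> ennreal (N * measure lebesgue (dyadic_cube j k) powr \<tau>)"
      by (rule besov_type_norm_bound[OF fin]) (assumption | rule that)+
    have "emeasure lborel E1 = 0"
    proof (rule null_if_cube_norms_tend_to_0[OF rapid p True])
      fix m :: nat and k :: "int^'n" and e :: real assume e: "0 < e"
      let ?a = "\<lambda>i. ennreal (2 powr (real i * ?s)) *
        Lp_norm (lebesgue_on (dyadic_cube (- int m) k)) p (\<lambda>x. ennreal (norm (?G i x)))"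
      have "lq_norm_from 0 q ?a < \<infinity>"
        using le_less_trans[OF N(2)[of "- int m" k], of \<infinity>] by simp
      then have "eventually (\<lambda>j. ?a j \<le> ennreal e) sequentially"
        by (rule lq_norm_from_finite_tendsto_0[OF that(2,3) _ e])
      then show "eventually (\<lambda>j. ennreal (2 powr (real j * ?s)) *
          Lp_norm (lebesgue_on (dyadic_cube (- int m) k)) p (\<lambda>x. ennreal (norm (F j x))) \<le> ennreal e) sequentially"
        using eventually_ge_at_top[of 1]
      proof eventually_elim
        fix j :: nat assume a: "?a j \<le> ennreal e" and "1 \<le> j"
        from \<open>1 \<le> j\<close> obtain i where "j = Suc i" by (cases j) auto
        with a show "ennreal (2 powr (real j * ?s)) *
          Lp_norm (lebesgue_on (dyadic_cube (- int m) k)) p (\<lambda>x. ennreal (norm (F j x))) \<le> ennreal e"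
          by (simp only: G)
      qed
    qed
    with not_null show False by simp
  qed
  have ii: False
    if fin: "triebel_lizorkin_type_norm \<phi>0 \<phi> (enn2real (1 / p)) \<tau> p q ?f < \<infinity>" and "0 < q" "p < \<infinity>" for q
  proof -
    let ?s = "enn2real (1 / p)"
    obtain N where N: "0 \<le> N" "\<And>j k. Lp_norm (lebesgue_on (dyadic_cube j k)) p (\<lambda>x.
        lq_norm_from (nat j) q (\<lambda>i. ennreal (2 powr (real i * ?s)) * ennreal (norm (?G i x))))
      \<le> ennreal (N * measure lebesgue (dyadic_cube j k) powr \<tau>)"
      by (rule triebel_lizorkin_type_norm_bound[OF fin]) (assumption | rule that)+
    have "emeasure lborel E1 = 0"
    proof (rule null_if_maximal_function_Lp[OF rapid p that(3)])
      fix m :: nat and k :: "int^'n"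
      let ?P = "dyadic_cube (- int m) k"
      let ?a = "\<lambda>x i. ennreal (2 powr (real i * ?s)) * ennreal (norm (?G i x))"
      have "Lp_norm (lebesgue_on ?P) p (\<lambda>x. SUP j. ennreal (2 powr (real (Suc j) * ?s) * norm (F (Suc j) x)))
          \<le> Lp_norm (lebesgue_on ?P) p (\<lambda>x. lq_norm_from 0 q (?a x))"
      proof (intro Lp_norm_mono p that(3) SUP_least)
        fix x j
        have "ennreal (2 powr (real (Suc j) * ?s) * norm (F (Suc j) x)) = ?a x (Suc j)"
          unfolding G by (rule ennreal_mult') simp
        also have "\<dots> \<le> lq_norm_from 0 q (?a x)"
          using lq_norm_from_ge[OF that(2), of "?a x" 0 "Suc j"] by simp
        finally show "ennreal (2 powr (real (Suc j) * ?s) * norm (F (Suc j) x)) \<le> lq_norm_from 0 q (?a x)" .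
      qed
      also have "\<dots> \<le> ennreal (N * measure lebesgue ?P powr \<tau>)" using N(2)[of "- int m" k] by simp
      also have "\<dots> < \<infinity>" by simp
      finally show "Lp_norm (lebesgue_on ?P) p
        (\<lambda>x. SUP j. ennreal (2 powr (real (Suc j) * ?s) * norm (F (Suc j) x))) < \<infinity>" .
    qed
    with not_null show False by simp
  qed
  have pos: "1 \<le> q \<Longrightarrow> 0 < q" for q :: ennreal
    by (rule less_le_trans[of _ 1]) simp_all
  show ?thesis
    unfolding besov_type_space_def triebel_lizorkin_type_space_def
    using i ii iii iv pos by blast
qed

end
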